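(* A single-harmonic perturbation of the sphere realizes only equilibrium classes on the diagonal of the $(S,U)$ lattice: for integers $\ell\ge2$ and $1\le m\le\ell$, the homogeneous body $B_\varepsilon$ with radial boundary $r(u)=1+\varepsilon Y_\ell^m(u)$, $u\in S^2$ (with $\varepsilon$ any value in the convex range if $m\ge2$, and $\varepsilon>0$ sufficiently small if $m=1$) has $S=U=m(\ell-m+1)$. The set of reachable values is $$\{\,m(\ell-m+1):\ \ell\ge2,\ 1\le m\le\ell\,\}=\{2,3,4,5,6,\dots\},$$ i.e. exactly the integers $\ge2$ occur; for instance the value $n\ge2$ is realized by $Y_n^1$.
   Context: $(\theta,\phi)$ are spherical coordinates on $S^2\subset\mathbb{R}^3$, with colatitude $\theta\in[0,\pi]$ and longitude $\phi$. For $1\le m\le\ell$, $Y_\ell^m(\theta,\phi)=P_\ell^m(\cos\theta)\cos(m\phi)$, where $P_\ell^m(x)=(1-x^2)^{m/2}\,\frac{d^m}{dx^m}P_\ell(x)$ and $P_\ell$ is the Legendre polynomial of degree $\ell$. For $\varepsilon$ with $r=1+\varepsilon Y_\ell^m>0$ on $S^2$, $B_\varepsilon=\{t\,u:u\in S^2,\ 0\le t\le r(u)\}$, taken with uniform mass density, and $\mathbf{c}$ is its centroid. The convex range is the set of $\varepsilon>0$ such that $r>0$ on $S^2$ and $B_\varepsilon$ is convex. The static equilibria of $B_\varepsilon$ are the critical points of $\rho(u)=|r(u)u-\mathbf{c}|^2$ on $S^2$; local minima of $\rho$ are stable equilibria and local maxima are unstable equilibria. $S$ and $U$ are the numbers of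 stable and unstable equilibria, and $(S,U)$ is the equilibrium class of the body. *)

theory Defs
  imports "HOL-Analysis.Analysis" "HOL-Computational_Algebra.Polynomial"
begin

(* Rodrigues' formula. *)
definition legendre_poly :: "nat \<Rightarrow> real poly" where
  "legendre_poly l = smult (1 / (2 ^ l * fact l)) ((pderiv ^^ l) ([:-1, 0, 1:] ^ l))"

(* No Condon-Shortley sign.  For m >= 1 the value at x = 1 and x = -1 is 0, since 0 powr a = 0. *)
definition assoc_legendre :: "nat \<Rightarrow> nat \<Rightarrow> real \<Rightarrow> real" where
  "assoc_legendre l m x = (1 - x\<^sup>2) powr (real m / 2) * poly ((pderiv ^^ m) (legendre_poly l)) x"

definition colatitude :: "real ^ 3 \<Rightarrow> real" where
  "colatitude u = arccos (u $ 3)"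

(* At the poles this is Arg 0 = 0; the choice is immaterial below, as the harmonics with m >= 1
   vanish there. *)
definition longitude :: "real ^ 3 \<Rightarrow> real" where
  "longitude u = Arg (Complex (u $ 1) (u $ 2))"

definition harmonic :: "nat \<Rightarrow> nat \<Rightarrow> real ^ 3 \<Rightarrow> real" where
  "harmonic l m u = assoc_legendre l m (cos (colatitude u)) * cos (real m * longitude u)"

definition radius :: "nat \<Rightarrow> nat \<Rightarrow> real \<Rightarrow> real ^ 3 \<Rightarrow> real" where
  "radius l m \<epsilon> u = 1 + \<epsilon> * harmonic l m u"

definition body :: "nat \<Rightarrow> nat \<Rightarrow> real \<Rightarrow> (real ^ 3) set" where
  "body l m \<epsilon> = {t *\<^sub>R u | t u. u \<in> sphere 0 1 \<and> 0 \<le> t \<and> t \<le> radius l m \<epsilon> u}"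

definition convex_range :: "nat \<Rightarrow> nat \<Rightarrow> real set" where
  "convex_range l m =
     {\<epsilon>. \<epsilon> > 0 \<and> (\<forall>u\<in>sphere 0 1. radius l m \<epsilon> u > 0) \<and> convex (body l m \<epsilon>)}"

definition centroid :: "(real ^ 3) set \<Rightarrow> real ^ 3" where
  "centroid B = (1 / measure lebesgue B) *\<^sub>R integral B (\<lambda>x. x)"

definition sq_dist :: "nat \<Rightarrow> nat \<Rightarrow> real \<Rightarrow> real ^ 3 \<Rightarrow> real" where
  "sq_dist l m \<epsilon> u = (norm (radius l m \<epsilon> u *\<^sub>R u - centroid (body l m \<epsilon>)))\<^sup>2"

(* The derivative is taken within the sphere, so that only tangential directions count:
   f x - f u = o(|x - u|) for x on the sphere, i.e. df vanishes on the tangent plane at u. *)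
definition critical_on_sphere :: "(real ^ 3 \<Rightarrow> real) \<Rightarrow> real ^ 3 \<Rightarrow> bool" where
  "critical_on_sphere f u \<longleftrightarrow>
     u \<in> sphere 0 1 \<and> (f has_derivative (\<lambda>_. 0)) (at u within sphere 0 1)"

definition equilibria :: "nat \<Rightarrow> nat \<Rightarrow> real \<Rightarrow> (real ^ 3) set" where
  "equilibria l m \<epsilon> = {u. critical_on_sphere (sq_dist l m \<epsilon>) u}"

definition stable_equilibria :: "nat \<Rightarrow> nat \<Rightarrow> real \<Rightarrow> (real ^ 3) set" where
  "stable_equilibria l m \<epsilon> = {u \<in> equilibria l m \<epsilon>.
     \<forall>\<^sub>F x in at u within sphere 0 1. sq_dist l m \<epsilon> u \<le> sq_dist l m \<epsilon> x}"

definition unstable_equilibria :: "nat \<Rightarrow> nat \<Rightarrow> real \<Rightarrow> (real ^ 3) set" where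
  "unstable_equilibria l m \<epsilon> = {u \<in> equilibria l m \<epsilon>.
     \<forall>\<^sub>F x in at u within sphere 0 1. sq_dist l m \<epsilon> x \<le> sq_dist l m \<epsilon> u}"

(* card is 0 on infinite sets, so a class with positive entries entails finiteness. *)
definition equilibrium_class :: "nat \<Rightarrow> nat \<Rightarrow> real \<Rightarrow> nat \<times> nat" where
  "equilibrium_class l m \<epsilon> = (card (stable_equilibria l m \<epsilon>), card (unstable_equilibria l m \<epsilon>))"

(* For m = 1 only sufficiently small amplitudes are admitted, so a class counts as realized if it
   is the class of all convex bodies of sufficiently small amplitude; for other m any
   amplitude in the convex range will do. *)
definition realizes :: "nat \<Rightarrow> nat \<Rightarrow> nat \<times> nat \<Rightarrow> bool" where
  "realizes l m c \<longleftrightarrow>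
     (if m = 1
      then \<forall>\<^sub>F \<epsilon> in at_right 0. \<epsilon> \<in> convex_range l m \<and> equilibrium_class l m \<epsilon> = c
      else \<exists>\<epsilon>\<in>convex_range l m. equilibrium_class l m \<epsilon> = c)"

definition reachable_classes :: "(nat \<times> nat) set" where
  "reachable_classes = {c. \<exists>l m. 2 \<le> l \<and> 1 \<le> m \<and> m \<le> l \<and> realizes l m c}"

end

theory Submission
  imports Defs
begin

text \<open>
  Write Q for the m-th derivative of the Legendre polynomial of degree l, and w = x + i y.  On the
  sphere the harmonic is the polynomial Y = Q(z) Re (w^m), and by symmetry the centroid lies on the
  axis of the body for m \<ge> 2 and on the x-axis for m = 1.

  For m \<ge> 2 the centroid is the origin: besides the rotation by 2 pi / m there is a symmetry
  reversing the axis, namely the reflection in z, combined with the rotation by pi / m if l + m is odd.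
  The squared distance to the centroid is then (1 + \<epsilon> Y)^2, and as the radius is positive its
  local extrema are those of Y.  All l - m roots of Q are real, simple and inside (-1, 1), so
  log |(1 - z^2)^(m/2) Q(z)| is strictly concave between consecutive zeros, and there is exactly one
  stationary height in each of the l - m + 1 gaps (latitude_poly_zero, latitude_poly_card).  At each
  such height Y has m maxima and m minima in the longitude; every other critical point is a zero of
  Y and no extremum (card_sphere_max_harm).

  For m = 1 the centroid is (k, 0, 0), and k need not vanish.  But Y is orthogonal to linear functions
  if l \<ge> 2, so k is of order \<epsilon>^2 (centroid_second_order), and the squared distance is an
  increasing affine function of a small perturbation of Y.  Off the great circle y = 0 the perturbed
  function has only saddles.  On this circle the critical points of Y are nondegenerate, so they
  persist: there is still exactly one in each gap between zeros of Y, which leaves l maxima and l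
  minima (card_sphere_max_pharm).  That the body is convex for small \<epsilon> is seen from
  explicit supporting half-spaces (convex_body_small).

  The products m (l - m + 1) with l \<ge> 2 are at least 2, and m = 1 already gives every such number.
\<close>

section \<open>Real roots of derivatives of Legendre polynomials\<close>

text \<open>
  Rolle's theorem applied to neighbouring zeros and counted.  The points found are also kept
  away from the zeros themselves: if f' factors, as it does in latitude_poly_card, this tells which
  factor vanishes.
\<close>
lemma rolle_count:
  fixes f f' :: "real \<Rightarrow> real"
  assumes "finite Z" "card Z = Suc n" "\<And>z. z \<in> Z \<Longrightarrow> f z = 0"
    and f': "\<And>x. (f has_real_derivative f' x) (at x)"
  shows "\<exists>W. finite W \<and> card W = n \<and> (\<forall>x\<in>W. Min Z < x \<and> x < Max Z \<and> x \<notin> Z \<and> f' x = 0)"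
  using assms(1-3)
proof (induction n arbitrary: Z)
  case 0
  then show ?case by (intro exI[of _ "{}"]) auto
next
  case (Suc n)
  define M where "M = Max Z"
  define Z0 where "Z0 = Z - {M}"
  have Zne: "Z \<noteq> {}" using Suc.prems by auto
  have MZ: "M \<in> Z" using Zne Suc.prems by (simp add: M_def)
  have c0: "card Z0 = Suc n" using MZ Suc.prems by (simp add: Z0_def)
  have fin0: "finite Z0" using Suc.prems by (simp add: Z0_def)
  obtain W where W: "finite W" "card W = n"
      "\<forall>x\<in>W. Min Z0 < x \<and> x < Max Z0 \<and> x \<notin> Z0 \<and> f' x = 0"
    using Suc.IH[OF fin0 c0] Suc.prems(3) by (auto simp: Z0_def)
  have Z0ne: "Z0 \<noteq> {}" using c0 by auto
  have mx0: "Max Z0 \<in> Z0" using Z0ne fin0 by simp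
  hence lt: "Max Z0 < M" using Suc.prems(1) by (auto simp: Z0_def M_def order.not_eq_order_implies_strict)
  have cont: "continuous_on {Max Z0..M} f"
    by (rule DERIV_continuous_on) (rule has_field_derivative_at_within[OF f'])
  have diff: "f differentiable (at x)" for x using f' real_differentiable_def by blast
  have eq: "f (Max Z0) = f M" using Suc.prems(3)[of "Max Z0"] Suc.prems(3)[OF MZ] mx0 by (simp add: Z0_def)
  have "\<exists>x. Max Z0 < x \<and> x < M \<and> (f has_real_derivative 0) (at x)"
    using Rolle[OF lt eq cont diff] by blast
  then obtain x where x: "Max Z0 < x" "x < M" "(f has_real_derivative 0) (at x)" by blast
  have fx: "f' x = 0" using DERIV_unique[OF f' x(3)] .
  have mn: "Min Z = Min Z0"
  proof -
    have "Z = insert M Z0" using MZ by (auto simp: Z0_def)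
    moreover have le: "Min Z0 \<le> Max Z0" using fin0 Z0ne mx0 by simp
    ultimately have "Min Z = min M (Min Z0)" using fin0 Z0ne by (metis Min_insert)
    thus ?thesis using lt le by (simp add: min_def)
  qed
  have xnZ: "x \<notin> Z" using x fin0 by (metis DiffI M_def Max_ge Z0_def insertE less_irrefl not_less singletonD)
  have "x \<notin> W" using W(3) x by auto
  moreover have "Min Z < x" using mn x(1) fin0 Z0ne mx0 by (metis Min_le order_le_less_trans)
  ultimately have new: "x \<notin> W" "Min Z < x" by auto
  have old: "Min Z < y \<and> y < M \<and> y \<notin> Z \<and> f' y = 0" if "y \<in> W" for y
  proof -
    have y: "Min Z0 < y" "y < Max Z0" "y \<notin> Z0" "f' y = 0" using W(3) that by auto
    have "y < M" using y(2) lt by (rule less_trans)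
    thus ?thesis using y mn by (simp add: Z0_def)
  qed
  have "finite (insert x W) \<and> card (insert x W) = Suc n" using W new by simp
  moreover have "\<forall>y\<in>insert x W. Min Z < y \<and> y < Max Z \<and> y \<notin> Z \<and> f' y = 0"
    using old new fx xnZ x(2) unfolding M_def[symmetric] by simp
  ultimately show ?case by blast
qed

text \<open>
  A function that crosses zero only downwards cannot cross twice.  Between two
  zeros that are both crossed downwards there would be a first return to zero, and it would be
  reached from below.
\<close>
lemma at_most_one_zero:
  fixes k k' :: "real \<Rightarrow> real"
  assumes d: "\<And>t. (k has_real_derivative k' t) (at t)"
    and neg: "\<And>t. \<lbrakk>a < t; t < b; k t = 0\<rbrakk> \<Longrightarrow> k' t < 0"
    and x: "a < x" "x < b" "k x = 0" and y: "a < y" "y < b" "k y = 0"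
  shows "x = y"
proof -
  have False if xy: "a < x" "x < y" "y < b" "k x = 0" "k y = 0" for x y
  proof -
    have cont: "continuous_on S k" for S using d by (meson DERIV_continuous_on has_field_derivative_at_within)
    obtain e where e: "e > 0" "\<And>h. 0 < h \<Longrightarrow> h < e \<Longrightarrow> k (x + h) < k x"
      using has_real_derivative_neg_dec_right[of k "k' x" x UNIV] d neg xy by force
    define x1 where "x1 = x + min (e/2) ((y - x)/2)"
    have "0 < min (e/2) ((y - x)/2)" "min (e/2) ((y - x)/2) < e" "min (e/2) ((y - x)/2) < y - x"
      using e(1) xy by (auto simp: min_less_iff_disj)
    hence x1: "x < x1" "x1 < y" "k x1 < 0" 
      using e(2)[of "min (e/2) ((y - x)/2)"] xy by (auto simp: x1_def)
    define S where "S = {t\<in>{x1..y}. k t = 0}"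
    have "closed S" unfolding S_def
      using continuous_closed_preimage_constant[OF cont, of "{x1..y}" 0] by simp
    hence S: "compact S" "S \<noteq> {}" using xy x1
      by (auto simp: S_def compact_eq_bounded_closed intro: bounded_subset[OF bounded_closed_interval])
    (* The first zero to the right of x1. *)
    obtain t where t: "t \<in> S" "\<And>s. s \<in> S \<Longrightarrow> t \<le> s" using compact_attains_inf[OF S] by blast
    have kt': "k t = 0" "x1 \<le> t" "t \<le> y" using t(1) by (auto simp: S_def)
    hence "x1 \<noteq> t" using x1(3) by auto
    hence kt: "k t = 0" "x1 < t" "t \<le> y" using kt' by auto
    obtain e' where e': "e' > 0" "\<And>h. 0 < h \<Longrightarrow> h < e' \<Longrightarrow> k (t - h) > k t"
      using has_real_derivative_neg_dec_left[of k "k' t" t UNIV] d neg[of t] xy kt x1 by force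
    define t1 where "t1 = t - min (e'/2) ((t - x1)/2)"
    have "0 < min (e'/2) ((t - x1)/2)" "min (e'/2) ((t - x1)/2) < e'" "min (e'/2) ((t - x1)/2) < t - x1"
      using e'(1) kt by (auto simp: min_less_iff_disj)
    hence t1: "x1 < t1" "t1 < t" "k t1 > 0" 
      using e'(2)[of "min (e'/2) ((t - x1)/2)"] kt by (auto simp: t1_def)
    obtain s where "x1 \<le> s" "s \<le> t1" "k s = 0"
      using IVT'[of k x1 0 t1] x1 t1 cont by (auto intro: less_imp_le)
    hence "s \<in> S" using t1 kt by (auto simp: S_def)
    thus False using t(2)[of s] \<open>s \<le> t1\<close> t1 by auto
  qed
  thus ?thesis using x y by (metis linorder_neqE_linordered_idom)
qed

lemma pderiv_funpow_smult: "(pderiv ^^ n) (smult c p) = smult c ((pderiv ^^ n) (p :: real poly))"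
  by (induction n) (auto simp: pderiv_smult)

lemma degree_pderiv_funpow: "degree ((pderiv ^^ n) (p :: real poly)) = degree p - n"
  by (induction n) (auto simp: degree_pderiv)

lemma pderiv_funpow_nonzero: "p \<noteq> 0 \<Longrightarrow> n \<le> degree p \<Longrightarrow> (pderiv ^^ n) (p :: real poly) \<noteq> 0"
  by (induction n) (auto simp: pderiv_eq_0_iff degree_pderiv_funpow)

lemma power_dvd_pderiv_funpow:
  fixes p :: "real poly" shows "p ^ (l - k) dvd (pderiv ^^ k) (p ^ l)"
proof (induction k)
  case (Suc k)
  show ?case
  proof (cases "k < l")
    case True
    then obtain j where j: "l - k = Suc j" "l - Suc k = j" by (metis Suc_diff_Suc)
    from Suc j obtain q where "(pderiv ^^ k) (p ^ l) = p ^ Suc j * q" by (auto elim: dvdE)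
    hence "(pderiv ^^ Suc k) (p ^ l) = p ^ Suc j * pderiv q + q * (smult (of_nat (Suc j)) (p ^ j) * pderiv p)"
      by (simp only: funpow.simps o_apply pderiv_mult pderiv_power_Suc)
    also have "\<dots> = p ^ j * (p * pderiv q + smult (of_nat (Suc j)) (q * pderiv p))"
      by (simp only: power_Suc distrib_left mult_smult_left mult_smult_right mult_ac)
    finally have "p ^ j dvd (pderiv ^^ Suc k) (p ^ l)" by (metis dvd_triv_left)
    thus ?thesis using j by simp
  next
    case False
    hence "l - Suc k = 0" by simp
    thus ?thesis by (simp only: power_0 one_dvd)
  qed
qed simp

text \<open>
  The polynomial w = X^2 - 1 of Rodrigues' formula.
\<close>
abbreviation w_poly :: "real poly" where "w_poly \<equiv> [:-1, 0, 1:]"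

lemma poly_MVT_count:
  assumes "finite Z" "card Z = Suc n" "\<And>z. z \<in> Z \<Longrightarrow> poly p z = (0::real)"
  shows "\<exists>W. finite W \<and> card W = n \<and> (\<forall>x\<in>W. Min Z < x \<and> x < Max Z \<and> poly (pderiv p) x = 0)"
proof -
  obtain W where "finite W" "card W = n"
      "\<forall>x\<in>W. Min Z < x \<and> x < Max Z \<and> x \<notin> Z \<and> poly (pderiv p) x = 0"
    using rolle_count[of Z n "poly p" "poly (pderiv p)", OF assms poly_DERIV] by auto
  thus ?thesis by (intro exI[of _ W]) simp
qed

text \<open>
  As long as fewer than l derivatives are taken, w still divides the result, so the
  end points 1 and -1 join the k known zeros, and Rolle gives k + 1 zeros of the next derivative.
\<close>
lemma roots_below:
  assumes "k \<le> l"
  shows "\<exists>R. finite R \<and> card R = k \<and> (\<forall>x\<in>R. -1 < x \<and> x < 1 \<and> poly ((pderiv ^^ k) (w_poly ^ l)) x = 0)"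
  using assms
proof (induction k)
  case 0 then show ?case by (intro exI[of _ "{}"]) simp
next
  case (Suc k)
  then obtain R where R: "finite R" "card R = k"
    "\<forall>x\<in>R. -1 < x \<and> x < 1 \<and> poly ((pderiv ^^ k) (w_poly ^ l)) x = 0" using Suc_leD by blast
  obtain j where "l - k = Suc j" using Suc.prems by (metis Suc_diff_Suc less_eq_Suc_le)
  hence "w_poly * w_poly ^ j dvd (pderiv ^^ k) (w_poly ^ l)"
    using power_dvd_pderiv_funpow[of w_poly l k] by (simp only: power_Suc)
  then obtain q where q: "(pderiv ^^ k) (w_poly ^ l) = w_poly * w_poly ^ j * q" by (rule dvdE)
  have e: "poly ((pderiv ^^ k) (w_poly ^ l)) 1 = 0" "poly ((pderiv ^^ k) (w_poly ^ l)) (-1) = 0"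
    unfolding q poly_mult by simp_all
  define Z where "Z = insert (-1) (insert 1 R)"
  have "-1 \<notin> R" "1 \<notin> R" using R(3) by auto
  hence Z: "finite Z" "card Z = Suc (Suc k)" using R by (simp_all add: Z_def)
  have "Min Z = -1" using R(1,3) by (intro Min_eqI) (auto simp: Z_def intro: less_imp_le)
  moreover have "Max Z = 1" using R(1,3) by (intro Max_eqI) (auto simp: Z_def intro: less_imp_le)
  ultimately have Z': "Min Z = -1" "Max Z = 1" by auto
  obtain W where "finite W" "card W = Suc k"
      "\<forall>x\<in>W. Min Z < x \<and> x < Max Z \<and> poly (pderiv ((pderiv ^^ k) (w_poly ^ l))) x = 0"
    using poly_MVT_count[OF Z(1,2), of "(pderiv ^^ k) (w_poly ^ l)"] R(3) e unfolding Z_def by blast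
  thus ?case using Z' by (intro exI[of _ W]) simp
qed

text \<open>
  From the l-th derivative on the end points are no longer zeros, and each further
  derivative costs one zero.
\<close>
lemma roots_above:
  assumes "j \<le> l"
  shows "\<exists>R. finite R \<and> card R = l - j \<and> (\<forall>x\<in>R. -1 < x \<and> x < 1 \<and> poly ((pderiv ^^ (l + j)) (w_poly ^ l)) x = 0)"
  using assms
proof (induction j)
  case 0 then show ?case using roots_below[of l l] by simp
next
  case (Suc j)
  define D where "D = (pderiv ^^ (l + j)) (w_poly ^ l)"
  have D': "(pderiv ^^ (l + Suc j)) (w_poly ^ l) = pderiv D" by (simp add: D_def)
  have "\<exists>R. finite R \<and> card R = l - j \<and> (\<forall>x\<in>R. -1 < x \<and> x < 1 \<and> poly D x = 0)"
    using Suc.IH[OF Suc_leD[OF Suc.prems]] by (simp only: D_def)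
  then obtain R where R: "finite R" "card R = l - j"
    "\<forall>x\<in>R. -1 < x \<and> x < 1 \<and> poly D x = 0" by blast
  have c: "card R = Suc (l - Suc j)" using R Suc.prems by simp
  hence "R \<noteq> {}" by auto
  hence mm: "-1 < Min R" "Max R < 1" using R by auto
  obtain W where "finite W" "card W = l - Suc j"
      "\<forall>x\<in>W. Min R < x \<and> x < Max R \<and> poly (pderiv D) x = 0"
    using poly_MVT_count[OF R(1) c, of D] R(3) by blast
  thus ?case unfolding D' using mm by (intro exI[of _ W]) force
qed

text \<open>
  The m-th derivative of the Legendre polynomial of degree l: the factor of the harmonic
  that depends on the height z = cos \<theta> alone, once the power of sin \<theta> has been moved to
  the longitude factor.
\<close>
definition dleg :: "nat \<Rightarrow> nat \<Rightarrow> real poly" where "dleg l m = (pderiv ^^ m) (legendre_poly l)"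

lemma dleg_eq: "dleg l m = smult (1 / (2 ^ l * fact l)) ((pderiv ^^ (l + m)) (w_poly ^ l))"
  by (simp add: dleg_def legendre_poly_def pderiv_funpow_smult funpow_add add.commute[of l m])

lemma dleg_nonzero: "m \<le> l \<Longrightarrow> dleg l m \<noteq> 0"
  unfolding dleg_eq using pderiv_funpow_nonzero[of "w_poly ^ l" "l+m"] by (simp add: degree_power_eq)

lemma degree_dleg: "degree (dleg l m) = l - m"
  unfolding dleg_eq by (simp add: degree_pderiv_funpow degree_power_eq)

lemma dleg_roots:
  assumes "m \<le> l"
  shows "finite {x. poly (dleg l m) x = 0}" "card {x. poly (dleg l m) x = 0} = l - m"
    "\<And>x. poly (dleg l m) x = 0 \<Longrightarrow> -1 < x \<and> x < 1"
proof -
  let ?S = "{x. poly (dleg l m) x = 0}"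
  obtain R where R: "finite R" "card R = l - m" "\<forall>x\<in>R. -1 < x \<and> x < 1 \<and> poly (dleg l m) x = 0"
    using roots_above[OF assms] by (auto simp: dleg_eq)
  show fin: "finite ?S" using poly_roots_finite[OF dleg_nonzero[OF assms]] .
  have "card ?S \<le> l - m" using card_poly_roots_bound[OF dleg_nonzero[OF assms]] by (simp add: degree_dleg)
  hence RS: "R = ?S" using R fin by (intro card_seteq) auto
  show "card ?S = l - m" using R(2) unfolding RS .
  show "-1 < x \<and> x < 1" if "poly (dleg l m) x = 0" for x
    using R(3) that RS by blast
qed

lemma split_real_poly:
  assumes "p \<noteq> 0" "finite R" "R \<subseteq> {x. poly p x = 0}" "card R = degree p"
  shows "p = smult (lead_coeff p) (\<Prod>r\<in>R. [:-r, 1::real:])"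
  using assms(2,1,3,4)
proof (induction R arbitrary: p)
  case empty
  then show ?case by (auto simp: degree_eq_zeroE elim: degree_eq_zeroE)
next
  case (insert a R)
  then obtain q where q: "p = [:-a, 1:] * q" by (auto simp: poly_eq_0_iff_dvd elim: dvdE)
  have qn: "q \<noteq> 0" using insert.prems q by auto
  have deg: "card R = degree q" using insert q qn by (simp add: degree_mult_eq del: mult_pCons_left)
  have "R \<subseteq> {x. poly q x = 0}" using insert q by auto
  hence "q = smult (lead_coeff q) (\<Prod>r\<in>R. [:-r, 1:])" using insert.IH[OF qn _ deg] by simp
  moreover have "lead_coeff p = lead_coeff q" using q by (simp add: lead_coeff_mult del: mult_pCons_left)
  ultimately show ?case using insert.hyps q by (metis mult_smult_right prod.insert)
qed

text \<open>
  Laguerre's inequality p p'' < p'^2 says that log |p| is strictly concave, which is clear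
  for a product of real linear factors.  The induction splits off one factor (x - a); at x = a the
  first term of (x - a)^2 (p p'' - p'^2) - p^2 vanishes, and p(a) \<noteq> 0 because the roots are
  distinct.
\<close>
lemma laguerre_prod:
  assumes "finite R" "R \<noteq> {}"
  defines "p \<equiv> (\<Prod>r\<in>R. [:-r, 1::real:])"
  shows "poly p x * poly (pderiv (pderiv p)) x < (poly (pderiv p) x)\<^sup>2"
  using assms(1,2) unfolding p_def
proof (induction R rule: finite_ne_induct)
  case (singleton a) then show ?case by (simp add: pderiv_pCons)
next
  case (insert a R)
  define p where "p = (\<Prod>r\<in>R. [:-r, 1::real:])"
  have pd: "pderiv ([:-a,1:] * p) = p + [:-a,1:] * pderiv p"
    unfolding pderiv_mult by (simp add: pderiv_pCons)
  have pd2: "pderiv (pderiv ([:-a,1:] * p)) = smult 2 (pderiv p) + [:-a,1:] * pderiv (pderiv p)"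
  proof -
    have "pderiv ([:-a,1:] * pderiv p) = pderiv p + [:-a,1:] * pderiv (pderiv p)"
      unfolding pderiv_mult by (simp add: pderiv_pCons)
    hence "pderiv (pderiv ([:-a,1:] * p)) = (pderiv p + pderiv p) + [:-a,1:] * pderiv (pderiv p)"
      unfolding pd pderiv_add by (simp only: add.assoc)
    also have "pderiv p + pderiv p = smult 2 (pderiv p)"
      by (metis one_add_one smult_1_left smult_add_left)
    finally show ?thesis .
  qed
  have pa: "poly p a \<noteq> 0" using insert by (auto simp: p_def poly_prod)
  define A B C where "A = poly p x" "B = poly (pderiv p) x" "C = poly (pderiv (pderiv p)) x"
  have IH: "A * C < B\<^sup>2" using insert.IH by (simp add: p_def A_B_C_def)
  have "(x - a)\<^sup>2 * (A * C - B\<^sup>2) - A\<^sup>2 < 0"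
  proof (cases "x = a")
    case True thus ?thesis using pa by (simp add: A_B_C_def)
  next
    case False
    hence "(x - a)\<^sup>2 * (A * C - B\<^sup>2) < 0" using IH by (intro mult_pos_neg) auto
    thus ?thesis by (smt (verit) zero_le_power2)
  qed
  hence "((x - a) * A) * (2 * B + (x - a) * C) < (A + (x - a) * B)\<^sup>2"
    by (simp add: power2_eq_square algebra_simps)
  moreover have "poly ([:-a,1:] * p) x = (x - a) * A"
      "poly (pderiv ([:-a,1:] * p)) x = A + (x - a) * B"
      "poly (pderiv (pderiv ([:-a,1:] * p))) x = 2 * B + (x - a) * C"
    unfolding pd2 unfolding pd poly_add poly_mult poly_smult by (simp_all add: A_B_C_def algebra_simps)
  ultimately show ?case unfolding prod.insert[OF insert.hyps(1,3)] p_def[symmetric] by (simp only:)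
qed

lemma laguerre_dleg:
  assumes "m < l"
  shows "poly (dleg l m) x * poly (pderiv (pderiv (dleg l m))) x < (poly (pderiv (dleg l m)) x)\<^sup>2"
proof -
  let ?R = "{x. poly (dleg l m) x = 0}"
  let ?p = "\<Prod>r\<in>?R. [:-r, 1::real:]"
  let ?c = "lead_coeff (dleg l m)"
  note R = dleg_roots[of m l]
  have nz: "dleg l m \<noteq> 0" using assms dleg_nonzero by simp
  have eq: "dleg l m = smult ?c ?p"
    using assms R nz by (intro split_real_poly) (auto simp: degree_dleg)
  have "?R \<noteq> {}" using R assms by (metis card.empty less_imp_le zero_less_diff less_irrefl)
  hence "poly ?p x * poly (pderiv (pderiv ?p)) x < (poly (pderiv ?p) x)\<^sup>2"
    using R assms by (intro laguerre_prod) auto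
  hence "?c\<^sup>2 * (poly ?p x * poly (pderiv (pderiv ?p)) x) < ?c\<^sup>2 * (poly (pderiv ?p) x)\<^sup>2"
    using nz by (intro mult_strict_left_mono) auto
  thus ?thesis by (subst (1 2 3) eq) (simp add: pderiv_smult power2_eq_square algebra_simps)
qed

text \<open>
  A double root would turn Laguerre's inequality into 0 < 0.
\<close>
lemma dleg_simple: "m \<le> l \<Longrightarrow> poly (dleg l m) x = 0 \<Longrightarrow> poly (pderiv (dleg l m)) x \<noteq> 0"
proof (cases "m = l")
  case True
  assume "poly (dleg l m) x = 0"
  thus ?thesis using dleg_roots(1,2)[of m l] True by (metis card_eq_0_iff diff_self_eq_0 empty_iff mem_Collect_eq order_refl)
next
  case False
  assume "m \<le> l" "poly (dleg l m) x = 0"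
  thus ?thesis using False laguerre_dleg[of m l x] by auto
qed

lemma laguerre_dleg_le:
  "m \<le> l \<Longrightarrow> poly (dleg l m) x * poly (pderiv (pderiv (dleg l m))) x \<le> (poly (pderiv (dleg l m)) x)\<^sup>2"
proof (cases "m = l")
  case True
  hence "pderiv (pderiv (dleg l m)) = 0" by (simp add: pderiv_eq_0_iff degree_pderiv degree_dleg)
  thus ?thesis by simp
qed (use laguerre_dleg[of m l x] in \<open>auto intro: less_imp_le\<close>)

text \<open>
  With Q = dleg l m, the derivative of (1 - z^2)^(m/2) Q(z) is
  (1 - z^2)^(m/2 - 1) times this polynomial; its zeros in (-1, 1) are the heights at which the
  harmonic is stationary along meridians.
\<close>
definition latitude_poly :: "nat \<Rightarrow> nat \<Rightarrow> real poly" where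
  "latitude_poly l m = [:1, 0, -1:] * pderiv (dleg l m) - smult (real m) ([:0, 1:] * dleg l m)"

lemma poly_latitude_poly: "poly (latitude_poly l m) z = (1 - z\<^sup>2) * poly (pderiv (dleg l m)) z - m * z * poly (dleg l m) z"
  by (simp add: latitude_poly_def algebra_simps power2_eq_square)

lemma poly_latitude_poly': "poly (pderiv (latitude_poly l m)) z = (1 - z\<^sup>2) * poly (pderiv (pderiv (dleg l m))) z
    - (m + 2) * z * poly (pderiv (dleg l m)) z - m * poly (dleg l m) z"
proof -
  have "pderiv [:1, 0, -1:] = [:0, -2::real:]" "pderiv [:0, 1:] = [:1::real:]"
    by (simp_all add: pderiv_pCons)
  thus ?thesis unfolding latitude_poly_def pderiv_diff pderiv_mult pderiv_smult
      poly_diff poly_add poly_mult poly_smult by (simp add: algebra_simps power2_eq_square)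
qed

text \<open>
  This is where the concavity of log |(1 - z^2)^(m/2) Q(z)| between
  consecutive zeros enters: at a zero of E = latitude_poly l m the product Q E' is negative, so
  |(1 - z^2)^(m/2) Q| has a strict local maximum there.  In Q E' the term with Q Q'' is controlled by
  Laguerre's inequality, the remaining ones by the equation (1 - z^2) Q' = m z Q.
\<close>
lemma latitude_poly_zero:
  assumes "1 \<le> m" "m \<le> l" "-1 < z" "z < 1" "poly (latitude_poly l m) z = 0"
  shows "poly (dleg l m) z \<noteq> 0" "poly (dleg l m) z * poly (pderiv (latitude_poly l m)) z < 0"
proof -
  define q q1 q2 where "q = poly (dleg l m) z" "q1 = poly (pderiv (dleg l m)) z"
    "q2 = poly (pderiv (pderiv (dleg l m))) z"
  have z2: "0 < 1 - z\<^sup>2" using assms by (simp add: abs_square_less_1)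
  have e: "(1 - z\<^sup>2) * q1 = m * z * q" using assms by (simp add: poly_latitude_poly q_q1_q2_def)
  show nz: "poly (dleg l m) z \<noteq> 0"
    using e z2 dleg_simple[OF assms(2), of z] by (auto simp: q_q1_q2_def)
  have lag: "q * q2 \<le> q1\<^sup>2" using laguerre_dleg_le[OF assms(2)] by (simp add: q_q1_q2_def)
  have pos: "0 \<le> z * (q * q1)"
  proof -
    have "(1 - z\<^sup>2) * (z * (q * q1)) = z * q * ((1 - z\<^sup>2) * q1)" by (simp add: algebra_simps)
    also have "\<dots> = m * (z * q)\<^sup>2" unfolding e by (simp add: power2_eq_square algebra_simps)
    finally have "(1 - z\<^sup>2) * (z * (q * q1)) = m * (z * q)\<^sup>2" .
    thus ?thesis using z2 by (metis mult_nonneg_nonneg of_nat_0_le_iff zero_le_mult_iff zero_le_power2 not_less)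
  qed
  have "q * ((1 - z\<^sup>2) * q2 - (m + 2) * z * q1 - m * q)
      = (1 - z\<^sup>2) * (q * q2) - q1 * (m * z * q) - 2 * (z * (q * q1)) - m * q\<^sup>2"
    by (simp add: algebra_simps power2_eq_square)
  also have "\<dots> = (1 - z\<^sup>2) * (q * q2 - q1\<^sup>2) - 2 * (z * (q * q1)) - m * q\<^sup>2"
    unfolding e[symmetric] by (simp add: algebra_simps power2_eq_square)
  also have "\<dots> < 0"
  proof -
    have "(1 - z\<^sup>2) * (q * q2 - q1\<^sup>2) \<le> 0" using z2 lag by (intro mult_nonneg_nonpos) auto
    moreover have "0 < m * q\<^sup>2" using assms nz by (simp add: q_q1_q2_def)
    ultimately show ?thesis using pos by linarith
  qed
  finally show "poly (dleg l m) z * poly (pderiv (latitude_poly l m)) z < 0"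
    unfolding poly_latitude_poly' q_q1_q2_def by (simp add: algebra_simps)
qed

lemma latitude_poly_degree: "m \<le> l \<Longrightarrow> degree (latitude_poly l m) \<le> l - m + 1"
  unfolding latitude_poly_def
proof (rule degree_diff_le)
  show "degree ([:1, 0, -1:] * pderiv (dleg l m)) \<le> l - m + 1"
  proof (cases "pderiv (dleg l m) = 0")
    case False
    hence "l - m > 0" using degree_dleg[of l m] by (auto simp: pderiv_eq_0_iff)
    thus ?thesis using False by (subst degree_mult_eq) (auto simp: degree_pderiv degree_dleg)
  qed auto
  show "degree (smult (real m) ([:0, 1:] * dleg l m)) \<le> l - m + 1"
    by (rule order.trans[OF degree_smult_le]) (use degree_mult_le[of "[:0,1:]" "dleg l m"] degree_dleg[of l m] in auto)
qed

text \<open>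
  Rolle on the l - m roots of Q together with the end points gives at least
  l - m + 1 zeros, and the degree gives at most that many.  Squaring the profile makes it the
  polynomial D, whose derivative is 2 (1 - z^2)^(m - 1) Q E.
\<close>
lemma latitude_poly_card:
  assumes "1 \<le> m" "m \<le> l"
  shows "finite {z. -1 < z \<and> z < 1 \<and> poly (latitude_poly l m) z = 0}"
    "card {z. -1 < z \<and> z < 1 \<and> poly (latitude_poly l m) z = 0} = l - m + 1"
proof -
  let ?R = "{x. poly (dleg l m) x = 0}"
  note R = dleg_roots[OF assms(2)]
  have "poly (dleg l m) 1 \<noteq> 0" using R(3)[of 1] by auto
  hence "poly (latitude_poly l m) 1 \<noteq> 0" using assms by (simp add: poly_latitude_poly)
  hence nz: "latitude_poly l m \<noteq> 0" by auto
  have fin: "finite {z. poly (latitude_poly l m) z = 0}" using poly_roots_finite[OF nz] .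
  thus fin': "finite {z. -1 < z \<and> z < 1 \<and> poly (latitude_poly l m) z = 0}"
    by (rule finite_subset[rotated]) auto
  have "card {z. poly (latitude_poly l m) z = 0} \<le> l - m + 1"
    using card_poly_roots_bound[OF nz] latitude_poly_degree[OF assms(2)] by simp
  moreover have "card {z. -1 < z \<and> z < 1 \<and> poly (latitude_poly l m) z = 0} \<le> card {z. poly (latitude_poly l m) z = 0}"
    using fin by (intro card_mono) auto
  ultimately have up: "card {z. -1 < z \<and> z < 1 \<and> poly (latitude_poly l m) z = 0} \<le> l - m + 1" by simp
  define D where "D = [:1, 0, -1:] ^ m * (dleg l m)\<^sup>2"
  define Z where "Z = insert (-1) (insert 1 ?R)"
  have R1: "-1 \<notin> insert 1 ?R" "1 \<notin> ?R" using R(3)[of 1] R(3)[of "-1"] by auto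
  define RR where "RR = ?R"
  have "card (insert (-1) (insert 1 RR)) = Suc (Suc (l - m))"
    using R(1,2) R1 unfolding RR_def[symmetric] by (subst card_insert_disjoint; simp)
  hence "card Z = Suc (Suc (l - m))" by (simp add: Z_def RR_def)
  moreover have "Min Z = -1" using R(1,3) by (intro Min_eqI) (auto simp: Z_def intro: less_imp_le)
  moreover have "Max Z = 1" using R(1,3) by (intro Max_eqI) (auto simp: Z_def intro: less_imp_le)
  ultimately have Z: "finite Z" "card Z = Suc (l - m + 1)" "Min Z = -1" "Max Z = 1"
    using R(1) by (auto simp: Z_def)
  have "poly D z = 0" if "z \<in> Z" for z
    using that assms by (auto simp: Z_def D_def poly_power)
  from rolle_count[OF Z(1,2) this poly_DERIV] obtain W where
    W: "finite W" "card W = l - m + 1" "\<forall>x\<in>W. -1 < x \<and> x < 1 \<and> x \<notin> Z \<and> poly (pderiv D) x = 0"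
    by (auto simp: Z)
  obtain j where j: "m = Suc j" using assms by (cases m) auto
  have "poly (pderiv D) x = 2 * (1 - x\<^sup>2) ^ j * poly (dleg l m) x * poly (latitude_poly l m) x" for x
  proof -
    have d: "pderiv [:1, 0, -1:] = [:0, -2::real:]" by (simp add: pderiv_pCons)
    have d2: "pderiv ([:1, 0, -1:] ^ Suc j) = smult (of_nat (Suc j)) ([:1, 0, -1:] ^ j) * [:0, -2::real:]"
      unfolding pderiv_power_Suc d ..
    define u q q1 where "u = 1 - x\<^sup>2" "q = poly (dleg l m) x" "q1 = poly (pderiv (dleg l m)) x"
    have D: "D = [:1, 0, -1:] ^ Suc j * (dleg l m * dleg l m)" unfolding D_def j power2_eq_square ..
    have v: "poly [:1, 0, -1:] x = u" "poly [:0, -2:] x = - 2 * x"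
      by (simp_all add: u_q_q1_def power2_eq_square)
    have "poly (pderiv D) x = u ^ Suc j * (q * q1 + q * q1) + q * q * (of_nat (Suc j) * u ^ j * (- 2 * x))"
      unfolding D pderiv_mult d2 unfolding poly_add poly_mult poly_smult poly_power v
      by (simp only: u_q_q1_def mult.commute)
    also have "\<dots> = 2 * u ^ j * q * (u * q1 - real (Suc j) * x * q)"
      by (simp add: algebra_simps)
    also have "\<dots> = 2 * (1 - x\<^sup>2) ^ j * poly (dleg l m) x * poly (latitude_poly l m) x"
      unfolding poly_latitude_poly j[symmetric] u_q_q1_def ..
    finally show ?thesis .
  qed
  hence "poly (latitude_poly l m) x = 0" if "x \<in> W" for x
    using W(3) that by (auto simp: Z_def power2_eq_1_iff)
  hence "W \<subseteq> {z. -1 < z \<and> z < 1 \<and> poly (latitude_poly l m) z = 0}" using W by auto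
  from card_mono[OF fin' this] have "l - m + 1 \<le> card {z. -1 < z \<and> z < 1 \<and> poly (latitude_poly l m) z = 0}"
    using W(2) by linarith
  thus "card {z. -1 < z \<and> z < 1 \<and> poly (latitude_poly l m) z = 0} = l - m + 1" using up by simp
qed

section \<open>Local maxima on the sphere\<close>

definition sphere_max :: "(real ^ 3 \<Rightarrow> real) \<Rightarrow> (real ^ 3) set" where
  "sphere_max f = {u \<in> sphere 0 1. \<forall>\<^sub>F x in at u within sphere 0 1. f x \<le> f u}"

lemma sphere_max_cong:
  assumes "\<And>u. u \<in> sphere 0 1 \<Longrightarrow> f u \<le> f v \<longleftrightarrow> g u \<le> g v" "v \<in> sphere 0 1"
  shows "v \<in> sphere_max f \<longleftrightarrow> v \<in> sphere_max g"
  unfolding sphere_max_def mem_Collect_eq eventually_at_topological using assms by blast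

lemma sphere_max_isometry:
  assumes "orthogonal_transformation T"
  shows "card (sphere_max (\<lambda>u. f (T u))) = card (sphere_max f)"
proof -
  have inj: "inj T" using assms orthogonal_transformation_inj by blast
  have surj: "surj T" using assms orthogonal_transformation_surj by blast
  have nT: "norm (T x) = norm x" for x using assms by (simp add: orthogonal_transformation_norm)
  have dT: "dist (T x) (T y) = dist x y" for x y
    using assms by (simp add: orthogonal_transformation_isometry)
  have iff: "T u \<in> sphere_max f \<longleftrightarrow> u \<in> sphere_max (\<lambda>u. f (T u))" for u
  proof -
    have all: "(\<forall>x. P x) \<longleftrightarrow> (\<forall>x. P (T x))" for P using surj by (metis surjD)
    have "(\<forall>\<^sub>F x in at (T u) within sphere 0 1. f x \<le> f (T u))
      \<longleftrightarrow> (\<exists>d>0. \<forall>x. T x \<in> sphere 0 1 \<longrightarrow> T x \<noteq> T u \<and> dist (T x) (T u) < d \<longrightarrow> f (T x) \<le> f (T u))"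
      unfolding eventually_at Ball_def by (intro ex_cong1 conj_cong refl all)
    also have "\<dots> \<longleftrightarrow> (\<forall>\<^sub>F x in at u within sphere 0 1. f (T x) \<le> f (T u))"
      unfolding eventually_at Ball_def by (simp add: nT dT inj_eq[OF inj])
    finally show ?thesis by (simp add: sphere_max_def nT)
  qed
  have "bij_betw T (sphere_max (\<lambda>u. f (T u))) (sphere_max f)"
  proof (rule bij_betw_imageI)
    show "inj_on T (sphere_max (\<lambda>u. f (T u)))" using inj by (rule inj_on_subset) simp
    show "T ` sphere_max (\<lambda>u. f (T u)) = sphere_max f"
    proof (intro equalityI subsetI)
      fix y assume "y \<in> sphere_max f"
      moreover obtain x where "y = T x" using surj by (metis surjD)
      ultimately show "y \<in> T ` sphere_max (\<lambda>u. f (T u))" using iff[of x] by blast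
    next
      fix y assume "y \<in> T ` sphere_max (\<lambda>u. f (T u))"
      then obtain x where "y = T x" "x \<in> sphere_max (\<lambda>u. f (T u))" by blast
      thus "y \<in> sphere_max f" using iff[of x] by blast
    qed
  qed
  thus ?thesis by (rule bij_betw_same_card)
qed

lemma sphere_max_curve:
  assumes u: "u \<in> sphere_max F" and g: "isCont \<gamma> (0::real)" "\<And>t. norm (\<gamma> t) = 1" "\<gamma> 0 = u"
  shows "\<exists>e>0. \<forall>t. \<bar>t\<bar> < e \<longrightarrow> F (\<gamma> t) \<le> F u"
proof -
  have "\<exists>d>0. \<forall>x\<in>sphere 0 1. x \<noteq> u \<and> dist x u < d \<longrightarrow> F x \<le> F u"
    using u unfolding sphere_max_def mem_Collect_eq eventually_at by (elim conjE)
  then obtain d where d: "d > 0" "\<And>x. x\<in>sphere 0 1 \<Longrightarrow> x \<noteq> u \<Longrightarrow> dist x u < d \<Longrightarrow> F x \<le> F u"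
    by blast
  obtain e where e: "e > 0" "\<And>t. \<bar>t\<bar> < e \<Longrightarrow> dist (\<gamma> t) u < d"
    using g(1) d(1) unfolding continuous_at_eps_delta g(3) by (auto simp: dist_real_def)
  have "F (\<gamma> t) \<le> F u" if "\<bar>t\<bar> < e" for t
    using d(2)[of "\<gamma> t"] e(2)[OF that] g(2)[of t] by (cases "\<gamma> t = u") auto
  thus ?thesis using e(1) by blast
qed

text \<open>
  The Lagrange multiplier rule on the unit sphere: along the great circle through
  u in a tangential direction h the function has a local maximum at u, so its derivative annihilates
  h, and only the normal component of a direction remains.
\<close>
lemma sphere_max_lagrange:
  fixes F :: "real ^ 3 \<Rightarrow> real"
  assumes D: "(F has_derivative D) (at u)" and u: "u \<in> sphere_max F"
  shows "\<exists>c. D = (\<lambda>h. c * (u \<bullet> h))"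
proof -
  have nu: "norm u = 1" using u by (simp add: sphere_max_def)
  hence uu: "u \<bullet> u = 1" by (simp add: norm_eq_1)
  interpret D: bounded_linear D using D by (rule has_derivative_bounded_linear)
  have tang: "D h = 0" if h: "u \<bullet> h = 0" "norm h = 1" for h
  proof -
    define \<gamma> where "\<gamma> t = cos t *\<^sub>R u + sin t *\<^sub>R h" for t
    have g0: "\<gamma> 0 = u" by (simp add: \<gamma>_def)
    have gn: "norm (\<gamma> t) = 1" for t
    proof -
      have "\<gamma> t \<bullet> \<gamma> t = (cos t)\<^sup>2 + (sin t)\<^sup>2"
        using h uu by (simp add: \<gamma>_def inner_add norm_eq_1 inner_commute power2_eq_square)
      thus ?thesis by (simp add: norm_eq_1)
    qed
    have gd: "(\<gamma> has_derivative (\<lambda>t. t *\<^sub>R h)) (at 0)"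
      unfolding \<gamma>_def by (auto intro!: derivative_eq_intros)
    have "((F \<circ> \<gamma>) has_derivative (D \<circ> (\<lambda>t. t *\<^sub>R h))) (at 0)"
      using gd D by (intro diff_chain_at) (auto simp: g0)
    hence "((\<lambda>t. F (\<gamma> t)) has_real_derivative D h) (at 0)"
      unfolding has_field_derivative_def by (simp add: o_def D.scaleR mult_commute_abs)
    moreover have "isCont \<gamma> 0" unfolding \<gamma>_def by (intro continuous_intros)
    then obtain e where e: "e > 0" "\<forall>t. \<bar>t\<bar> < e \<longrightarrow> F (\<gamma> t) \<le> F u"
      using sphere_max_curve[OF u, of \<gamma>] gn g0 by blast
    hence "\<forall>y. \<bar>0 - y\<bar> < e \<longrightarrow> F (\<gamma> y) \<le> F (\<gamma> 0)" using g0 by auto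
    ultimately show ?thesis using DERIV_local_max e(1) by blast
  qed
  have "D h = D u * (u \<bullet> h)" for h
  proof -
    define k where "k = h - (u \<bullet> h) *\<^sub>R u"
    have k: "u \<bullet> k = 0" by (simp add: k_def inner_diff uu)
    have "D k = 0"
    proof (cases "k = 0")
      case False
      hence "D ((1 / norm k) *\<^sub>R k) = 0" using k by (intro tang) auto
      thus ?thesis using False by (simp add: D.scaleR)
    qed (simp add: D.zero)
    moreover have "h = k + (u \<bullet> h) *\<^sub>R u" by (simp add: k_def)
    ultimately show ?thesis by (metis D.add D.scaleR add_0 mult.commute real_scaleR_def)
  qed
  thus ?thesis by blast
qed

text \<open>
  On the sphere u \<bullet> v = 1 - |v - u|^2 / 2, so the linear function
  u \<bullet> v is stationary at u when restricted to the sphere.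
\<close>
lemma normal_derivative_imp_critical:
  fixes F :: "real ^ 3 \<Rightarrow> real"
  assumes "(F has_derivative (\<lambda>h. c * (u \<bullet> h))) (at u)" "norm u = 1"
  shows "(F has_derivative (\<lambda>_. 0)) (at u within sphere 0 1)"
proof -
  have 1: "((\<lambda>v. F v - c * (u \<bullet> v)) has_derivative (\<lambda>_. 0)) (at u within sphere 0 1)"
    by (rule has_derivative_at_withinI) (auto intro!: derivative_eq_intros assms(1))
  have "((\<lambda>v. c * (1 - ((v - u) \<bullet> (v - u)) / 2)) has_derivative (\<lambda>_. 0)) (at u within sphere 0 1)"
    by (auto intro!: derivative_eq_intros)
  hence 2: "((\<lambda>v. c * (u \<bullet> v)) has_derivative (\<lambda>_. 0)) (at u within sphere 0 1)"
  proof (rule has_derivative_transform[rotated 2])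
    fix v :: "real ^ 3" assume "v \<in> sphere 0 1"
    hence "v \<bullet> v = 1" "u \<bullet> u = 1" using assms(2) by (auto simp: norm_eq_1)
    thus "c * (u \<bullet> v) = c * (1 - (v - u) \<bullet> (v - u) / 2)"
      by (simp add: inner_diff inner_commute field_simps)
  qed (use assms(2) in auto)
  show ?thesis using has_derivative_add[OF 1 2] by simp
qed

text \<open>
  A local extremum of a function that extends differentiably to space is
  automatically critical, so the criticality clause in the definition of stable and unstable
  equilibria can be dropped.
\<close>
lemma sphere_max_critical:
  fixes F g :: "real ^ 3 \<Rightarrow> real"
  assumes "\<And>v. F differentiable (at v)" "\<And>v. v \<in> sphere 0 1 \<Longrightarrow> g v = F v" "u \<in> sphere_max g"
  shows "critical_on_sphere g u"
proof -
  have u: "u \<in> sphere 0 1" using assms(3) by (simp add: sphere_max_def)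
  have "u \<in> sphere_max F" using sphere_max_cong[of g u F] assms(2,3) u by auto
  then obtain c where "(F has_derivative (\<lambda>h. c * (u \<bullet> h))) (at u)"
    using sphere_max_lagrange assms(1) unfolding differentiable_def by metis
  hence "(F has_derivative (\<lambda>_. 0)) (at u within sphere 0 1)"
    using u normal_derivative_imp_critical by simp
  thus ?thesis unfolding critical_on_sphere_def
    using u assms(2) by (auto intro: has_derivative_transform)
qed

lemma unstable_equilibria_eq:
  assumes "\<And>v. F differentiable (at v)" "\<And>v. v \<in> sphere 0 1 \<Longrightarrow> sq_dist l m \<epsilon> v = F v"
  shows "unstable_equilibria l m \<epsilon> = sphere_max (sq_dist l m \<epsilon>)"
proof -
  have "critical_on_sphere (sq_dist l m \<epsilon>) u" if "u \<in> sphere_max (sq_dist l m \<epsilon>)" for u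
    using sphere_max_critical[of F "sq_dist l m \<epsilon>"] assms that by blast
  thus ?thesis
    by (auto simp: unstable_equilibria_def equilibria_def sphere_max_def critical_on_sphere_def)
qed

lemma stable_equilibria_eq:
  assumes "\<And>v. F differentiable (at v)" "\<And>v. v \<in> sphere 0 1 \<Longrightarrow> sq_dist l m \<epsilon> v = F v"
  shows "stable_equilibria l m \<epsilon> = sphere_max (\<lambda>u. - sq_dist l m \<epsilon> u)"
proof -
  have "critical_on_sphere (sq_dist l m \<epsilon>) u" if "u \<in> sphere_max (\<lambda>u. - sq_dist l m \<epsilon> u)" for u
  proof -
    have "critical_on_sphere (\<lambda>u. - sq_dist l m \<epsilon> u) u"
      using sphere_max_critical[of "\<lambda>v. - F v" "\<lambda>u. - sq_dist l m \<epsilon> u"] assms that by auto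
    thus ?thesis unfolding critical_on_sphere_def
      using has_derivative_minus[of "\<lambda>u. - sq_dist l m \<epsilon> u" "\<lambda>_. 0"] by auto
  qed
  thus ?thesis
    by (auto simp: stable_equilibria_def equilibria_def sphere_max_def critical_on_sphere_def)
qed

section \<open>Order 1: small perturbations of the harmonic\<close>

text \<open>
  If every gap between consecutive points of Z contains exactly one point of X, then X has
  one point fewer than Z: send the left end of a gap to the point in it.
\<close>
lemma gap_count:
  fixes X Z :: "real set"
  assumes Z: "finite Z" "Z \<noteq> {}" and disj: "X \<inter> Z = {}"
    and between: "\<And>x. x \<in> X \<Longrightarrow> Min Z < x \<and> x < Max Z"
    and gap: "\<And>a b. \<lbrakk>a \<in> Z; b \<in> Z; a < b; \<And>z. z \<in> Z \<Longrightarrow> \<not> (a < z \<and> z < b)\<rbrakk>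
          \<Longrightarrow> \<exists>!x. a < x \<and> x < b \<and> x \<in> X"
  shows "card X = card Z - 1"
proof -
  define nxt where "nxt a = Min {b\<in>Z. a < b}" for a
  have nxt: "nxt a \<in> Z \<and> a < nxt a \<and> (\<forall>z\<in>Z. \<not> (a < z \<and> z < nxt a))" if "a \<in> Z - {Max Z}" for a
  proof -
    have "a < Max Z" using that Z by (metis DiffE Max_ge antisym_conv1 insertI1)
    hence "Max Z \<in> {b\<in>Z. a < b}" using Z by simp
    hence "{b\<in>Z. a < b} \<noteq> {}" by blast
    moreover have "finite {b\<in>Z. a < b}" using Z by simp
    ultimately have "finite {b\<in>Z. a < b}" "{b\<in>Z. a < b} \<noteq> {}" by auto
    from Min_in[OF this] Min_le[OF this(1)] show ?thesis unfolding nxt_def by force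
  qed
  have ex1: "\<exists>!x. a < x \<and> x < nxt a \<and> x \<in> X" if "a \<in> Z - {Max Z}" for a
    using gap[of a "nxt a"] nxt[OF that] that by blast
  define g where "g a = (THE x. a < x \<and> x < nxt a \<and> x \<in> X)" for a
  have g: "a < g a \<and> g a < nxt a \<and> g a \<in> X" if "a \<in> Z - {Max Z}" for a
    unfolding g_def by (rule theI'[OF ex1[OF that]])
  have "inj_on g (Z - {Max Z})"
  proof (rule linorder_inj_onI)
    fix a b assume ab: "a < b" "a \<in> Z - {Max Z}" "b \<in> Z - {Max Z}"
    have "nxt a \<le> b" using nxt[OF ab(2)] ab by (meson DiffE not_le)
    thus "g a \<noteq> g b" using g[OF ab(2)] g[OF ab(3)] by auto
  qed auto
  moreover have "g ` (Z - {Max Z}) = X"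
  proof (intro equalityI subsetI)
    fix x assume x: "x \<in> X"
    define a where "a = Max {z\<in>Z. z < x}"
    have "Min Z \<in> {z\<in>Z. z < x}" using between[OF x] Z by simp
    hence "{z\<in>Z. z < x} \<noteq> {}" by blast
    moreover have "finite {z\<in>Z. z < x}" using Z by simp
    ultimately have "finite {z\<in>Z. z < x}" "{z\<in>Z. z < x} \<noteq> {}" by auto
    from Max_in[OF this] Max_ge[OF this(1)] have a: "a \<in> Z" "a < x" 
       "\<And>z. z \<in> Z \<Longrightarrow> z < x \<Longrightarrow> z \<le> a" unfolding a_def by auto
    have az: "a \<in> Z - {Max Z}" using a between[OF x] by auto
    have "x < nxt a" using a(3)[of "nxt a"] nxt[OF az] x disj by force
    hence "g a = x" unfolding g_def using ex1[OF az] x a by (intro the1_equality) auto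
    thus "x \<in> g ` (Z - {Max Z})" using az by blast
  qed (use g in auto)
  ultimately have "card X = card (Z - {Max Z})" by (metis card_image)
  thus ?thesis using Z by simp
qed

lemma second_derivative_max:
  fixes f f' :: "real \<Rightarrow> real"
  assumes f: "\<And>t. (f has_real_derivative f' t) (at t)" and f': "(f' has_real_derivative D) (at x)"
    and 0: "f' x = 0" and D: "D < 0"
  shows "\<exists>d>0. \<forall>t. \<bar>t - x\<bar> < d \<longrightarrow> f t \<le> f x \<and> (t \<noteq> x \<longrightarrow> f t < f x)"
proof -
  obtain d1 where d1: "d1 > 0" "\<And>h. 0 < h \<Longrightarrow> h < d1 \<Longrightarrow> f' (x + h) < 0"
    using has_real_derivative_neg_dec_right[of f' D x UNIV] f' D 0 by force
  obtain d2 where d2: "d2 > 0" "\<And>h. 0 < h \<Longrightarrow> h < d2 \<Longrightarrow> f' (x - h) > 0"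
    using has_real_derivative_neg_dec_left[of f' D x UNIV] f' D 0 by force
  have "f t < f x" if t: "\<bar>t - x\<bar> < min d1 d2" "t \<noteq> x" for t
  proof (cases "t < x")
    case True
    then obtain z where z: "t < z" "z < x" "f x - f t = (x - t) * f' z"
      using MVT2[OF True, of f f'] f by auto
    have "f' z > 0" using d2(2)[of "x - z"] z t True by auto
    hence "(x - t) * f' z > 0" using True by simp
    thus ?thesis using z by linarith
  next
    case False
    hence xt: "x < t" using t by auto
    then obtain z where z: "x < z" "z < t" "f t - f x = (t - x) * f' z"
      using MVT2[OF xt, of f f'] f by auto
    have "f' z < 0" using d1(2)[of "z - x"] z t xt by auto
    hence "(t - x) * f' z < 0" using xt by (simp add: mult_pos_neg)
    thus ?thesis using z by linarith
  qed
  thus ?thesis using d1 d2 by (intro exI[of _ "min d1 d2"]) (auto simp: order.order_iff_strict)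
qed

text \<open>
  Stability of nondegenerate critical points, read pointwise.  Think of
  y0, y1, y2 as a function and its first two derivatives.  If y0 y2 < 0 wherever y1 = 0, then by
  compactness either |y1| or - y0 y2 is bounded below by a constant e > 0 at every point.  A triple
  (f0, f1, f2) within \<eta> = e / (2 M) of (y0, y1, y2), where M bounds y0 and y2, inherits the
  signs: a vanishing f1 excludes the first alternative, and the second makes |y0| and |y2| at least
  2 \<eta>.
\<close>
lemma nondegenerate_profile_stable:
  fixes y0 y1 y2 :: "real \<Rightarrow> real"
  assumes K: "compact K" "K \<noteq> {}" and c: "continuous_on K y0" "continuous_on K y1" "continuous_on K y2"
    and nd: "\<And>t. t \<in> K \<Longrightarrow> y1 t = 0 \<Longrightarrow> y0 t * y2 t < 0"
  shows "\<exists>\<eta>>0. \<forall>t\<in>K. \<forall>f0 f1 f2. \<bar>f0 - y0 t\<bar> \<le> \<eta> \<and> \<bar>f1 - y1 t\<bar> \<le> \<eta> \<and> \<bar>f2 - y2 t\<bar> \<le> \<eta> \<longrightarrow>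
     (f1 = 0 \<longrightarrow> y0 t * f0 > 0 \<and> f0 * f2 < 0 \<and> \<eta> \<le> \<bar>f0\<bar>) \<and> (y0 t = 0 \<longrightarrow> y1 t * f1 > 0)"
proof -
  have "\<exists>t\<in>K. \<forall>s\<in>K. max \<bar>y1 t\<bar> (- (y0 t * y2 t)) \<le> max \<bar>y1 s\<bar> (- (y0 s * y2 s))"
    using K by (intro continuous_attains_inf continuous_intros c)
  then obtain t0 where t0: "t0 \<in> K" "\<And>s. s \<in> K \<Longrightarrow> max \<bar>y1 t0\<bar> (- (y0 t0 * y2 t0)) \<le> max \<bar>y1 s\<bar> (- (y0 s * y2 s))"
    by blast
  define e where "e = max \<bar>y1 t0\<bar> (- (y0 t0 * y2 t0))"
  have e: "e > 0" using nd[OF t0(1)] by (auto simp: e_def less_max_iff_disj)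
  have alt: "e \<le> \<bar>y1 s\<bar> \<or> y0 s * y2 s \<le> - e" if "s \<in> K" for s
    using t0(2)[OF that] unfolding e_def[symmetric] by auto
  have "\<exists>t\<in>K. \<forall>s\<in>K. max \<bar>y0 s\<bar> \<bar>y2 s\<bar> \<le> max \<bar>y0 t\<bar> \<bar>y2 t\<bar>"
    using K by (intro continuous_attains_sup continuous_intros c)
  then obtain t1 where t1: "t1 \<in> K" "\<And>s. s \<in> K \<Longrightarrow> max \<bar>y0 s\<bar> \<bar>y2 s\<bar> \<le> max \<bar>y0 t1\<bar> \<bar>y2 t1\<bar>"
    by blast
  define M where "M = max 1 (max \<bar>y0 t1\<bar> \<bar>y2 t1\<bar>)"
  have M: "M \<ge> 1" "\<And>s. s \<in> K \<Longrightarrow> \<bar>y0 s\<bar> \<le> M" "\<And>s. s \<in> K \<Longrightarrow> \<bar>y2 s\<bar> \<le> M"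
    using t1(2) unfolding M_def by (auto simp: le_max_iff_disj)
  define \<eta> where "\<eta> = e / (2 * M)"
  have \<eta>: "\<eta> > 0" "2 * \<eta> * M = e" using e M(1) by (auto simp: \<eta>_def)
  have "\<eta> < e"
  proof -
    have "2 * \<eta> * 1 \<le> 2 * \<eta> * M" using \<eta> M(1) by (intro mult_left_mono) auto
    thus ?thesis using \<eta> by linarith
  qed
  show ?thesis
  proof (intro exI conjI ballI allI impI)
    fix t f0 f1 f2 assume t: "t \<in> K" 
      and cl: "\<bar>f0 - y0 t\<bar> \<le> \<eta> \<and> \<bar>f1 - y1 t\<bar> \<le> \<eta> \<and> \<bar>f2 - y2 t\<bar> \<le> \<eta>"
    { assume f1: "f1 = 0"
      hence "\<bar>y1 t\<bar> < e" using cl \<open>\<eta> < e\<close> by auto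
      hence le: "y0 t * y2 t \<le> - e" using alt[OF t] by auto
      have big: "2 * \<eta> \<le> \<bar>a\<bar>" if "a * b \<le> - e" "\<bar>b\<bar> \<le> M" for a b
      proof -
        have "2 * \<eta> * M \<le> \<bar>a\<bar> * \<bar>b\<bar>" using that \<eta>(2) by (simp flip: abs_mult)
        also have "\<dots> \<le> \<bar>a\<bar> * M" using that by (intro mult_left_mono) auto
        finally show ?thesis using M(1) by simp
      qed
      have b0: "2 * \<eta> \<le> \<bar>y0 t\<bar>" using big[OF le M(3)[OF t]] .
      have b2: "2 * \<eta> \<le> \<bar>y2 t\<bar>" using big[of "y2 t" "y0 t"] le M(2)[OF t] by (simp add: mult.commute)
      have op: "y0 t * y2 t < 0" using le e by linarith
      have "(0 < y0 t \<and> \<eta> \<le> f0 \<and> f2 < 0) \<or> (y0 t < 0 \<and> f0 \<le> - \<eta> \<and> 0 < f2)"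
        using op b0 b2 cl \<eta>(1) unfolding mult_less_0_iff by linarith
      hence "y0 t * f0 > 0 \<and> f0 * f2 < 0 \<and> \<eta> \<le> \<bar>f0\<bar>"
        using \<eta>(1) by (auto simp: mult_pos_neg mult_neg_pos mult_neg_neg)
    } note A = this
    show "y0 t * f0 > 0" "f0 * f2 < 0" "\<eta> \<le> \<bar>f0\<bar>" if "f1 = 0" using A[OF that] by auto
    show "y1 t * f1 > 0" if "y0 t = 0"
    proof -
      have "e \<le> \<bar>y1 t\<bar>" using alt[OF t] that e by auto
      hence "(0 < y1 t \<and> 0 < f1) \<or> (y1 t < 0 \<and> f1 < 0)" using cl \<open>\<eta> < e\<close> by linarith
      thus ?thesis by (auto simp: mult_neg_neg)
    qed
  qed (use \<eta> in auto)
qed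

lemma compact_bound:
  fixes f :: "real \<Rightarrow> real"
  assumes "continuous_on {0..pi} f"
  shows "\<exists>N. \<forall>t\<in>{0..pi}. \<bar>f t\<bar> \<le> N"
proof -
  have "compact (f ` {0..pi})" using assms by (intro compact_continuous_image) auto
  hence "bounded (f ` {0..pi})" by (rule compact_imp_bounded)
  thus ?thesis unfolding bounded_iff by auto
qed

context
  fixes l :: nat
begin

abbreviation "Q \<equiv> dleg l 1"

definition quad_coeff :: "real \<Rightarrow> real \<Rightarrow> real poly" where
  "quad_coeff b c = smult b (Q * Q) - smult c Q"

definition quad_part :: "real \<Rightarrow> real \<Rightarrow> real poly" where "quad_part b c = [:1, 0, -1:] * quad_coeff b c"

text \<open>
  For the harmonic x Q(z) of order 1, amplitude \<epsilon> and a centroid (k, 0, 0), the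
  squared distance from the boundary to the centroid is 1 + k^2 + 2 \<epsilon> times this function
  with a = k / \<epsilon>, b = \<epsilon> / 2 and c = k (see equilibrium_class_m_1).  All three
  parameters tend to 0 with \<epsilon>, and for a = b = c = 0 it is the harmonic itself.
\<close>
definition pharm :: "real \<Rightarrow> real \<Rightarrow> real \<Rightarrow> real ^ 3 \<Rightarrow> real" where
  "pharm a b c u = u $ 1 * (poly Q (u $ 3) - a) + (u $ 1)\<^sup>2 * poly (quad_coeff b c) (u $ 3)"

text \<open>
  The unperturbed function along the meridian y = 0, \<theta> \<mapsto> (sin \<theta>, 0, cos \<theta>),
  and its first two derivatives.
\<close>
definition base_val where "base_val \<theta> = sin \<theta> * poly Q (cos \<theta>)"
definition base_d1 where "base_d1 \<theta> = cos \<theta> * poly Q (cos \<theta>) - (sin \<theta>)\<^sup>2 * poly (pderiv Q) (cos \<theta>)"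
definition base_d2 where "base_d2 \<theta> = - sin \<theta> * poly Q (cos \<theta>) - 3 * sin \<theta> * cos \<theta> * poly (pderiv Q) (cos \<theta>)
   + (sin \<theta>) ^ 3 * poly (pderiv (pderiv Q)) (cos \<theta>)"

lemma base_d1_latitude_poly: "base_d1 \<theta> = - poly (latitude_poly l 1) (cos \<theta>)"
  by (simp add: base_d1_def poly_latitude_poly sin_squared_eq)

lemma base_d2_latitude_poly: "base_d2 \<theta> = sin \<theta> * poly (pderiv (latitude_poly l 1)) (cos \<theta>)"
proof -
  have "sin \<theta> ^ 3 = sin \<theta> * (1 - (cos \<theta>)\<^sup>2)"
    by (simp add: power3_eq_cube flip: sin_squared_eq) (simp add: power2_eq_square)
  then show ?thesis unfolding base_d2_def poly_latitude_poly' by (simp only:) (simp add: algebra_simps)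
qed

lemma DERIV_poly_cos: "((\<lambda>\<theta>. poly P (cos \<theta>)) has_real_derivative - sin \<theta> * poly (pderiv P) (cos \<theta>)) (at \<theta>)"
  by (rule DERIV_cong[OF DERIV_chain2[OF poly_DERIV DERIV_cos]]) simp

lemma base_val_deriv: "(base_val has_real_derivative base_d1 \<theta>) (at \<theta>)"
  unfolding base_val_def base_d1_def
  by (rule derivative_eq_intros DERIV_poly_cos refl)+ (simp add: power2_eq_square algebra_simps)

lemma base_d1_deriv: "(base_d1 has_real_derivative base_d2 \<theta>) (at \<theta>)"
  unfolding base_d1_latitude_poly base_d2_latitude_poly
  by (rule derivative_eq_intros DERIV_poly_cos refl)+ simp

text \<open>
  The first two derivatives along the meridian are - E(cos \<theta>) and
  sin \<theta> E'(cos \<theta>) with E = latitude_poly l 1, so this is latitude_poly_zero in the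
  variable \<theta>.  Unlike z, the variable \<theta> remains smooth at the poles, which matters
  as soon as perturbations are compared.
\<close>
lemma base_nondegenerate:
  assumes "1 \<le> l" "\<theta> \<in> {0..pi}" "base_d1 \<theta> = 0" shows "base_val \<theta> * base_d2 \<theta> < 0"
proof -
  have E0: "poly (latitude_poly l 1) (cos \<theta>) = 0" using assms by (simp add: base_d1_latitude_poly)
  have "poly Q 1 \<noteq> 0" "poly Q (-1) \<noteq> 0"
    using dleg_roots(3)[of 1 l 1] dleg_roots(3)[of 1 l "-1"] assms by auto
  hence "cos \<theta> \<noteq> 1" "cos \<theta> \<noteq> -1" using E0 by (auto simp: poly_latitude_poly)
  hence c: "-1 < cos \<theta>" "cos \<theta> < 1" by (auto simp: order.not_eq_order_implies_strict)
  have "sin \<theta> \<noteq> 0" using c by (metis cos_one_sin_zero sin_zero_abs_cos_one abs_if minus_minus less_irrefl)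
  hence "(sin \<theta>)\<^sup>2 > 0" by simp
  moreover have "poly Q (cos \<theta>) * poly (pderiv (latitude_poly l 1)) (cos \<theta>) < 0"
    using latitude_poly_zero(2)[of 1 l "cos \<theta>"] assms c E0 by simp
  ultimately have "(sin \<theta>)\<^sup>2 * (poly Q (cos \<theta>) * poly (pderiv (latitude_poly l 1)) (cos \<theta>)) < 0" by (rule mult_pos_neg)
  thus ?thesis by (simp add: base_val_def base_d2_latitude_poly power2_eq_square algebra_simps)
qed

text \<open>
  The perturbed function and its first two derivatives along the half
  meridian (s sin \<theta>, 0, cos \<theta>), where s is 1 or -1 and \<theta> runs through [0, pi].
\<close>
definition merid_val where "merid_val a b c s \<theta> = s * sin \<theta> * (poly Q (cos \<theta>) - a) + poly (quad_part b c) (cos \<theta>)"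
definition merid_d1 where "merid_d1 a b c s \<theta> = s * (base_d1 \<theta> - a * cos \<theta>) - sin \<theta> * poly (pderiv (quad_part b c)) (cos \<theta>)"
definition merid_d2 where "merid_d2 a b c s \<theta> = s * (base_d2 \<theta> + a * sin \<theta>) - cos \<theta> * poly (pderiv (quad_part b c)) (cos \<theta>)
   + (sin \<theta>)\<^sup>2 * poly (pderiv (pderiv (quad_part b c))) (cos \<theta>)"

lemma merid_val_alt: "merid_val a b c s \<theta> = s * (base_val \<theta> - a * sin \<theta>) + poly (quad_part b c) (cos \<theta>)"
  by (simp add: merid_val_def base_val_def algebra_simps)

lemma merid_val_deriv: "(merid_val a b c s has_real_derivative merid_d1 a b c s \<theta>) (at \<theta>)"
  unfolding merid_val_alt merid_d1_def
  by (rule derivative_eq_intros DERIV_poly_cos base_val_deriv refl)+ simp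

lemma merid_d1_deriv: "(merid_d1 a b c s has_real_derivative merid_d2 a b c s \<theta>) (at \<theta>)"
  unfolding merid_d1_def merid_d2_def
  by (rule derivative_eq_intros DERIV_poly_cos base_d1_deriv refl)+ (simp add: power2_eq_square algebra_simps)

text \<open>
  What the counting below needs to know about small parameters.  Along the
  meridian, critical points keep the sign and the concavity of the unperturbed function and their
  values dominate the coefficient of the quadratic term, and the slope keeps its sign at the zeros of
  the unperturbed function.  The last two clauses make the z-derivative of the perturbed function,
  x Q'(z) (1 + x (2 b Q(z) - c)), vanish only for x = 0 wherever its x-derivative vanishes.
\<close>
definition nondegenerate :: "real \<Rightarrow> real \<Rightarrow> real \<Rightarrow> bool" where
  "nondegenerate a b c \<longleftrightarrow>
    (\<forall>t\<in>{0..pi}. \<forall>s. s = 1 \<or> s = -1 \<longrightarrow>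
       (merid_d1 a b c s t = 0 \<longrightarrow> base_val t * (s * merid_val a b c s t) > 0 \<and> merid_val a b c s t * merid_d2 a b c s t < 0 \<and>
           \<bar>poly (quad_coeff b c) (cos t)\<bar> < \<bar>merid_val a b c s t\<bar>) \<and>
       (base_val t = 0 \<longrightarrow> base_d1 t * (s * merid_d1 a b c s t) > 0)) \<and>
    (\<forall>z x. \<bar>z\<bar> \<le> 1 \<and> \<bar>x\<bar> \<le> 1 \<longrightarrow> 1 + x * (2 * b * poly Q z - c) \<noteq> 0 \<and>
       (poly Q z - a + 2 * x * poly (quad_coeff b c) z = 0 \<longrightarrow> poly (pderiv Q) z \<noteq> 0))"

text \<open>
  Along a half meridian the perturbed function, multiplied by s, differs from the
  unperturbed one by three terms, each of them up to sign a parameter times a fixed smooth function; the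
  same holds for the derivatives.
\<close>
lemma small_perturbation_nondegenerate:
  assumes l: "1 \<le> l"
  shows "\<exists>\<delta>>0. \<forall>a b c. \<bar>a\<bar> \<le> \<delta> \<and> \<bar>b\<bar> \<le> \<delta> \<and> \<bar>c\<bar> \<le> \<delta> \<longrightarrow> nondegenerate a b c"
proof -
  let ?K = "{0..pi}"
  have cts: "continuous_on ?K base_val" "continuous_on ?K base_d1" "continuous_on ?K base_d2"
    unfolding base_val_def base_d1_def base_d2_def by (intro continuous_intros)+
  have Kne: "?K \<noteq> {}" by simp
  have ex: "\<exists>\<eta>>0. \<forall>t\<in>?K. \<forall>g0 g1 g2. \<bar>g0 - base_val t\<bar> \<le> \<eta> \<and> \<bar>g1 - base_d1 t\<bar> \<le> \<eta> \<and> \<bar>g2 - base_d2 t\<bar> \<le> \<eta> \<longrightarrow>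
     (g1 = 0 \<longrightarrow> base_val t * g0 > 0 \<and> g0 * g2 < 0 \<and> \<eta> \<le> \<bar>g0\<bar>) \<and> (base_val t = 0 \<longrightarrow> base_d1 t * g1 > 0)"
    by (rule nondegenerate_profile_stable[OF compact_Icc Kne cts base_nondegenerate[OF l]])
  obtain \<eta> where \<eta>: "\<eta> > 0" and stable: "\<And>t g0 g1 g2. t \<in> ?K \<Longrightarrow>
      \<bar>g0 - base_val t\<bar> \<le> \<eta> \<Longrightarrow> \<bar>g1 - base_d1 t\<bar> \<le> \<eta> \<Longrightarrow> \<bar>g2 - base_d2 t\<bar> \<le> \<eta> \<Longrightarrow>
     (g1 = 0 \<longrightarrow> base_val t * g0 > 0 \<and> g0 * g2 < 0 \<and> \<eta> \<le> \<bar>g0\<bar>) \<and> (base_val t = 0 \<longrightarrow> base_d1 t * g1 > 0)"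
    using ex by blast
  have "\<exists>z\<in>{-1..1}. \<forall>x\<in>{-1..1}. max \<bar>poly Q z\<bar> \<bar>poly (pderiv Q) z\<bar> \<le> max \<bar>poly Q x\<bar> \<bar>poly (pderiv Q) x\<bar>"
    by (intro continuous_attains_inf continuous_intros) auto
  then obtain z0 where z0: "\<And>x. x \<in> {-1..1} \<Longrightarrow>
      max \<bar>poly Q z0\<bar> \<bar>poly (pderiv Q) z0\<bar> \<le> max \<bar>poly Q x\<bar> \<bar>poly (pderiv Q) x\<bar>" by blast
  define e where "e = max \<bar>poly Q z0\<bar> \<bar>poly (pderiv Q) z0\<bar>"
  have e: "e > 0" using dleg_simple[of 1 l z0] l by (auto simp: e_def less_max_iff_disj)
  have Q': "poly (pderiv Q) x \<noteq> 0" if "\<bar>x\<bar> \<le> 1" "\<bar>poly Q x\<bar> < e" for x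
  proof -
    have "x \<in> {-1..1}" using that(1) by (simp add: abs_le_iff)
    from z0[OF this] show ?thesis using that(2) unfolding e_def[symmetric] by auto
  qed
  define A B where "A = [:1, 0, -1:] * (Q * Q)" "B = [:1, 0, -1:] * Q"
  have T: "quad_part b c = smult b A - smult c B" for b c
    unfolding quad_part_def quad_coeff_def A_B_def by (simp only: right_diff_distrib mult_smult_right)
  define A1 A2 B1 B2 where AB:
    "A1 t = - sin t * poly (pderiv A) (cos t)"
    "A2 t = - cos t * poly (pderiv A) (cos t) + (sin t)\<^sup>2 * poly (pderiv (pderiv A)) (cos t)"
    "B1 t = - sin t * poly (pderiv B) (cos t)"
    "B2 t = - cos t * poly (pderiv B) (cos t) + (sin t)\<^sup>2 * poly (pderiv (pderiv B)) (cos t)" for t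
  define g where "g t = \<bar>poly A (cos t)\<bar> + \<bar>A1 t\<bar> + \<bar>A2 t\<bar> + \<bar>poly B (cos t)\<bar> + \<bar>B1 t\<bar> + \<bar>B2 t\<bar> 
     + \<bar>poly Q (cos t)\<bar> + \<bar>poly Q (cos t) * poly Q (cos t)\<bar>" for t
  have "continuous_on ?K g" unfolding g_def AB by (intro continuous_intros)
  then obtain N0 where N0: "\<And>t. t \<in> ?K \<Longrightarrow> \<bar>g t\<bar> \<le> N0" using compact_bound by blast
  define N where "N = max 1 N0"
  have N1: "N \<ge> 1" by (simp add: N_def)
  have gN: "g t \<le> N" if "t \<in> ?K" for t using N0[OF that] unfolding N_def by linarith
  have N: "\<bar>poly A (cos t)\<bar> \<le> N" "\<bar>A1 t\<bar> \<le> N" "\<bar>A2 t\<bar> \<le> N" "\<bar>poly B (cos t)\<bar> \<le> N"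
      "\<bar>B1 t\<bar> \<le> N" "\<bar>B2 t\<bar> \<le> N" "\<bar>poly Q (cos t)\<bar> \<le> N" "\<bar>poly Q (cos t) * poly Q (cos t)\<bar> \<le> N"
      if "t \<in> ?K" for t
  proof -
    have eight: "p1 \<le> N \<and> p2 \<le> N \<and> p3 \<le> N \<and> p4 \<le> N \<and> p5 \<le> N \<and> p6 \<le> N \<and> p7 \<le> N \<and> p8 \<le> N"
      if "p1 + p2 + p3 + p4 + p5 + p6 + p7 + p8 \<le> N" "0 \<le> p1" "0 \<le> p2" "0 \<le> p3" "0 \<le> p4"
        "0 \<le> p5" "0 \<le> p6" "0 \<le> p7" "0 \<le> p8" for p1 p2 p3 p4 p5 p6 p7 p8 :: real
      using that by linarith
    from eight[OF gN[OF that, unfolded g_def]] show "\<bar>poly A (cos t)\<bar> \<le> N" "\<bar>A1 t\<bar> \<le> N" "\<bar>A2 t\<bar> \<le> N" 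
      "\<bar>poly B (cos t)\<bar> \<le> N" "\<bar>B1 t\<bar> \<le> N" "\<bar>B2 t\<bar> \<le> N" "\<bar>poly Q (cos t)\<bar> \<le> N" 
      "\<bar>poly Q (cos t) * poly Q (cos t)\<bar> \<le> N" by simp_all
  qed
  (* The common smallness requirement.  The bound closest to it below is 5 \<delta> N on |Q|, so 6 leaves
     room for a strict inequality. *)
  define \<mu> where "\<mu> = min \<eta> (min e 1)"
  have \<mu>: "\<mu> > 0" "\<mu> \<le> \<eta>" "\<mu> \<le> e" "\<mu> \<le> 1" using \<eta> e by (auto simp: \<mu>_def)
  define \<delta> where "\<delta> = \<mu> / (6 * N)"
  have \<delta>: "\<delta> > 0" "6 * (\<delta> * N) = \<mu>" using \<mu> N1 by (auto simp: \<delta>_def)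
  have \<delta>N: "\<delta> \<le> \<delta> * N" using \<delta>(1) N1 by simp
  have "nondegenerate a b c" if abc: "\<bar>a\<bar> \<le> \<delta>" "\<bar>b\<bar> \<le> \<delta>" "\<bar>c\<bar> \<le> \<delta>" for a b c
  proof -
    have small: "\<bar>p * v\<bar> \<le> \<delta> * N" if "\<bar>p\<bar> \<le> \<delta>" "\<bar>v\<bar> \<le> N" for p v
      unfolding abs_mult using that by (intro mult_mono) auto
    have trig: "\<bar>a * sin t\<bar> \<le> \<delta> * N" "\<bar>a * cos t\<bar> \<le> \<delta> * N" for t
      using N1 abs_sin_le_one[of t] abs_cos_le_one[of t] by (auto intro!: small abc order.trans[OF _ N1])
    have S: "\<bar>poly (quad_coeff b c) (cos t)\<bar> \<le> 2 * (\<delta> * N)" if "t \<in> ?K" for t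
      using small[OF abc(2) N(8)[OF that]] small[OF abc(3) N(7)[OF that]]
      unfolding quad_coeff_def poly_diff poly_smult poly_mult by linarith
    have Z: "\<bar>poly Q z\<bar> \<le> N" "\<bar>poly (quad_coeff b c) z\<bar> \<le> 2 * (\<delta> * N)" if "\<bar>z\<bar> \<le> 1" for z
    proof -
      have "arccos z \<in> ?K" "cos (arccos z) = z" using that by (auto intro: arccos_lbound arccos_ubound cos_arccos_abs)
      thus "\<bar>poly Q z\<bar> \<le> N" "\<bar>poly (quad_coeff b c) z\<bar> \<le> 2 * (\<delta> * N)" using N(7) S by metis+
    qed
    have near: "\<bar>s * x - y\<bar> \<le> \<eta>" if "x = s * (y - p) + (q - r)" "s = 1 \<or> s = -1"
        "\<bar>p\<bar> \<le> \<delta> * N" "\<bar>q\<bar> \<le> \<delta> * N" "\<bar>r\<bar> \<le> \<delta> * N" for x s y p q r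
    proof -
      have "s * s = 1" using that(2) by auto
      hence "s * x - y = s * (q - r) - p"
        unfolding that(1) by (simp add: right_diff_distrib distrib_left flip: mult.assoc)
      moreover have "\<bar>s * (q - r)\<bar> = \<bar>q - r\<bar>" using that(2) by (auto simp: abs_mult)
      ultimately show ?thesis using that(3-5) \<delta> \<mu>(1,2) by linarith
    qed
    show ?thesis unfolding nondegenerate_def
    proof (intro conjI ballI allI impI)
      fix t s :: real assume t: "t \<in> ?K" and s: "s = 1 \<or> s = -1"
      note n = small[OF abc(2) N(1)[OF t]] small[OF abc(2) N(2)[OF t]] small[OF abc(2) N(3)[OF t]]
        small[OF abc(3) N(4)[OF t]] small[OF abc(3) N(5)[OF t]] small[OF abc(3) N(6)[OF t]] trig[of t] trig(1)[of t, unfolded abs_minus_cancel[of "a * sin t", symmetric]]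
      have "merid_val a b c s t = s * (base_val t - a * sin t) + (b * poly A (cos t) - c * poly B (cos t))"
        by (simp add: merid_val_alt T)
      from near[OF this s n(7) n(1) n(4)] have c0: "\<bar>s * merid_val a b c s t - base_val t\<bar> \<le> \<eta>"
        .
      have "merid_d1 a b c s t = s * (base_d1 t - a * cos t) + (b * A1 t - c * B1 t)"
        by (simp add: merid_d1_def T AB pderiv_diff pderiv_smult algebra_simps)
      from near[OF this s n(8) n(2) n(5)] have c1: "\<bar>s * merid_d1 a b c s t - base_d1 t\<bar> \<le> \<eta>"
        .
      have "merid_d2 a b c s t = s * (base_d2 t - - (a * sin t)) + (b * A2 t - c * B2 t)"
        by (simp add: merid_d2_def T AB pderiv_diff pderiv_smult algebra_simps)
      from near[OF this s n(9) n(3) n(6)] have c2: "\<bar>s * merid_d2 a b c s t - base_d2 t\<bar> \<le> \<eta>"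
        .
      note st = stable[OF t c0 c1 c2]
      show "base_d1 t * (s * merid_d1 a b c s t) > 0" if "base_val t = 0" using st that by blast
      assume z: "merid_d1 a b c s t = 0"
      have st1: "base_val t * (s * merid_val a b c s t) > 0" "(s * merid_val a b c s t) * (s * merid_d2 a b c s t) < 0"
          "\<eta> \<le> \<bar>s * merid_val a b c s t\<bar>" using st z by auto
      show "base_val t * (s * merid_val a b c s t) > 0" by fact
      show "merid_val a b c s t * merid_d2 a b c s t < 0" using st1(2) s by auto
      have "\<bar>poly (quad_coeff b c) (cos t)\<bar> < \<eta>" using S[OF t] \<delta> \<mu> by linarith
      also have "\<eta> \<le> \<bar>merid_val a b c s t\<bar>" using st1(3) s by auto
      finally show "\<bar>poly (quad_coeff b c) (cos t)\<bar> < \<bar>merid_val a b c s t\<bar>" .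
    next
      fix z x :: real assume zx: "\<bar>z\<bar> \<le> 1 \<and> \<bar>x\<bar> \<le> 1"
      have xv: "\<bar>x * v\<bar> \<le> \<bar>v\<bar>" for v unfolding abs_mult using zx by (intro mult_left_le_one_le) auto
      have "\<bar>2 * b * poly Q z - c\<bar> \<le> 3 * (\<delta> * N)"
        using small[OF abc(2), of "poly Q z"] Z(1) zx abc \<delta>N by (simp add: mult.assoc)
      hence "\<bar>x * (2 * b * poly Q z - c)\<bar> < 1" using xv[of "2 * b * poly Q z - c"] \<delta> \<mu> by linarith
      thus "1 + x * (2 * b * poly Q z - c) \<noteq> 0" by linarith
      assume 0: "poly Q z - a + 2 * x * poly (quad_coeff b c) z = 0"
      have "\<bar>poly Q z\<bar> < e"
      proof -
        have "2 * x * poly (quad_coeff b c) z = 2 * (x * poly (quad_coeff b c) z)" by simp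
        moreover have "\<bar>poly (quad_coeff b c) z\<bar> \<le> 2 * (\<delta> * N)" using Z(2) zx by blast
        ultimately show ?thesis using 0 xv[of "poly (quad_coeff b c) z"] abc(1) \<delta>N \<delta> \<mu> by linarith
      qed
      thus "poly (pderiv Q) z \<noteq> 0" using Q' zx by blast
    qed
  qed
  thus ?thesis using \<delta>(1) by blast
qed

definition merid :: "real \<Rightarrow> real \<Rightarrow> real ^ 3" where
  "merid s \<theta> = vector [s * sin \<theta>, 0, cos \<theta>]"

lemma merid_nth [simp]: "merid s \<theta> $ 1 = s * sin \<theta>" "merid s \<theta> $ 2 = 0" "merid s \<theta> $ 3 = cos \<theta>"
  by (simp_all add: merid_def vector_3)

lemma norm_eq_1_vec3: "norm (u :: real ^ 3) = 1 \<longleftrightarrow> (u $ 1)\<^sup>2 + (u $ 2)\<^sup>2 + (u $ 3)\<^sup>2 = 1"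
  by (simp add: norm_eq_1 inner_vec_def sum_3 power2_eq_square)

lemma norm_merid: "s\<^sup>2 = 1 \<Longrightarrow> norm (merid s \<theta>) = 1"
  unfolding norm_eq_1_vec3 by (simp add: power_mult_distrib)

lemma pharm_merid: "s\<^sup>2 = 1 \<Longrightarrow> pharm a b c (merid s \<theta>) = merid_val a b c s \<theta>"
  by (simp add: pharm_def merid_val_def quad_part_def power_mult_distrib sin_squared_eq power2_eq_square[of "cos \<theta>"] algebra_simps)

lemma isCont_vector3:
  assumes "isCont f x" "isCont g x" "isCont h x"
  shows "isCont (\<lambda>x. vector [f x, g x, h x] :: real ^ 3) x"
  unfolding isCont_def
proof (rule vec_tendstoI)
  fix i :: 3
  show "(\<lambda>x. (vector [f x, g x, h x] :: real ^ 3) $ i) \<midarrow>x\<rightarrow> (vector [f x, g x, h x] :: real ^ 3) $ i"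
    using exhaust_3[of i] assms by (auto simp: vector_3 isCont_def)
qed

text \<open>
  A critical point with a negative value would be a strict local minimum along the meridian,
  because value and second derivative have opposite signs.
\<close>
lemma pharm_max_on_circle:
  assumes u: "merid s \<theta> \<in> sphere_max (pharm a b c)" and s: "s = 1 \<or> s = -1" and g: "nondegenerate a b c" and th: "\<theta> \<in> {0..pi}"
  shows "merid_d1 a b c s \<theta> = 0" "merid_val a b c s \<theta> > 0"
proof -
  have s2: "s\<^sup>2 = 1" using s by auto
  have "isCont (\<lambda>t. merid s (\<theta> + t)) 0"
    unfolding merid_def by (intro isCont_vector3 continuous_intros)
  then obtain e where e: "e > 0" "\<forall>t. \<bar>t\<bar> < e \<longrightarrow> pharm a b c (merid s (\<theta> + t)) \<le> pharm a b c (merid s \<theta>)"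
    using sphere_max_curve[OF u, of "\<lambda>t. merid s (\<theta> + t)"] norm_merid[OF s2] by auto
  have loc: "merid_val a b c s t \<le> merid_val a b c s \<theta>" if "\<bar>t - \<theta>\<bar> < e" for t
    using e(2)[rule_format, OF that] unfolding pharm_merid[OF s2] by simp
  hence "\<forall>y. \<bar>\<theta> - y\<bar> < e \<longrightarrow> merid_val a b c s y \<le> merid_val a b c s \<theta>" by (simp add: abs_minus_commute)
  thus z: "merid_d1 a b c s \<theta> = 0" by (rule DERIV_local_max[OF merid_val_deriv e(1)])
  have gd: "merid_val a b c s \<theta> * merid_d2 a b c s \<theta> < 0" 
    using g th s z unfolding nondegenerate_def by blast
  show "merid_val a b c s \<theta> > 0"
  proof (rule ccontr)
    assume "\<not> merid_val a b c s \<theta> > 0"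
    hence merid_d2: "merid_d2 a b c s \<theta> > 0" using gd by (auto simp: mult_less_0_iff)
    have "\<exists>d>0. \<forall>t. \<bar>t - \<theta>\<bar> < d \<longrightarrow> - merid_val a b c s t \<le> - merid_val a b c s \<theta> \<and> (t \<noteq> \<theta> \<longrightarrow> - merid_val a b c s t < - merid_val a b c s \<theta>)"
      using z merid_d2 by (intro second_derivative_max[where f' = "\<lambda>t. - merid_d1 a b c s t" and D = "- merid_d2 a b c s \<theta>"]
          DERIV_minus merid_val_deriv merid_d1_deriv) auto
    then obtain k where k: "k > 0" "\<And>t. \<bar>t - \<theta>\<bar> < k \<Longrightarrow> t \<noteq> \<theta> \<Longrightarrow> merid_val a b c s t > merid_val a b c s \<theta>" by auto
    define t where "t = \<theta> + min k e / 2"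
    have "\<bar>t - \<theta>\<bar> < k" "\<bar>t - \<theta>\<bar> < e" "t \<noteq> \<theta>" using k(1) e(1) by (auto simp: t_def min_def)
    thus False using k(2)[of t] loc[of t] by auto
  qed
qed

lemma pharm_deriv: "(pharm a b c has_derivative (\<lambda>h. (poly Q (u$3) - a + 2 * u$1 * poly (quad_coeff b c) (u$3)) * h$1
   + u$1 * poly (pderiv Q) (u$3) * (1 + u$1 * (2 * b * poly Q (u$3) - c)) * h$3)) (at u)"
proof -
  have P: "((\<lambda>u. poly P (u$3)) has_derivative (\<lambda>h. h$3 * poly (pderiv P) (u$3))) (at u)" for P and u :: "real^3"
    by (rule DERIV_compose_FDERIV[OF poly_DERIV bounded_linear_imp_has_derivative[OF bounded_linear_vec_nth]])
  have S': "poly (pderiv (quad_coeff b c)) z = 2 * b * poly Q z * poly (pderiv Q) z - c * poly (pderiv Q) z" for z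
    by (simp add: quad_coeff_def pderiv_diff pderiv_smult pderiv_mult algebra_simps)
  have N: "((\<lambda>u. u$1) has_derivative (\<lambda>h. h$1)) (at u)" for u :: "real^3"
    by (rule bounded_linear_imp_has_derivative[OF bounded_linear_vec_nth])
  show ?thesis unfolding pharm_def
    by (rule derivative_eq_intros P N refl)+ (auto simp: S' fun_eq_iff algebra_simps power2_eq_square)
qed

lemma pharm_differentiable: "pharm a b c differentiable (at u)"
  using pharm_deriv unfolding differentiable_def by blast

text \<open>
  Off the plane y = 0 the coordinates x and z are free, so both partial derivatives
  vanish.  The z-derivative is x Q'(z) times a factor close to 1, and the x-derivative forces Q(z) to
  be small, hence Q'(z) \<noteq> 0.  So x = 0 and Q(z) = a, where the function equals 0.  This is a
  saddle: raising Q(z) slightly above a and then taking x > 0 tiny makes the function positive.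
\<close>
lemma pharm_max_off_circle:
  assumes u: "u \<in> sphere_max (pharm a b c)" and g: "nondegenerate a b c" and y: "u $ 2 \<noteq> 0"
  shows False
proof -
  let ?z = "u $ 3"
  have nu: "(u $ 1)\<^sup>2 + (u $ 2)\<^sup>2 + (u $ 3)\<^sup>2 = 1" using u by (simp add: sphere_max_def norm_eq_1_vec3)
  obtain k where k: "(\<lambda>h. (poly Q (u$3) - a + 2 * u$1 * poly (quad_coeff b c) (u$3)) * h$1
   + u$1 * poly (pderiv Q) (u$3) * (1 + u$1 * (2 * b * poly Q (u$3) - c)) * h$3) = (\<lambda>h. k * (u \<bullet> h))"
    using sphere_max_lagrange[OF pharm_deriv u] by blast
  have in2: "u \<bullet> axis 2 1 = u $ 2" by (simp add: inner_axis)
  have ax: "(axis 2 1 :: real^3) $ 1 = 0" "(axis 2 1 :: real^3) $ 3 = 0" "(axis 1 1 :: real^3) $ 1 = 1" 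
    "(axis 1 1 :: real^3) $ 3 = 0" "(axis 3 1 :: real^3) $ 1 = 0" "(axis 3 1 :: real^3) $ 3 = 1" 
    by (simp_all add: axis_def)
  have "k * u $ 2 = 0" using fun_cong[OF k, of "axis 2 1"] unfolding in2 ax by simp
  hence "k = 0" using y by simp
  hence gx: "poly Q ?z - a + 2 * u$1 * poly (quad_coeff b c) ?z = 0"
    and gz: "u$1 * poly (pderiv Q) ?z * (1 + u$1 * (2 * b * poly Q ?z - c)) = 0"
    using fun_cong[OF k, of "axis 1 1"] fun_cong[OF k, of "axis 3 1"] unfolding ax by simp_all
  have "(u$3)\<^sup>2 \<le> 1" "(u$1)\<^sup>2 \<le> 1" using nu zero_le_power2[of "u$1"] zero_le_power2[of "u$2"] zero_le_power2[of "u$3"] by linarith+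
  hence z1: "\<bar>?z\<bar> \<le> 1" "\<bar>u$1\<bar> \<le> 1" by (auto simp: abs_square_le_1)
  have Q': "poly (pderiv Q) ?z \<noteq> 0" and "1 + u$1 * (2 * b * poly Q ?z - c) \<noteq> 0"
    using g z1 gx unfolding nondegenerate_def by blast+
  hence x: "u $ 1 = 0" using gz by auto
  hence qa: "poly Q ?z = a" using gx by simp
  have Gu: "pharm a b c u = 0" by (simp add: pharm_def x)
  have "\<exists>d>0. \<forall>x\<in>sphere 0 1. x \<noteq> u \<and> dist x u < d \<longrightarrow> pharm a b c x \<le> pharm a b c u"
    using u unfolding sphere_max_def mem_Collect_eq eventually_at by (elim conjE)
  then obtain d where d: "d > 0" 
    "\<And>x. x\<in>sphere 0 1 \<Longrightarrow> x \<noteq> u \<Longrightarrow> dist x u < d \<Longrightarrow> pharm a b c x \<le> pharm a b c u"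
    by blast
  (* The coordinates (x, z) as a chart of the hemisphere that contains u. *)
  define \<psi> where "\<psi> p = (vector [fst p, sgn (u$2) * sqrt (1 - (fst p)\<^sup>2 - (snd p)\<^sup>2), snd p] :: real ^ 3)" for p
  have cont: "isCont \<psi> (0, ?z)" unfolding \<psi>_def by (rule isCont_vector3; intro continuous_intros)
  have "(u$2)\<^sup>2 = 1 - ?z\<^sup>2" using nu x by simp
  hence "sqrt (1 - ?z\<^sup>2) = \<bar>u $ 2\<bar>" by (metis real_sqrt_abs)
  hence psi0: "\<psi> (0, ?z) = u"
    by (simp add: \<psi>_def vec_eq_iff forall_3 vector_3 x sgn_mult_abs)
  obtain e where e: "e > 0" "\<And>p. dist p (0, ?z) < e \<Longrightarrow> dist (\<psi> p) u < d"
    using cont d(1) unfolding continuous_at_eps_delta psi0 by blast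
    have "0 < (u$2)\<^sup>2" using y by simp
    hence "?z\<^sup>2 < 1" using \<open>(u$2)\<^sup>2 = 1 - ?z\<^sup>2\<close> by linarith
    hence lt: "\<bar>?z\<bar> < 1" by (simp add: abs_square_less_1)
  have "\<exists>z. \<bar>z - ?z\<bar> < min (e/2) ((1 - \<bar>?z\<bar>) / 2) \<and> poly Q z > a"
  proof -
    define r where "r = min (e/2) ((1 - \<bar>?z\<bar>) / 2)"
    have r: "r > 0" using e lt by (simp add: r_def)
    consider "poly (pderiv Q) ?z > 0" | "poly (pderiv Q) ?z < 0" using Q' by linarith
    thus ?thesis
    proof cases
      case 1
      then obtain q where q: "q > 0" "\<And>h. 0 < h \<Longrightarrow> h < q \<Longrightarrow> poly Q ?z < poly Q (?z + h)"
        using has_real_derivative_pos_inc_right[of "poly Q" "poly (pderiv Q) ?z" ?z UNIV] poly_DERIV by force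
      show ?thesis unfolding r_def[symmetric]
        using q(1) r q(2)[of "min q r / 2"] qa by (intro exI[of _ "?z + min q r / 2"]) (auto simp: min_def)
    next
      case 2
      then obtain q where q: "q > 0" "\<And>h. 0 < h \<Longrightarrow> h < q \<Longrightarrow> poly Q ?z < poly Q (?z - h)"
        using has_real_derivative_neg_dec_left[of "poly Q" "poly (pderiv Q) ?z" ?z UNIV] poly_DERIV by force
      show ?thesis unfolding r_def[symmetric]
        using q(1) r q(2)[of "min q r / 2"] qa by (intro exI[of _ "?z - min q r / 2"]) (auto simp: min_def)
    qed
  qed
  then obtain z where z: "\<bar>z - ?z\<bar> < e / 2" "\<bar>z - ?z\<bar> < (1 - \<bar>?z\<bar>) / 2" "poly Q z > a" by auto
  have z1: "\<bar>z\<bar> < 1" using z(2) lt abs_triangle_ineq[of "z - ?z" ?z] by simp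
  define S where "S = \<bar>poly (quad_coeff b c) z\<bar> + 1"
  (* Small enough to stay in the chart and in the neighbourhood, and for the quadratic term to be
     dominated by Q(z) - a. *)
  define t where "t = min (e / 4) (min (1 - \<bar>z\<bar>) ((poly Q z - a) / (2 * S)))"
  have S: "S > 0" by (simp add: S_def)
  have t: "t > 0" "t \<le> e / 4" "t \<le> 1 - \<bar>z\<bar>" "t \<le> (poly Q z - a) / (2 * S)"
    using e(1) z1 z(3) S unfolding t_def min_less_iff_conj min_le_iff_disj by auto
  have "t\<^sup>2 \<le> (1 - \<bar>z\<bar>)\<^sup>2" using t by (intro power_mono) auto
  also have "\<dots> \<le> 1 - z\<^sup>2"
  proof -
    have "(1 - \<bar>z\<bar>)\<^sup>2 = 1 - 2 * \<bar>z\<bar> + \<bar>z\<bar> * \<bar>z\<bar>" by (simp add: power2_eq_square algebra_simps)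
    moreover have "z\<^sup>2 = \<bar>z\<bar> * \<bar>z\<bar>" by (simp add: power2_eq_square)
    moreover have "\<bar>z\<bar> * \<bar>z\<bar> \<le> 1 * \<bar>z\<bar>" using z1 by (intro mult_right_mono) auto
    ultimately show ?thesis by linarith
  qed
  finally have tz: "0 \<le> 1 - t\<^sup>2 - z\<^sup>2" by linarith
  have sg: "(sgn (u$2))\<^sup>2 = 1" using y by (simp add: sgn_if)
  have "norm (\<psi> (t, z)) = 1" unfolding norm_eq_1_vec3
    using tz sg by (simp add: \<psi>_def vector_3 power_mult_distrib)
  moreover have "dist (t, z) (0, ?z) < e"
  proof -
    have "dist (t, z) (0, ?z) \<le> dist t 0 + dist z ?z"
      unfolding dist_Pair_Pair by (rule sqrt_sum_squares_le_sum) auto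
    thus ?thesis using t z by (simp add: dist_real_def)
  qed
  hence "dist (\<psi> (t, z)) u < d" by (rule e(2))
  moreover have pos: "pharm a b c (\<psi> (t, z)) > 0"
  proof -
    have "t * \<bar>poly (quad_coeff b c) z\<bar> \<le> t * S" using t by (simp add: S_def)
    also have "\<dots> \<le> (poly Q z - a) / (2 * S) * S" using t S by (intro mult_right_mono) auto
    also have "\<dots> < poly Q z - a" using S z(3) by simp
    finally have "\<bar>t * poly (quad_coeff b c) z\<bar> < poly Q z - a" using t(1) by (simp add: abs_mult)
    hence "0 < t * (poly Q z - a + t * poly (quad_coeff b c) z)" using t(1) by (intro mult_pos_pos) auto
    thus ?thesis by (simp add: pharm_def \<psi>_def vector_3 power2_eq_square algebra_simps)
  qed
  ultimately show False using d(2)[of "\<psi> (t, z)"] Gu by (cases "\<psi> (t, z) = u") auto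
qed

text \<open>
  The colatitudes of the local maxima.  At the colatitude \<theta> only the half meridian
  on which the unperturbed function is positive can carry a maximum, which fixes the sign s.
\<close>
definition merid_maxima :: "real \<Rightarrow> real \<Rightarrow> real \<Rightarrow> real set" where
  "merid_maxima a b c = {\<theta>\<in>{0..pi}. base_val \<theta> \<noteq> 0 \<and> merid_d1 a b c (sgn (base_val \<theta>)) \<theta> = 0}"

lemma sgn_cases: "(x::real) \<noteq> 0 \<Longrightarrow> sgn x = 1 \<or> sgn x = -1" by (auto simp: sgn_if)

lemma merid_maxima_facts:
  assumes g: "nondegenerate a b c" and th: "\<theta> \<in> merid_maxima a b c"
  shows "merid_val a b c (sgn (base_val \<theta>)) \<theta> > 0" "merid_d2 a b c (sgn (base_val \<theta>)) \<theta> < 0"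
    "\<bar>poly (quad_coeff b c) (cos \<theta>)\<bar> < merid_val a b c (sgn (base_val \<theta>)) \<theta>"
proof -
  define s where "s = sgn (base_val \<theta>)"
  have s: "s = 1 \<or> s = -1" "base_val \<theta> \<noteq> 0" "\<theta> \<in> {0..pi}" "merid_d1 a b c s \<theta> = 0"
    using th sgn_cases by (auto simp: merid_maxima_def s_def)
  hence g': "base_val \<theta> * (s * merid_val a b c s \<theta>) > 0" "merid_val a b c s \<theta> * merid_d2 a b c s \<theta> < 0"
     "\<bar>poly (quad_coeff b c) (cos \<theta>)\<bar> < \<bar>merid_val a b c s \<theta>\<bar>"
    using g unfolding nondegenerate_def by blast+
  have "base_val \<theta> * s = \<bar>base_val \<theta>\<bar>" by (simp add: s_def mult_sgn_abs abs_sgn)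
  hence "\<bar>base_val \<theta>\<bar> * merid_val a b c s \<theta> > 0" using g'(1) by (simp flip: mult.assoc)
  hence merid_val: "merid_val a b c s \<theta> > 0" by (simp add: zero_less_mult_iff)
  moreover have "merid_d2 a b c s \<theta> < 0" using g'(2) merid_val by (simp add: mult_less_0_iff)
  ultimately show "merid_val a b c (sgn (base_val \<theta>)) \<theta> > 0" "merid_d2 a b c (sgn (base_val \<theta>)) \<theta> < 0"
    "\<bar>poly (quad_coeff b c) (cos \<theta>)\<bar> < merid_val a b c (sgn (base_val \<theta>)) \<theta>" using g'(3) by (simp_all add: s_def)
qed

text \<open>
  Along the meridian the point is a strict local maximum by the second derivative.
  Across it, at a fixed height z the function is quadratic in x, and near the point it increases
  from x to the end s sqrt (1 - z^2) of the interval of admissible x, which lies on the meridian.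
\<close>
lemma merid_in_sphere_max:
  assumes g: "nondegenerate a b c" and th: "\<theta> \<in> merid_maxima a b c"
  shows "merid (sgn (base_val \<theta>)) \<theta> \<in> sphere_max (pharm a b c)"
proof -
  define s where "s = sgn (base_val \<theta>)"
  define S where "S = poly (quad_coeff b c)"
  have s: "s = 1 \<or> s = -1" "base_val \<theta> \<noteq> 0" "\<theta> \<in> {0..pi}" "merid_d1 a b c s \<theta> = 0"
    using th sgn_cases by (auto simp: merid_maxima_def s_def)
  have s2: "s\<^sup>2 = 1" and ss: "s * s = 1" using s(1) by auto
  note X = merid_maxima_facts[OF g th, folded s_def]
  have sp: "sin \<theta> > 0" using s(2,3) sin_ge_zero[of \<theta>] by (auto simp: base_val_def)
  have cl: "-1 < cos \<theta>" "cos \<theta> < 1"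
  proof -
    have "(sin \<theta>)\<^sup>2 > 0" using sp by simp
    hence "(cos \<theta>)\<^sup>2 < 1" using sin_cos_squared_add[of \<theta>] by linarith
    hence "\<bar>cos \<theta>\<bar> < 1" by (simp add: abs_square_less_1)
    thus "-1 < cos \<theta>" "cos \<theta> < 1" by auto
  qed
  have ac: "arccos (cos \<theta>) = \<theta>" using s(3) by (simp add: arccos_cos)
  obtain d where d: "d > 0" "\<And>t. \<bar>t - \<theta>\<bar> < d \<Longrightarrow> merid_val a b c s t \<le> merid_val a b c s \<theta>"
    using second_derivative_max[OF merid_val_deriv merid_d1_deriv s(4) X(2)] by blast
  let ?F = "at (merid s \<theta>) within sphere 0 1"
  have t3: "((\<lambda>v. v $ 3) \<longlongrightarrow> cos \<theta>) ?F"
    using tendsto_vec_nth[OF tendsto_ident_at[of "merid s \<theta>" "sphere 0 1"], of 3] by simp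
  have t1: "((\<lambda>v. v $ 1) \<longlongrightarrow> s * sin \<theta>) ?F"
    using tendsto_vec_nth[OF tendsto_ident_at[of "merid s \<theta>" "sphere 0 1"], of 1] by simp
  have ta: "((\<lambda>v. arccos (v $ 3)) \<longlongrightarrow> \<theta>) ?F"
    using isCont_tendsto_compose[OF isCont_arccos[OF cl] t3] ac by simp
  have e1: "\<forall>\<^sub>F v in ?F. merid_val a b c s (arccos (v $ 3)) \<le> merid_val a b c s \<theta>"
    using tendstoD[OF ta d(1)] by (rule eventually_mono) (auto simp: dist_real_def intro: d(2))
  have tb: "((\<lambda>v. s * (poly Q (v$3) - a + (s * sin (arccos (v$3)) + v$1) * S (v$3)))
     \<longlongrightarrow> s * (poly Q (cos \<theta>) - a + (s * sin \<theta> + s * sin \<theta>) * S (cos \<theta>))) ?F"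
    unfolding S_def by (intro tendsto_intros t3 t1 ta)
  have "sin \<theta> * (s * (poly Q (cos \<theta>) - a + (s * sin \<theta> + s * sin \<theta>) * S (cos \<theta>)))
      = merid_val a b c s \<theta> + (sin \<theta>)\<^sup>2 * S (cos \<theta>)"
  proof -
    have "sin \<theta> * (s * (poly Q (cos \<theta>) - a + (s * sin \<theta> + s * sin \<theta>) * S (cos \<theta>)))
       = s * sin \<theta> * (poly Q (cos \<theta>) - a) + 2 * (s * s) * (sin \<theta>)\<^sup>2 * S (cos \<theta>)"
      by (simp add: algebra_simps power2_eq_square)
    moreover have "poly (quad_part b c) (cos \<theta>) = (sin \<theta>)\<^sup>2 * S (cos \<theta>)"
      unfolding quad_part_def S_def sin_squared_eq poly_mult by (simp add: power2_eq_square)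
    ultimately show ?thesis by (simp add: merid_val_def ss)
  qed
  also have "\<dots> > 0"
  proof -
    have "(sin \<theta>)\<^sup>2 \<le> 1" by (simp add: sin_squared_eq)
    hence "\<bar>(sin \<theta>)\<^sup>2 * S (cos \<theta>)\<bar> \<le> \<bar>S (cos \<theta>)\<bar>" unfolding abs_mult by (intro mult_left_le_one_le) auto
    thus ?thesis using X(3) unfolding S_def by linarith
  qed
  finally have "0 < s * (poly Q (cos \<theta>) - a + (s * sin \<theta> + s * sin \<theta>) * S (cos \<theta>))"
    using sp by (simp add: zero_less_mult_iff)
  from order_tendstoD(1)[OF tb this]
  have e2: "\<forall>\<^sub>F v in ?F. 0 < s * (poly Q (v$3) - a + (s * sin (arccos (v$3)) + v$1) * S (v$3))" .
  have e3: "\<forall>\<^sub>F v in ?F. v \<in> sphere 0 1" by (auto simp: eventually_at_filter)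
  from e1 e2 e3 have "\<forall>\<^sub>F v in ?F. pharm a b c v \<le> pharm a b c (merid s \<theta>)"
  proof eventually_elim
    case (elim v)
    define z x r where "z = v$3" "x = v$1" "r = sin (arccos (v$3))"
    have nv: "x\<^sup>2 + (v $ 2)\<^sup>2 + z\<^sup>2 = 1" using elim(3) by (simp add: norm_eq_1_vec3 z_x_r_def)
    have z1: "z\<^sup>2 \<le> 1" using nv zero_le_power2[of x] zero_le_power2[of "v$2"] by linarith
    hence za: "\<bar>z\<bar> \<le> 1" by (simp add: abs_square_le_1)
    have cz: "cos (arccos z) = z" using za by (rule cos_arccos_abs)
    have r: "r = sqrt (1 - z\<^sup>2)" using za by (simp add: z_x_r_def sin_arccos abs_le_iff)
    hence r2: "r\<^sup>2 = 1 - z\<^sup>2" "r \<ge> 0" using z1 by auto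
    have "x\<^sup>2 \<le> r\<^sup>2" using nv r2 zero_le_power2[of "v$2"] by linarith
    hence "\<bar>x\<bar> \<le> r" using r2(2) abs_le_square_iff[of x r] by simp
    hence "0 \<le> r - s * x" using s(1) by auto
    hence "0 \<le> (r - s * x) * (s * (poly Q z - a + (s * r + x) * S z))"
      using elim(2) by (simp add: z_x_r_def)
    also have "\<dots> = s * r * (poly Q z - a) + s * s * r\<^sup>2 * S z - s * s * (x * (poly Q z - a) + x\<^sup>2 * S z)
        + (s * r * x * S z - s * s * s * r * x * S z)"
      by (simp add: algebra_simps power2_eq_square)
    also have "\<dots> = s * r * (poly Q z - a) + r\<^sup>2 * S z - (x * (poly Q z - a) + x\<^sup>2 * S z)"
      unfolding ss by simp
    also have "s * r * (poly Q z - a) + r\<^sup>2 * S z = merid_val a b c s (arccos z)"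
      unfolding merid_val_def cz r2(1) by (simp add: z_x_r_def quad_part_def S_def power2_eq_square algebra_simps)
    also have "x * (poly Q z - a) + x\<^sup>2 * S z = pharm a b c v"
      by (simp add: pharm_def z_x_r_def S_def)
    finally have "pharm a b c v \<le> merid_val a b c s (arccos z)" by simp
    thus ?case using elim(1) unfolding pharm_merid[OF s2] z_x_r_def by linarith
  qed
  thus ?thesis using norm_merid[OF s2] unfolding sphere_max_def s_def[symmetric] by simp
qed

lemma sphere_max_pharm_eq:
  assumes g: "nondegenerate a b c"
  shows "sphere_max (pharm a b c) = (\<lambda>\<theta>. merid (sgn (base_val \<theta>)) \<theta>) ` merid_maxima a b c"
proof (intro equalityI subsetI)
  fix u assume u: "u \<in> sphere_max (pharm a b c)"
  have y: "u $ 2 = 0" using pharm_max_off_circle[OF u g] by blast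
  have nu: "(u $ 1)\<^sup>2 + (u $ 3)\<^sup>2 = 1" using u y by (simp add: sphere_max_def norm_eq_1_vec3)
  define \<theta> where "\<theta> = arccos (u $ 3)"
  have "(u $ 3)\<^sup>2 \<le> 1" using nu zero_le_power2[of "u$1"] by linarith
  hence z: "\<bar>u $ 3\<bar> \<le> 1" by (simp add: abs_square_le_1)
  have c: "cos \<theta> = u $ 3" unfolding \<theta>_def using z by (rule cos_arccos_abs)
  have th: "\<theta> \<in> {0..pi}" unfolding \<theta>_def using z by (auto intro: arccos_lbound arccos_ubound)
  have sn: "sin \<theta> = \<bar>u $ 1\<bar>"
  proof -
    have "sin \<theta> = sqrt (1 - (u$3)\<^sup>2)" unfolding \<theta>_def using z by (simp add: sin_arccos abs_le_iff)
    also have "1 - (u$3)\<^sup>2 = (u$1)\<^sup>2" using nu by simp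
    finally show ?thesis by simp
  qed
  define s where "s = (if u $ 1 \<ge> 0 then 1 else -1::real)"
  have s: "s = 1 \<or> s = -1" by (simp add: s_def)
  have uc: "u = merid s \<theta>" by (simp add: vec_eq_iff forall_3 y c sn s_def)
  note m = pharm_max_on_circle[OF u[unfolded uc] s g th]
  have "base_val \<theta> * (s * merid_val a b c s \<theta>) > 0" using g th s m(1) unfolding nondegenerate_def by blast
  hence "base_val \<theta> * s > 0" using m(2) by (simp add: zero_less_mult_iff flip: mult.assoc)
  hence "base_val \<theta> \<noteq> 0 \<and> sgn (base_val \<theta>) = s" using s by auto
  thus "u \<in> (\<lambda>\<theta>. merid (sgn (base_val \<theta>)) \<theta>) ` merid_maxima a b c"
    using th m(1) uc by (intro image_eqI[of _ _ \<theta>]) (auto simp: merid_maxima_def)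
qed (use merid_in_sphere_max[OF g] in auto)

text \<open>
  The l + 1 zeros of sin \<theta> Q(cos \<theta>) in [0, pi], end points included, cut
  the interval into l gaps.  In a gap the perturbed slope is positive at the left end and negative at
  the right end, hence vanishes, and every zero is crossed downwards, hence there is only one.
\<close>
lemma card_merid_maxima:
  assumes l: "1 \<le> l" and g: "nondegenerate a b c"
  shows "card (merid_maxima a b c) = l"
proof -
  define Z where "Z = {\<theta>\<in>{0..pi}. base_val \<theta> = 0}"
  define R where "R = {x. poly Q x = 0}"
  have R: "finite R" "card R = l - 1" "\<And>x. x \<in> R \<Longrightarrow> -1 < x \<and> x < 1"
    using dleg_roots[of 1 l] l by (auto simp: R_def)
  have inj: "inj_on cos Z" unfolding Z_def inj_on_def using cos_inj_pi by auto
  have "cos ` Z = insert 1 (insert (-1) R)"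
  proof (intro equalityI subsetI)
    fix x assume "x \<in> cos ` Z"
    then obtain t where t: "t \<in> {0..pi}" "base_val t = 0" "x = cos t" by (auto simp: Z_def)
    show "x \<in> insert 1 (insert (-1) R)"
    proof (cases "sin t = 0")
      case True
      hence "\<bar>cos t\<bar> = 1" using sin_zero_abs_cos_one by blast
      thus ?thesis using t by auto
    qed (use t in \<open>auto simp: base_val_def R_def\<close>)
  next
    fix x assume x: "x \<in> insert 1 (insert (-1) R)"
    hence x1: "\<bar>x\<bar> \<le> 1" using R(3)[of x] by auto
    hence c: "cos (arccos x) = x" by (rule cos_arccos_abs)
    have "sin (arccos x) = sqrt (1 - x\<^sup>2)" using x1 by (simp add: sin_arccos abs_le_iff)
    hence "base_val (arccos x) = 0" using x c by (auto simp: base_val_def R_def)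
    moreover have "arccos x \<in> {0..pi}" using x1 by (auto intro: arccos_lbound arccos_ubound)
    ultimately show "x \<in> cos ` Z" using c unfolding Z_def by (metis (mono_tags, lifting) imageI mem_Collect_eq)
  qed
  moreover have "card (insert 1 (insert (-1) R)) = Suc l"
  proof -
    have "-1 \<notin> R" "1 \<notin> insert (-1) R" using R(3) by fastforce+
    thus ?thesis using R(1,2) l by simp
  qed
  ultimately have cZ: "card Z = Suc l" "finite Z" 
    using card_image[OF inj] finite_image_iff[OF inj] R(1) by auto
  have ends: "0 \<in> Z" "pi \<in> Z" by (auto simp: Z_def base_val_def)
  have mm: "Min Z = 0" "Max Z = pi"
    using ends cZ by (auto intro!: Min_eqI Max_eqI simp: Z_def)
  have "card (merid_maxima a b c) = card Z - 1"
  proof (rule gap_count)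
    show "finite Z" "Z \<noteq> {}" using cZ ends by auto
    show "merid_maxima a b c \<inter> Z = {}" by (auto simp: merid_maxima_def Z_def)
    fix x assume x: "x \<in> merid_maxima a b c"
    hence "x \<in> {0..pi}" "x \<notin> Z" by (auto simp: merid_maxima_def Z_def)
    hence "x \<noteq> 0" "x \<noteq> pi" using ends by auto
    thus "Min Z < x \<and> x < Max Z" using \<open>x \<in> {0..pi}\<close> unfolding mm by auto
  next
    fix p q assume p: "p \<in> Z" and q: "q \<in> Z" and pq: "p < q" and no: "\<And>z. z \<in> Z \<Longrightarrow> \<not> (p < z \<and> z < q)"
    have K: "0 \<le> p" "q \<le> pi" and zero: "base_val p = 0" "base_val q = 0" using p q by (auto simp: Z_def)
    have nz: "base_val t \<noteq> 0" if "p < t" "t < q" for t using no[of t] that K by (auto simp: Z_def)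
    have cont: "continuous_on A base_val" for A
      using base_val_deriv by (meson DERIV_continuous_on has_field_derivative_at_within)
    define s where "s = sgn (base_val ((p + q) / 2))"
    have s: "s = 1 \<or> s = -1" using sgn_cases[OF nz[of "(p+q)/2"]] pq by (simp add: s_def)
    have sg: "sgn (base_val t) = s" if t: "p < t" "t < q" for t
    proof (rule ccontr)
      assume ne: "sgn (base_val t) \<noteq> s"
      have mid: "p < (p+q)/2" "(p+q)/2 < q" using pq by auto
      have "base_val t * base_val ((p+q)/2) < 0"
        using ne nz[OF t] nz[OF mid] unfolding s_def by (auto simp: sgn_if mult_less_0_iff split: if_splits)
      hence "\<exists>x. min t ((p+q)/2) \<le> x \<and> x \<le> max t ((p+q)/2) \<and> base_val x = 0"
      proof (cases "t \<le> (p+q)/2")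
        case True
        have "base_val t \<le> 0 \<and> 0 \<le> base_val ((p+q)/2) \<or> 0 \<le> base_val t \<and> base_val ((p+q)/2) \<le> 0"
          using \<open>base_val t * base_val ((p+q)/2) < 0\<close> by (auto simp: mult_less_0_iff)
        thus ?thesis using IVT'[of base_val t 0 "(p+q)/2"] IVT2'[of base_val "(p+q)/2" 0 t] True cont
          by (auto simp: min_def max_def)
      next
        case False
        have "base_val t \<le> 0 \<and> 0 \<le> base_val ((p+q)/2) \<or> 0 \<le> base_val t \<and> base_val ((p+q)/2) \<le> 0"
          using \<open>base_val t * base_val ((p+q)/2) < 0\<close> by (auto simp: mult_less_0_iff)
        thus ?thesis using IVT'[of base_val "(p+q)/2" 0 t] IVT2'[of base_val t 0 "(p+q)/2"] False cont
          by (auto simp: min_def max_def)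
      qed
      then obtain x where "min t ((p+q)/2) \<le> x" "x \<le> max t ((p+q)/2)" "base_val x = 0" by blast
      thus False using nz[of x] t mid by (auto simp: min_def max_def split: if_splits)
    qed
    have pos: "s * base_val t > 0" if "p < t" "t < q" for t
      using sg[OF that] s nz[OF that] by (auto simp: sgn_if split: if_splits)
    have ds: "((\<lambda>t. s * base_val t) has_real_derivative s * base_d1 x) (at x)" for x
      by (intro DERIV_cmult base_val_deriv)
    have py: "s * base_d1 p \<ge> 0"
    proof (rule ccontr)
      assume "\<not> s * base_d1 p \<ge> 0"
      then obtain d where d: "d > 0" "\<And>h. 0 < h \<Longrightarrow> h < d \<Longrightarrow> s * base_val (p + h) < s * base_val p"
        using has_real_derivative_neg_dec_right[of "\<lambda>t. s * base_val t" "s * base_d1 p" p UNIV] ds by force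
      have "0 < min d (q - p) / 2" "min d (q - p) / 2 < d" "min d (q - p) / 2 < q - p"
        using d(1) pq by (auto simp: min_def)
      thus False using d(2)[of "min d (q - p) / 2"] pos[of "p + min d (q - p) / 2"] zero by auto
    qed
    have qy: "s * base_d1 q \<le> 0"
    proof (rule ccontr)
      assume "\<not> s * base_d1 q \<le> 0"
      then obtain d where d: "d > 0" "\<And>h. 0 < h \<Longrightarrow> h < d \<Longrightarrow> s * base_val (q - h) < s * base_val q"
        using has_real_derivative_pos_inc_left[of "\<lambda>t. s * base_val t" "s * base_d1 q" q UNIV] ds by force
      have "0 < min d (q - p) / 2" "min d (q - p) / 2 < d" "min d (q - p) / 2 < q - p"
        using d(1) pq by (auto simp: min_def)
      thus False using d(2)[of "min d (q - p) / 2"] pos[of "q - min d (q - p) / 2"] zero by auto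
    qed
    have end_sign: "base_d1 t * (s * merid_d1 a b c s t) > 0" if "t = p \<or> t = q" for t
    proof -
      have "t \<in> {0..pi}" "base_val t = 0" using that p q by (auto simp: Z_def)
      thus ?thesis using g s unfolding nondegenerate_def by blast
    qed
    have f1p: "merid_d1 a b c s p > 0"
      using end_sign[of p] py s by (auto simp: zero_less_mult_iff mult_less_0_iff)
    have f1q: "merid_d1 a b c s q < 0"
      using end_sign[of q] qy s by (auto simp: zero_less_mult_iff mult_less_0_iff)
    have "continuous_on {p..q} (merid_d1 a b c s)"
      using merid_d1_deriv by (meson DERIV_continuous_on has_field_derivative_at_within)
    then obtain x where x: "p \<le> x" "x \<le> q" "merid_d1 a b c s x = 0"
      using IVT2'[of "merid_d1 a b c s" q 0 p] f1p f1q pq by auto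
    have "x \<noteq> p" "x \<noteq> q" using x f1p f1q by auto
    hence x': "p < x" "x < q" using x by auto
    have iff: "t \<in> merid_maxima a b c \<longleftrightarrow> merid_d1 a b c s t = 0" if "p < t" "t < q" for t
      unfolding merid_maxima_def using sg[OF that] nz[OF that] that K by auto
    have uniq: "t = x" if t: "p < t" "t < q" "merid_d1 a b c s t = 0" for t
    proof (rule at_most_one_zero[OF merid_d1_deriv _ t x' x(3)])
      fix t assume t: "p < t" "t < q" "merid_d1 a b c s t = 0"
      hence "t \<in> merid_maxima a b c" using iff by blast
      from merid_maxima_facts(2)[OF g this] show "merid_d2 a b c s t < 0" unfolding sg[OF t(1,2)] .
    qed
    show "\<exists>!x. p < x \<and> x < q \<and> x \<in> merid_maxima a b c"
    proof (rule ex1I[of _ x])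
      show "p < x \<and> x < q \<and> x \<in> merid_maxima a b c" using x' x(3) iff[OF x'] by simp
      show "t = x" if "p < t \<and> t < q \<and> t \<in> merid_maxima a b c" for t
        using uniq[of t] iff[of t] that by simp
    qed
  qed
  thus ?thesis using cZ by simp
qed

lemma card_sphere_max_pharm:
  assumes "1 \<le> l" "nondegenerate a b c"
  shows "card (sphere_max (pharm a b c)) = l"
proof -
  have "inj_on (\<lambda>\<theta>. merid (sgn (base_val \<theta>)) \<theta>) (merid_maxima a b c)"
  proof (rule inj_onI)
    fix x y assume xy: "x \<in> merid_maxima a b c" "y \<in> merid_maxima a b c" "merid (sgn (base_val x)) x = merid (sgn (base_val y)) y"
    hence "cos x = cos y" by (metis merid_nth(3))
    moreover have "0 \<le> x" "x \<le> pi" "0 \<le> y" "y \<le> pi" using xy(1,2) unfolding merid_maxima_def by auto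
    ultimately show "x = y" using cos_inj_pi by blast
  qed
  thus ?thesis unfolding sphere_max_pharm_eq[OF assms(2)] by (simp add: card_image card_merid_maxima[OF assms])
qed

end

section \<open>The harmonic as a polynomial, and its local maxima\<close>

text \<open>
  On the sphere sin \<theta> exp(i \<phi>) = x + i y, so the harmonic is the restriction of
  Q(z) Re ((x + i y)^m), a polynomial in the coordinates.
\<close>
definition harm :: "nat \<Rightarrow> nat \<Rightarrow> real ^ 3 \<Rightarrow> real" where
  "harm l m u = poly (dleg l m) (u $ 3) * Re (Complex (u $ 1) (u $ 2) ^ m)"

lemma harmonic_eq:
  assumes u: "norm u = 1" and m: "1 \<le> m"
  shows "harmonic l m u = harm l m u"
proof -
  define w where "w = Complex (u $ 1) (u $ 2)"
  have n: "(u $ 1)\<^sup>2 + (u $ 2)\<^sup>2 + (u $ 3)\<^sup>2 = 1" using u by (simp add: norm_eq_1_vec3)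
  hence "(u $ 3)\<^sup>2 \<le> 1" using zero_le_power2[of "u$1"] zero_le_power2[of "u$2"] by linarith
  hence "\<bar>u $ 3\<bar> \<le> 1" by (simp add: abs_square_le_1)
  hence c: "cos (colatitude u) = u $ 3" unfolding colatitude_def by (rule cos_arccos_abs)
  have w2: "1 - (u $ 3)\<^sup>2 = (cmod w)\<^sup>2" using n by (simp add: w_def cmod_power2)
  have p: "((cmod w)\<^sup>2) powr (real m / 2) = cmod w ^ m"
  proof (cases "w = 0")
    case False
    hence "(cmod w)\<^sup>2 powr (real m / 2) = (cmod w powr 2) powr (real m / 2)" by simp
    also have "\<dots> = cmod w powr real m" unfolding powr_powr by simp
    also have "\<dots> = cmod w ^ m" using False by (simp add: powr_realpow)
    finally show ?thesis .
  qed (use m in auto)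
  have "w ^ m = rcis (cmod w ^ m) (real m * Arg w)"
    by (metis DeMoivre2 rcis_cmod_Arg)
  hence "Re (w ^ m) = cmod w ^ m * cos (real m * Arg w)" by simp
  thus ?thesis unfolding harmonic_def assoc_legendre_def c w2 p harm_def dleg_def longitude_def
      w_def[symmetric] by simp
qed

text \<open>
  A point of space as a complex number w = x + i y and a height z.
\<close>
definition cyl :: "complex \<Rightarrow> real \<Rightarrow> real ^ 3" where "cyl w z = vector [Re w, Im w, z]"

lemma cyl_nth [simp]: "cyl w z $ 1 = Re w" "cyl w z $ 2 = Im w" "cyl w z $ 3 = z"
  by (simp_all add: cyl_def vector_3)

lemma harm_cyl: "harm l m (cyl w z) = poly (dleg l m) z * Re (w ^ m)"
  by (simp add: harm_def)

lemma cyl_eq: "cyl (Complex (u $ 1) (u $ 2)) (u $ 3) = u"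
  by (simp add: vec_eq_iff forall_3)

lemma norm_cyl: "norm (cyl w z) = 1 \<longleftrightarrow> (cmod w)\<^sup>2 + z\<^sup>2 = 1"
  by (simp add: norm_eq_1_vec3 cmod_power2)

lemma isCont_cyl:
  assumes "isCont w x" "isCont z x" shows "isCont (\<lambda>t. cyl (w t) (z t)) x"
  unfolding cyl_def using assms by (intro isCont_vector3 isCont_Re isCont_Im)

lemma isCont_cis_mult [continuous_intros]: "isCont (\<lambda>x. cis (s * x)) t"
  unfolding cis_conv_exp by (intro continuous_intros)

lemma harm_deriv:
  assumes "1 \<le> m"
  shows "(harm l m has_derivative (\<lambda>h. poly (dleg l m) (u$3) * Re (of_nat m * Complex (u$1) (u$2) ^ (m - 1) * Complex (h$1) (h$2))
    + h$3 * poly (pderiv (dleg l m)) (u$3) * Re (Complex (u$1) (u$2) ^ m))) (at u)"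
proof -
  have N: "((\<lambda>u. u$i) has_derivative (\<lambda>h. h$i)) (at u)" for u :: "real^3" and i
    by (rule bounded_linear_imp_has_derivative[OF bounded_linear_vec_nth])
  have P: "((\<lambda>u. poly P (u$3)) has_derivative (\<lambda>h. h$3 * poly (pderiv P) (u$3))) (at u)" for P and u :: "real^3"
    by (rule DERIV_compose_FDERIV[OF poly_DERIV N])
  have Ceq: "(\<lambda>u::real^3. Complex (u$1) (u$2)) = (\<lambda>u. of_real (u$1) + \<i> * of_real (u$2))"
    by (simp add: Complex_eq)
  have W: "((\<lambda>u::real^3. Complex (u$1) (u$2)) has_derivative (\<lambda>h. Complex (h$1) (h$2))) (at u)"
    unfolding Ceq by (auto intro!: derivative_eq_intros N)
  have Wm: "((\<lambda>u::real^3. Complex (u$1) (u$2) ^ m) has_derivative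
     (\<lambda>h. of_nat m * Complex (u$1) (u$2) ^ (m - 1) * Complex (h$1) (h$2))) (at u)"
    by (rule has_derivative_eq_rhs[OF has_derivative_power[OF W]]) (simp add: fun_eq_iff mult_ac)
  have R: "((\<lambda>u::real^3. Re (Complex (u$1) (u$2) ^ m)) has_derivative
     (\<lambda>h. Re (of_nat m * Complex (u$1) (u$2) ^ (m - 1) * Complex (h$1) (h$2)))) (at u)"
    by (rule has_derivative_Re[OF Wm])
  show ?thesis unfolding harm_def
    by (rule has_derivative_eq_rhs[OF has_derivative_mult[OF P R]]) (simp add: fun_eq_iff)
qed

lemma harm_differentiable: "1 \<le> m \<Longrightarrow> harm l m differentiable (at u)"
  using harm_deriv unfolding differentiable_def by blast

text \<open>
  The multiplier rule evaluated in the directions w and i w of the horizontal plane, where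
  the gradient of Re (w^m) pairs to m Re (w^m) and - m Im (w^m), and in the vertical direction.
\<close>
lemma harm_lagrange:
  assumes m: "1 \<le> m" and u: "cyl w z \<in> sphere_max (harm l m)"
  shows "\<exists>k. poly (dleg l m) z * m * Re (w ^ m) = k * (cmod w)\<^sup>2 \<and> poly (dleg l m) z * Im (w ^ m) = 0
      \<and> poly (pderiv (dleg l m)) z * Re (w ^ m) = k * z"
proof -
  have in3: "cyl w z \<bullet> h = Re w * h$1 + Im w * h$2 + z * h$3" for h
    by (simp add: inner_vec_def sum_3)
  obtain k where "(\<lambda>h. poly (dleg l m) z * Re (of_nat m * w ^ (m - 1) * Complex (h$1) (h$2))
    + h$3 * poly (pderiv (dleg l m)) z * Re (w ^ m)) = (\<lambda>h. k * (cyl w z \<bullet> h))"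
    using sphere_max_lagrange[OF harm_deriv[OF m] u] by auto
  hence k: "poly (dleg l m) z * Re (of_nat m * w ^ (m - 1) * \<eta>) + s * poly (pderiv (dleg l m)) z * Re (w ^ m)
     = k * (Re w * Re \<eta> + Im w * Im \<eta> + z * s)" for \<eta> s
    using fun_cong[of _ _ "cyl \<eta> s"] unfolding in3 by fastforce
  have wm: "w ^ (m - 1) * w = w ^ m" using m by (metis power_minus_mult less_eq_Suc_le One_nat_def)
  have e1: "of_nat m * w ^ (m - 1) * w = of_nat m * w ^ m" unfolding mult.assoc wm ..
  have e2: "of_nat m * w ^ (m - 1) * (\<i> * w) = \<i> * (of_nat m * w ^ m)" 
    using e1 by (metis mult.assoc mult.left_commute)
  have 1: "poly (dleg l m) z * m * Re (w ^ m) = k * (cmod w)\<^sup>2"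
    using k[of w 0] unfolding e1 cmod_power2 by (simp add: power2_eq_square)
  have "poly (dleg l m) z * m * Im (w ^ m) = 0"
    using k[of "\<i> * w" 0] unfolding e2 by simp
  hence 2: "poly (dleg l m) z * Im (w ^ m) = 0" using m by auto
  have "poly (pderiv (dleg l m)) z * Re (w ^ m) = k * z" using k[of 0 1] by simp
  thus ?thesis using 1 2 by blast
qed

lemma cis_root: "1 \<le> m \<Longrightarrow> cis (a / m) ^ m = cis a"
  unfolding Complex.DeMoivre by simp

text \<open>
  A local maximum is not a zero of the harmonic.  At a pole the harmonic is positive
  somewhere on every small circle around it.  At a zero of Q off the poles the multiplier rule leaves
  only points with Re (w^m) = 0.  Moving along the meridian by t while turning the longitude by t
  or by -t gives two curves with opposite values, which are nonzero for small t > 0.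
\<close>
lemma harm_max_nonzero:
  assumes m: "1 \<le> m" "m \<le> l" and u: "cyl w z \<in> sphere_max (harm l m)"
  shows "w \<noteq> 0" "poly (dleg l m) z \<noteq> 0"
proof -
  have n: "(cmod w)\<^sup>2 + z\<^sup>2 = 1" using u by (simp add: sphere_max_def norm_cyl del: dist_0_norm) (simp add: norm_cyl)
  show w0: "w \<noteq> 0"
  proof
    assume w: "w = 0"
    hence z: "z\<^sup>2 = 1" using n by simp
    have Qz: "poly (dleg l m) z \<noteq> 0" using dleg_roots(3)[OF m(2), of z] z by (auto simp: power2_eq_1_iff)
    (* The longitude in which the harmonic is positive near the pole; cos (m \<phi>) = -1 is attained
       at \<phi> = pi / m. *)
    obtain \<omega> where \<omega>: "\<omega> ^ m = complex_of_real (sgn (poly (dleg l m) z))" "cmod \<omega> = 1"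
    proof (cases "poly (dleg l m) z > 0")
      case True thus ?thesis by (intro that[of 1]) auto
    next
      case False
      have "cis (pi / m) ^ m = -1" using cis_root[OF m(1), of pi] by simp
      thus ?thesis using False Qz by (intro that[of "cis (pi / m)"]) auto
    qed
    define \<gamma> where "\<gamma> t = cyl (of_real (sin t) * \<omega>) (z * cos t)" for t
    have "isCont \<gamma> 0" unfolding \<gamma>_def by (intro isCont_cyl continuous_intros)
    moreover have "norm (\<gamma> t) = 1" for t
      unfolding \<gamma>_def norm_cyl by (simp add: norm_mult \<omega> power_mult_distrib z)
    moreover have "\<gamma> 0 = cyl w z" by (simp add: \<gamma>_def w)
    ultimately obtain e where e: "e > 0" "\<And>t. \<bar>t\<bar> < e \<Longrightarrow> harm l m (\<gamma> t) \<le> harm l m (cyl w z)"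
      using sphere_max_curve[OF u] by blast
    have Y0: "harm l m (cyl w z) = 0" using w m by (simp add: harm_cyl)
    have "isCont (\<lambda>t. sgn (poly (dleg l m) z) * poly (dleg l m) (z * cos t)) 0" by (intro continuous_intros)
    moreover have "sgn (poly (dleg l m) z) * poly (dleg l m) (z * cos 0) > 0" using Qz by (simp add: sgn_if)
    ultimately obtain e' where e': "e' > 0" 
        "\<And>t. \<bar>t\<bar> < e' \<Longrightarrow> 0 < sgn (poly (dleg l m) z) * poly (dleg l m) (z * cos t)"
      unfolding isCont_def using order_tendstoD(1)[THEN eventually_at[THEN iffD1]] Qz
      by (smt (verit, ccfv_threshold) UNIV_I dist_real_def)
    define t where "t = min 1 (min e e') / 2"
    have t: "0 < t" "t < e" "t < e'" "t < pi" using e(1) e'(1) pi_gt3 by (auto simp: t_def min_def)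
    have "harm l m (\<gamma> t) = sin t ^ m * (sgn (poly (dleg l m) z) * poly (dleg l m) (z * cos t))"
      by (simp add: \<gamma>_def harm_cyl power_mult_distrib \<omega> flip: of_real_power of_real_mult)
    also have "\<dots> > 0" by (rule mult_pos_pos[OF zero_less_power[OF sin_gt_zero]]) (use t e'(2)[of t] in auto)
    finally show False using e(2)[of t] t Y0 by auto
  qed
  show "poly (dleg l m) z \<noteq> 0"
  proof
    assume Q: "poly (dleg l m) z = 0"
    obtain k where k: "poly (dleg l m) z * m * Re (w ^ m) = k * (cmod w)\<^sup>2"
      "poly (pderiv (dleg l m)) z * Re (w ^ m) = k * z" using harm_lagrange[OF m(1) u] by blast
    have "k = 0" using k(1) Q w0 by simp
    hence Re0: "Re (w ^ m) = 0" using k(2) dleg_simple[OF m(2) Q] by simp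
    hence Im0: "Im (w ^ m) \<noteq> 0" using w0 by (metis complex_eqI power_not_zero zero_complex.simps)
    have z1: "-1 < z" "z < 1" using dleg_roots(3)[OF m(2) Q] by auto
    define \<theta> where "\<theta> = arccos z"
    have c: "cos \<theta> = z" using z1 by (simp add: \<theta>_def cos_arccos)
    have "(sin \<theta>)\<^sup>2 = (cmod w)\<^sup>2" using n by (simp add: sin_squared_eq c)
    moreover have "sin \<theta> \<ge> 0" unfolding \<theta>_def using z1 by (intro sin_ge_zero arccos_lbound arccos_ubound) auto
    ultimately have s: "sin \<theta> = cmod w" by (metis norm_ge_zero power2_eq_imp_eq)
    define q where "q t = poly (dleg l m) (cos (\<theta> + t))" for t
    define \<omega> where "\<omega> = w / of_real (cmod w)"
    have \<omega>: "cmod \<omega> = 1" using w0 by (simp add: \<omega>_def norm_divide)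
    have \<omega>m: "\<omega> ^ m = \<i> * of_real (Im (w ^ m) / cmod w ^ m)"
      unfolding \<omega>_def power_divide using Re0 by (simp add: complex_eq_iff Re_divide_of_real Im_divide_of_real flip: of_real_power)
    (* At time t the colatitude has moved by t and the longitude by s t. *)
    define \<gamma> where "\<gamma> s t = cyl (of_real (sin (\<theta> + t)) * \<omega> * cis (s * t)) (cos (\<theta> + t))" for s t
    have Y0: "harm l m (cyl w z) = 0" using Q by (simp add: harm_cyl)
    have ex: "\<exists>e>0. \<forall>t. \<bar>t\<bar> < e \<longrightarrow> harm l m (\<gamma> s t) \<le> 0" for s
    proof -
      have "isCont (\<gamma> s) 0" unfolding \<gamma>_def by (intro isCont_cyl continuous_intros)
      moreover have "norm (\<gamma> s t) = 1" for t
        unfolding \<gamma>_def norm_cyl by (simp add: norm_mult \<omega>)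
      moreover have "\<gamma> s 0 = cyl w z" using w0 by (simp add: \<gamma>_def c s \<omega>_def)
      ultimately show ?thesis using sphere_max_curve[OF u] unfolding Y0 by blast
    qed
    obtain e1 e2 where e: "e1 > 0" "e2 > 0" "\<And>t. \<bar>t\<bar> < e1 \<Longrightarrow> harm l m (\<gamma> 1 t) \<le> 0"
       "\<And>t. \<bar>t\<bar> < e2 \<Longrightarrow> harm l m (\<gamma> (-1) t) \<le> 0" using ex[of 1] ex[of "-1"] by blast
    have Y: "harm l m (\<gamma> s t) = - (q t * sin (\<theta> + t) ^ m * (Im (w ^ m) / cmod w ^ m) * sin (real m * (s * t)))" for s t :: real
      by (simp add: \<gamma>_def harm_cyl power_mult_distrib \<omega>m Complex.DeMoivre q_def flip: of_real_power)
    have dq: "(q has_real_derivative - sin \<theta> * poly (pderiv (dleg l m)) z) (at 0)"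
      unfolding q_def by (rule derivative_eq_intros DERIV_chain2[OF poly_DERIV] refl)+ (simp add: c)
    have "((\<lambda>t. (q t - q 0) / (t - 0)) \<longlongrightarrow> - sin \<theta> * poly (pderiv (dleg l m)) z) (at 0)"
      using dq unfolding has_field_derivative_iff .
    moreover have "- sin \<theta> * poly (pderiv (dleg l m)) z \<noteq> 0" using s w0 dleg_simple[OF m(2) Q] by simp
    ultimately have "\<forall>\<^sub>F t in at 0. (q t - q 0) / (t - 0) \<noteq> 0" by (rule tendsto_imp_eventually_ne)
    then obtain e3 where e3: "e3 > 0" "\<And>t. t \<noteq> 0 \<Longrightarrow> \<bar>t\<bar> < e3 \<Longrightarrow> (q t - q 0) / (t - 0) \<noteq> 0"
      unfolding eventually_at by (auto simp: dist_real_def)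
    have th: "0 < \<theta>" "\<theta> < pi" unfolding \<theta>_def using z1 arccos_lt_bounded[of z] by auto
    define t where "t = min (min e1 e2) (min e3 (min ((pi - \<theta>)) (pi / m))) / 2"
    have "0 < min (min e1 e2) (min e3 (min ((pi - \<theta>)) (pi / m)))" using e e3(1) th m by auto
    moreover have "min (min e1 e2) (min e3 (min ((pi - \<theta>)) (pi / m))) \<le> e1"
       "min (min e1 e2) (min e3 (min ((pi - \<theta>)) (pi / m))) \<le> e2"
       "min (min e1 e2) (min e3 (min ((pi - \<theta>)) (pi / m))) \<le> e3"
       "min (min e1 e2) (min e3 (min ((pi - \<theta>)) (pi / m))) \<le> pi - \<theta>"
       "min (min e1 e2) (min e3 (min ((pi - \<theta>)) (pi / m))) \<le> pi / m"
      unfolding min_le_iff_disj by auto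
    ultimately have t: "0 < t" "t < e1" "t < e2" "t < e3" "t < pi - \<theta>" "t < pi / m"
      unfolding t_def by linarith+
    have q0: "q t \<noteq> 0" using e3(2)[of t] t Q by (auto simp: q_def c)
    have s1: "sin (\<theta> + t) \<noteq> 0" using sin_gt_zero[of "\<theta> + t"] th t by auto
    have "0 < m * t" "m * t < pi" using t m by (auto simp: field_simps)
    hence s2: "sin (m * t) \<noteq> 0" using sin_gt_zero[of "m * t"] by auto
    have "q t * sin (\<theta> + t) ^ m * (Im (w ^ m) / cmod w ^ m) * sin (m * t) = 0"
    proof -
      have "harm l m (\<gamma> 1 t) \<le> 0" "harm l m (\<gamma> (-1) t) \<le> 0" using e(3)[of t] e(4)[of t] t by auto
      moreover have "harm l m (\<gamma> (-1) t) = - harm l m (\<gamma> 1 t)" unfolding Y by simp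
      ultimately have "harm l m (\<gamma> 1 t) = 0" by linarith
      thus ?thesis unfolding Y by simp
    qed
    thus False using q0 s1 s2 Im0 w0 by simp
  qed
qed

text \<open>
  The multiplier rule makes w^m real and z a zero of latitude_poly l m.  If the value
  were negative, turning the longitude would increase it.
\<close>
lemma harm_max_imp:
  assumes m: "1 \<le> m" "m \<le> l" and u: "cyl w z \<in> sphere_max (harm l m)"
  shows "-1 < z" "z < 1" "poly (latitude_poly l m) z = 0"
    "poly (dleg l m) z * Re (w ^ m) > 0" "Im (w ^ m) = 0"
proof -
  note nz = harm_max_nonzero[OF m u]
  have n: "(cmod w)\<^sup>2 + z\<^sup>2 = 1" using u by (simp add: sphere_max_def norm_cyl)
  have "(cmod w)\<^sup>2 > 0" using nz(1) by simp
  hence "z\<^sup>2 < 1" using n by linarith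
  hence "\<bar>z\<bar> < 1" by (simp add: abs_square_less_1)
  thus "-1 < z" "z < 1" by auto
  obtain k where k: "poly (dleg l m) z * m * Re (w ^ m) = k * (cmod w)\<^sup>2"
      "poly (dleg l m) z * Im (w ^ m) = 0"
      "poly (pderiv (dleg l m)) z * Re (w ^ m) = k * z" using harm_lagrange[OF m(1) u] by blast
  show Im0: "Im (w ^ m) = 0" using k(2) nz by simp
  hence Re0: "Re (w ^ m) \<noteq> 0" using nz(1) by (metis complex_eqI power_not_zero zero_complex.simps)
  have "(1 - z\<^sup>2) * (poly (pderiv (dleg l m)) z * Re (w ^ m)) = z * (k * (cmod w)\<^sup>2)"
  proof -
    have "1 - z\<^sup>2 = (cmod w)\<^sup>2" using n by linarith
    thus ?thesis unfolding k(3) by simp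
  qed
  hence "poly (latitude_poly l m) z * Re (w ^ m) = 0"
    unfolding k(1)[symmetric] poly_latitude_poly by (simp add: algebra_simps)
  thus "poly (latitude_poly l m) z = 0" using Re0 by simp
  show "poly (dleg l m) z * Re (w ^ m) > 0"
  proof (rule ccontr)
    assume "\<not> ?thesis"
    moreover have "poly (dleg l m) z * Re (w ^ m) \<noteq> 0" using nz(2) Re0 by simp
    ultimately have neg: "poly (dleg l m) z * Re (w ^ m) < 0" by linarith
    define \<gamma> where "\<gamma> t = cyl (w * cis (1 * t)) z" for t
    have "isCont \<gamma> 0" unfolding \<gamma>_def by (intro isCont_cyl continuous_intros)
    moreover have "norm (\<gamma> t) = 1" for t unfolding \<gamma>_def norm_cyl using n by (simp add: norm_mult)
    moreover have "\<gamma> 0 = cyl w z" by (simp add: \<gamma>_def)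
    ultimately obtain e where e: "e > 0" "\<And>t. \<bar>t\<bar> < e \<Longrightarrow> harm l m (\<gamma> t) \<le> harm l m (cyl w z)"
      using sphere_max_curve[OF u] by blast
    define r where "r = min e (pi / m)"
    define t where "t = r / 2"
    have "0 < r" "r \<le> e" "r \<le> pi / m" using e(1) m by (simp_all add: r_def)
    hence t: "0 < t" "t < e" "t < pi / m" unfolding t_def by linarith+
    have "0 < m * t" "m * t < pi" using t m by (auto simp: field_simps)
    hence "cos (m * t) < 1" using cos_monotone_0_pi[of 0 "m * t"] by simp
    hence "poly (dleg l m) z * Re (w ^ m) * 1 < poly (dleg l m) z * Re (w ^ m) * cos (m * t)"
      using neg by (rule mult_strict_left_mono_neg)
    also have "\<dots> = harm l m (\<gamma> t)"
      by (simp add: \<gamma>_def harm_cyl power_mult_distrib Complex.DeMoivre Im0)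
    finally show False using e(2)[of t] t by (simp add: harm_cyl)
  qed
qed

lemma harm_abs_le: "\<bar>harm l m (cyl w z)\<bar> \<le> \<bar>poly (dleg l m) z\<bar> * cmod w ^ m"
  unfolding harm_cyl abs_mult using abs_Re_le_cmod[of "w ^ m"] by (intro mult_left_mono) (auto simp: norm_power)

text \<open>
  The harmonic is at most |Q(z)| (1 - z^2)^(m/2), with equality at the given point,
  and the square D of this bound has a local maximum at z by latitude_poly_zero.
\<close>
lemma harm_max_if:
  assumes m: "1 \<le> m" "m \<le> l" and z: "-1 < z" "z < 1" "poly (latitude_poly l m) z = 0"
    and w: "(cmod w)\<^sup>2 + z\<^sup>2 = 1" "poly (dleg l m) z * Re (w ^ m) > 0" "Im (w ^ m) = 0"
  shows "cyl w z \<in> sphere_max (harm l m)"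
proof -
  define D where "D x = (1 - x\<^sup>2) ^ m * (poly (dleg l m) x)\<^sup>2" for x
  define D' where "D' x = 2 * (1 - x\<^sup>2) ^ (m - 1) * poly (dleg l m) x * poly (latitude_poly l m) x" for x
  obtain j where j: "m = Suc j" using m by (cases m) auto
  have dD: "(D has_real_derivative D' x) (at x)" for x
    unfolding D_def D'_def poly_latitude_poly unfolding j
    by (rule derivative_eq_intros poly_DERIV refl)+ (simp add: power2_eq_square algebra_simps)
  have "((\<lambda>x. 2 * (1 - x\<^sup>2) ^ (m - 1) * poly (dleg l m) x) has_real_derivative
      poly (pderiv ([:2:] * [:1,0,-1:] ^ (m - 1) * dleg l m)) z) (at z)"
    using poly_DERIV[of "[:2:] * [:1,0,-1:] ^ (m - 1) * dleg l m" z]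
    by (simp add: poly_power power2_eq_square del: mult_pCons_left)
  from DERIV_mult[OF this poly_DERIV[of "latitude_poly l m" z]]
  have dD': "(D' has_real_derivative 2 * (1 - z\<^sup>2) ^ (m - 1) * (poly (dleg l m) z * poly (pderiv (latitude_poly l m)) z)) (at z)"
    unfolding D'_def z(3) by (simp add: algebra_simps)
  have z2: "0 < 1 - z\<^sup>2" using z by (simp add: abs_square_less_1)
  have "2 * (1 - z\<^sup>2) ^ (m - 1) * (poly (dleg l m) z * poly (pderiv (latitude_poly l m)) z) < 0"
    by (rule mult_pos_neg[OF _ latitude_poly_zero(2)[OF m z]]) (use z2 in simp)
  from second_derivative_max[OF dD dD' _ this]
  obtain d where d: "d > 0" "\<And>x. \<bar>x - z\<bar> < d \<Longrightarrow> D x \<le> D z" by (auto simp: D'_def z(3))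
  have val: "harm l m (cyl w z) = \<bar>poly (dleg l m) z\<bar> * cmod w ^ m"
  proof -
    have "cmod w ^ m = \<bar>Re (w ^ m)\<bar>" using w(3) by (metis cmod_eq_Re norm_power)
    thus ?thesis using w(2) unfolding harm_cyl by (simp flip: abs_mult)
  qed
  have sq: "(\<bar>poly (dleg l m) x\<bar> * cmod v ^ m)\<^sup>2 = D x" if "(cmod v)\<^sup>2 + x\<^sup>2 = 1" for v x
  proof -
    have "(cmod v ^ m)\<^sup>2 = ((cmod v)\<^sup>2) ^ m" by (simp flip: power_mult add: mult.commute)
    moreover have "(cmod v)\<^sup>2 = 1 - x\<^sup>2" using that by linarith
    ultimately show ?thesis unfolding D_def power_mult_distrib by (simp add: mult.commute)
  qed
  have "harm l m v \<le> harm l m (cyl w z)" if v: "norm v = 1" "dist v (cyl w z) < d" for v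
  proof -
    define x y where "x = v $ 3" "y = Complex (v $ 1) (v $ 2)"
    have vp: "v = cyl y x" by (simp add: x_y_def cyl_eq)
    have "\<bar>x - z\<bar> < d"
      using component_le_norm_cart[of "v - cyl w z" 3] v(2) by (simp add: x_y_def dist_norm)
    hence Dxz: "D x \<le> D z" using d by blast
    have n: "(cmod y)\<^sup>2 + x\<^sup>2 = 1" using v(1) unfolding vp norm_cyl .
    have "(\<bar>poly (dleg l m) x\<bar> * cmod y ^ m)\<^sup>2 \<le> (\<bar>poly (dleg l m) z\<bar> * cmod w ^ m)\<^sup>2"
      unfolding sq[OF n] sq[OF w(1)] by fact
    hence "\<bar>poly (dleg l m) x\<bar> * cmod y ^ m \<le> \<bar>poly (dleg l m) z\<bar> * cmod w ^ m"
      by (rule power2_le_imp_le) simp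
    thus ?thesis using harm_abs_le[of l m y x] unfolding val vp by linarith
  qed
  moreover have "norm (cyl w z) = 1" unfolding norm_cyl by fact
  ultimately show ?thesis unfolding sphere_max_def mem_Collect_eq eventually_at
    using d(1) by (intro conjI exI[of _ d]) auto
qed

text \<open>
  Each of the l - m + 1 heights of latitude_poly_card carries the m roots w of
  w^m = sgn (Q(z)) (1 - z^2)^(m/2).
\<close>
lemma card_sphere_max_harm:
  assumes m: "1 \<le> m" "m \<le> l"
  shows "card (sphere_max (harm l m)) = m * (l - m + 1)"
proof -
  define C where "C = {z. -1 < z \<and> z < 1 \<and> poly (latitude_poly l m) z = 0}"
  define c where "c z = complex_of_real (sgn (poly (dleg l m) z) * sqrt (1 - z\<^sup>2) ^ m)" for z
  have C: "finite C" "card C = l - m + 1" using latitude_poly_card[OF m] by (simp_all add: C_def)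
  have Cz: "-1 < z" "z < 1" "poly (latitude_poly l m) z = 0" "poly (dleg l m) z \<noteq> 0" "0 < 1 - z\<^sup>2" if "z \<in> C" for z
    using that latitude_poly_zero(1)[OF m, of z] by (auto simp: C_def abs_square_less_1)
  have c0: "c z \<noteq> 0" if "z \<in> C" for z using Cz[OF that] by (simp add: c_def sgn_if)
  have roots: "w ^ m = c z \<longleftrightarrow> (cmod w)\<^sup>2 + z\<^sup>2 = 1 \<and> poly (dleg l m) z * Re (w ^ m) > 0 \<and> Im (w ^ m) = 0"
    if z: "z \<in> C" for w z
  proof
    assume wc: "w ^ m = c z"
    hence "cmod w ^ m = cmod (c z)" by (metis norm_power)
    also have "\<dots> = sqrt (1 - z\<^sup>2) ^ m"
      unfolding c_def norm_of_real abs_mult using Cz[OF z] by (simp add: abs_sgn_eq)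
    finally have "cmod w ^ m = sqrt (1 - z\<^sup>2) ^ m" .
    hence "cmod w = sqrt (1 - z\<^sup>2)" using m Cz(5)[OF z] by (simp add: power_eq_iff_eq_base)
    hence "(cmod w)\<^sup>2 + z\<^sup>2 = 1" using Cz(5)[OF z] by simp
    moreover have "poly (dleg l m) z * Re (w ^ m) > 0"
    proof -
      have "poly (dleg l m) z * Re (w ^ m) = \<bar>poly (dleg l m) z\<bar> * sqrt (1 - z\<^sup>2) ^ m"
        unfolding wc c_def by (simp add: mult_sgn_abs abs_sgn)
      also have "\<dots> > 0" using Cz(4,5)[OF z] by simp
      finally show ?thesis .
    qed
    moreover have "Im (w ^ m) = 0" unfolding wc c_def by simp
    ultimately show "(cmod w)\<^sup>2 + z\<^sup>2 = 1 \<and> poly (dleg l m) z * Re (w ^ m) > 0 \<and> Im (w ^ m) = 0" by blast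
  next
    assume a: "(cmod w)\<^sup>2 + z\<^sup>2 = 1 \<and> poly (dleg l m) z * Re (w ^ m) > 0 \<and> Im (w ^ m) = 0"
    have "cmod w = sqrt ((cmod w)\<^sup>2)" by simp
    also have "(cmod w)\<^sup>2 = 1 - z\<^sup>2" using a by linarith
    finally have "\<bar>Re (w ^ m)\<bar> = sqrt (1 - z\<^sup>2) ^ m"
      using a by (metis norm_power cmod_eq_Re)
    moreover have "sgn (poly (dleg l m) z) = sgn (Re (w ^ m))"
      using a by (auto simp: zero_less_mult_iff)
    ultimately have "Re (w ^ m) = sgn (poly (dleg l m) z) * sqrt (1 - z\<^sup>2) ^ m"
      by (metis sgn_mult_abs)
    thus "w ^ m = c z" using a by (simp add: c_def complex_eq_iff)
  qed
  have iff: "cyl w z \<in> sphere_max (harm l m) \<longleftrightarrow> z \<in> C \<and> w ^ m = c z" for w z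
  proof
    assume p: "cyl w z \<in> sphere_max (harm l m)"
    have "z \<in> C" using harm_max_imp[OF m p] by (simp add: C_def)
    moreover have "(cmod w)\<^sup>2 + z\<^sup>2 = 1" using p by (simp add: sphere_max_def norm_cyl)
    ultimately show "z \<in> C \<and> w ^ m = c z" using roots harm_max_imp[OF m p] by blast
  next
    assume p: "z \<in> C \<and> w ^ m = c z"
    thus "cyl w z \<in> sphere_max (harm l m)"
      using roots[of z w] Cz(1,2,3)[of z] by (intro harm_max_if[OF m]) auto
  qed
  have "bij_betw (\<lambda>(z, w). cyl w z) (SIGMA z:C. {w. w ^ m = c z}) (sphere_max (harm l m))"
  proof (rule bij_betw_imageI)
    show "inj_on (\<lambda>(z, w). cyl w z) (SIGMA z:C. {w. w ^ m = c z})"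
    proof (rule inj_onI, clarify)
      fix z w z' w' assume "cyl w z = cyl w' z'"
      hence "cyl w z $ 1 = cyl w' z' $ 1" "cyl w z $ 2 = cyl w' z' $ 2" "cyl w z $ 3 = cyl w' z' $ 3" by simp_all
      thus "z = z' \<and> w = w'" by (simp add: complex_eq_iff)
    qed
    show "(\<lambda>(z, w). cyl w z) ` (SIGMA z:C. {w. w ^ m = c z}) = sphere_max (harm l m)"
    proof (intro equalityI subsetI)
      fix u assume u: "u \<in> sphere_max (harm l m)"
      define w z where "w = Complex (u $ 1) (u $ 2)" "z = u $ 3"
      have "u = cyl w z" by (simp add: w_z_def cyl_eq)
      thus "u \<in> (\<lambda>(z, w). cyl w z) ` (SIGMA z:C. {w. w ^ m = c z})"
        using u iff[of w z] by (intro image_eqI[of _ _ "(z, w)"]) auto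
    qed (use iff in auto)
  qed
  from bij_betw_same_card[OF this] have "card (sphere_max (harm l m)) = (\<Sum>z\<in>C. card {w. w ^ m = c z})"
    using C(1) c0 m by (subst (asm) card_SigmaI) (auto intro!: finite_nth_roots)
  also have "\<dots> = (\<Sum>z\<in>C. m)" using c0 m by (intro sum.cong refl card_nth_roots) auto
  finally show ?thesis using C by simp
qed

definition rotz :: "real \<Rightarrow> real ^ 3 \<Rightarrow> real ^ 3" where
  "rotz a u = vector [cos a * u $ 1 - sin a * u $ 2, sin a * u $ 1 + cos a * u $ 2, u $ 3]"

lemma rotz_nth [simp]: "rotz a u $ 1 = cos a * u $ 1 - sin a * u $ 2"
  "rotz a u $ 2 = sin a * u $ 1 + cos a * u $ 2" "rotz a u $ 3 = u $ 3"
  by (simp_all add: rotz_def vector_3)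

lemma orthogonal_transformation_vec3I:
  assumes "linear T" "\<And>u. (T u $ 1)\<^sup>2 + (T u $ 2)\<^sup>2 + (T u $ 3)\<^sup>2 = (u $ 1)\<^sup>2 + (u $ 2)\<^sup>2 + (u $ 3)\<^sup>2"
  shows "orthogonal_transformation (T :: real ^ 3 \<Rightarrow> real ^ 3)"
  unfolding orthogonal_transformation using assms
  by (simp add: norm_eq_sqrt_inner inner_vec_def sum_3 power2_eq_square)

lemma orthogonal_rotz: "orthogonal_transformation (rotz a)"
proof (rule orthogonal_transformation_vec3I)
  show "linear (rotz a)" by (rule linearI) (simp_all add: vec_eq_iff forall_3 algebra_simps)
  fix u :: "real ^ 3"
  have "(cos a * u $ 1 - sin a * u $ 2)\<^sup>2 + (sin a * u $ 1 + cos a * u $ 2)\<^sup>2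
      = ((sin a)\<^sup>2 + (cos a)\<^sup>2) * ((u $ 1)\<^sup>2 + (u $ 2)\<^sup>2)"
    by algebra
  thus "(rotz a u $ 1)\<^sup>2 + (rotz a u $ 2)\<^sup>2 + (rotz a u $ 3)\<^sup>2 = (u $ 1)\<^sup>2 + (u $ 2)\<^sup>2 + (u $ 3)\<^sup>2" by simp
qed

text \<open>
  Rotation by pi / m about the axis exchanges maxima and minima.
\<close>
lemma harm_rotz: "1 \<le> m \<Longrightarrow> harm l m (rotz (pi / m) u) = - harm l m u" "1 \<le> m \<Longrightarrow> harm l m (rotz (2 * pi / m) u) = harm l m u"
proof -
  assume m: "1 \<le> m"
  have e: "Complex (rotz a u $ 1) (rotz a u $ 2) = cis a * Complex (u $ 1) (u $ 2)" for a
    by (simp add: complex_eq_iff)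
  have "cis (pi / m) ^ m = -1" "cis (2 * pi / m) ^ m = 1"
    using cis_root[OF m, of pi] cis_root[OF m, of "2 * pi"] by simp_all
  thus "harm l m (rotz (pi / m) u) = - harm l m u" "harm l m (rotz (2 * pi / m) u) = harm l m u"
    unfolding harm_def e power_mult_distrib by simp_all
qed


section \<open>Symmetries of the body and its centroid\<close>

lemma absolutely_integrable_bounded_continuous:
  fixes f :: "'a::euclidean_space \<Rightarrow> 'b::euclidean_space"
  assumes "S \<in> lmeasurable" "continuous_on S f" "\<And>x. x \<in> S \<Longrightarrow> norm (f x) \<le> M"
  shows "f absolutely_integrable_on S"
  using assms
  by (intro measurable_bounded_by_integrable_imp_absolutely_integrable[where g = "\<lambda>_. M"]
      continuous_imp_measurable_on_sets_lebesgue integrable_on_const) auto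

definition rad :: "nat \<Rightarrow> nat \<Rightarrow> real \<Rightarrow> real ^ 3 \<Rightarrow> real" where
  "rad l m \<epsilon> u = 1 + \<epsilon> * harm l m u"

lemma radius_eq: "norm u = 1 \<Longrightarrow> 1 \<le> m \<Longrightarrow> radius l m \<epsilon> u = rad l m \<epsilon> u"
  by (simp add: radius_def rad_def harmonic_eq)

lemma body_eq:
  assumes "1 \<le> m"
  shows "body l m \<epsilon> = {t *\<^sub>R u | t u. norm u = 1 \<and> 0 \<le> t \<and> t \<le> rad l m \<epsilon> u}"
  unfolding body_def using radius_eq[OF _ assms] by (auto; metis)

lemma body_image:
  assumes m: "1 \<le> m" and T: "orthogonal_transformation T" and Y: "\<And>u. harm l m (T u) = harm l m u"
  shows "T ` body l m \<epsilon> = body l m \<epsilon>"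
proof -
  have lin: "linear T" and nT: "\<And>x. norm (T x) = norm x" using T by (auto simp: orthogonal_transformation)
  have surj: "surj T" using T by (rule orthogonal_transformation_surj)
  have r: "rad l m \<epsilon> (T u) = rad l m \<epsilon> u" for u by (simp add: rad_def Y)
  show ?thesis
  proof (intro equalityI subsetI)
    fix x assume "x \<in> T ` body l m \<epsilon>"
    then obtain t u where "x = T (t *\<^sub>R u)" "norm u = 1" "0 \<le> t" "t \<le> rad l m \<epsilon> u"
      unfolding body_eq[OF m] by blast
    hence "x = t *\<^sub>R T u \<and> norm (T u) = 1 \<and> 0 \<le> t \<and> t \<le> rad l m \<epsilon> (T u)"
      using nT r lin by (simp add: linear_cmul)
    thus "x \<in> body l m \<epsilon>" unfolding body_eq[OF m] by blast
  next
    fix x assume "x \<in> body l m \<epsilon>"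
    then obtain t u where x: "x = t *\<^sub>R u" "norm u = 1" "0 \<le> t" "t \<le> rad l m \<epsilon> u"
      unfolding body_eq[OF m] by blast
    obtain v where v: "u = T v" using surj by (metis surjD)
    have "t *\<^sub>R v \<in> body l m \<epsilon>" unfolding body_eq[OF m]
      using x nT r unfolding v by auto
    moreover have "x = T (t *\<^sub>R v)" using x v lin by (simp add: linear_cmul)
    ultimately show "x \<in> T ` body l m \<epsilon>" by blast
  qed
qed

lemma continuous_on_harm: "1 \<le> m \<Longrightarrow> continuous_on S (harm l m)"
  using harm_differentiable differentiable_imp_continuous_on 
  by (meson differentiable_at_withinI differentiable_on_def)

text \<open>
  The body is the image of [0, 1] times the sphere; positivity of the radius makes the
  scaling factor in [0, 1] recoverable.
\<close>
lemma compact_body: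
  assumes m: "1 \<le> m" and pos: "\<And>u. norm u = 1 \<Longrightarrow> rad l m \<epsilon> u > 0"
  shows "compact (body l m \<epsilon>)"
proof -
  have "body l m \<epsilon> = (\<lambda>p. (fst p * rad l m \<epsilon> (snd p)) *\<^sub>R snd p) ` ({0..1} \<times> sphere 0 1)"
  proof (intro equalityI subsetI)
    fix x assume "x \<in> body l m \<epsilon>"
    then obtain t u where x: "x = t *\<^sub>R u" "norm u = 1" "0 \<le> t" "t \<le> rad l m \<epsilon> u"
      unfolding body_eq[OF m] by blast
    have "t / rad l m \<epsilon> u \<in> {0..1}" "t / rad l m \<epsilon> u * rad l m \<epsilon> u = t"
      using x pos[OF x(2)] by auto
    thus "x \<in> (\<lambda>p. (fst p * rad l m \<epsilon> (snd p)) *\<^sub>R snd p) ` ({0..1} \<times> sphere 0 1)"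
      using x by (intro image_eqI[of _ _ "(t / rad l m \<epsilon> u, u)"]) auto
  next
    fix x assume "x \<in> (\<lambda>p. (fst p * rad l m \<epsilon> (snd p)) *\<^sub>R snd p) ` ({0..1} \<times> sphere 0 1)"
    then obtain s u where x: "x = (s * rad l m \<epsilon> u) *\<^sub>R u" "0 \<le> s" "s \<le> 1" "norm u = 1" by auto
    have "0 \<le> s * rad l m \<epsilon> u" "s * rad l m \<epsilon> u \<le> rad l m \<epsilon> u"
      using x pos[OF x(4)] by (auto intro: mult_left_le_one_le)
    thus "x \<in> body l m \<epsilon>" unfolding body_eq[OF m] using x by blast
  qed
  moreover have cpt: "compact ({0..1::real} \<times> sphere (0::real^3) 1)" by (intro compact_Times) auto
  moreover have cts: "continuous_on ({0..1} \<times> sphere 0 1) (\<lambda>p. (fst p * rad l m \<epsilon> (snd p)) *\<^sub>R (snd p :: real ^ 3))"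
    unfolding rad_def
    by (intro continuous_intros continuous_on_compose2[OF continuous_on_harm[OF m, of UNIV]]) auto
  ultimately show ?thesis using compact_continuous_image[OF cts cpt] by simp
qed

lemma compact_id_integrable:
  assumes "compact (S :: (real^3) set)" shows "(\<lambda>x. x) absolutely_integrable_on S"
proof -
  obtain M where "\<And>x. x \<in> S \<Longrightarrow> norm x \<le> M" using compact_imp_bounded[OF assms] unfolding bounded_iff by blast
  thus ?thesis using assms 
    by (intro absolutely_integrable_bounded_continuous[of _ _ M]) (auto intro: lmeasurable_compact)
qed

text \<open>
  An orthogonal symmetry of the harmonic is a symmetry of the body, hence fixes its
  centroid.
\<close>
lemma centroid_fixed:
  assumes m: "1 \<le> m" and T: "orthogonal_transformation T" and Y: "\<And>u. harm l m (T u) = harm l m u"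
    and pos: "\<And>u. norm u = 1 \<Longrightarrow> rad l m \<epsilon> u > 0"
  shows "T (centroid (body l m \<epsilon>)) = centroid (body l m \<epsilon>)"
proof -
  let ?B = "body l m \<epsilon>"
  have lin: "linear T" using T by (simp add: orthogonal_transformation)
  have int: "(\<lambda>x. x) absolutely_integrable_on ?B"
    by (rule compact_id_integrable[OF compact_body[OF m pos]])
  have TB: "T ` ?B = ?B" by (rule body_image[OF m T Y])
  have "integral (T ` ?B) (\<lambda>x. x) = \<bar>det (matrix T)\<bar> *\<^sub>R integral ?B ((\<lambda>x. x) \<circ> T)"
    by (rule integral_change_of_variables_linear[OF lin]) (use int TB in simp)
  hence "integral ?B (\<lambda>x. x) = integral ?B (T \<circ> (\<lambda>x. x))" using T by (simp add: TB o_def)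
  also have "\<dots> = T (integral ?B (\<lambda>x. x))"
    using int lin by (intro integral_linear) (auto simp: absolutely_integrable_on_def linear_conv_bounded_linear)
  finally show ?thesis unfolding centroid_def using lin by (simp add: linear_cmul)
qed

lemma w_poly_power_even: "pcompose (w_poly ^ l) [:0, -1:] = w_poly ^ l"
proof -
  have "pcompose w_poly [:0, -1::real:] = w_poly" by (simp add: pcompose_pCons)
  thus ?thesis by (induction l) (simp_all only: power_0 power_Suc pcompose_1 pcompose_mult)
qed

text \<open>
  Rodrigues' polynomial w^l is even, and every derivative changes the parity.
\<close>
lemma dleg_minus: "poly (dleg l m) (- x) = (-1) ^ (l + m) * poly (dleg l m) x"
proof -
  have "(pderiv ^^ k) (pcompose p [:0, -1:]) = smult ((-1) ^ k) (pcompose ((pderiv ^^ k) p) [:0, -1::real:])" for k p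
  proof (induction k)
    case (Suc k)
    have "pderiv [:0, -1::real:] = [:-1:]" by (simp add: pderiv_pCons)
    thus ?case using Suc by (simp add: pderiv_smult pderiv_pcompose)
  qed simp
  note deriv = this
  define D where "D = (pderiv ^^ (l + m)) (w_poly ^ l)"
  have "D = smult ((-1) ^ (l + m)) (pcompose D [:0, -1:])"
    using deriv[of "l + m" "w_poly ^ l"] unfolding w_poly_power_even D_def .
  hence "poly D x = poly (smult ((-1) ^ (l + m)) (pcompose D [:0, -1:])) x" by (rule arg_cong)
  hence "poly D x = (-1) ^ (l + m) * poly D (- x)" unfolding poly_smult poly_pcompose by simp
  hence "(-1) ^ (l + m) * poly D x = ((-1) ^ (l + m) * (-1) ^ (l + m)) * poly D (- x)"
    unfolding mult.assoc by (rule arg_cong)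
  hence "poly D (- x) = (-1) ^ (l + m) * poly D x" by (simp flip: power_mult_distrib)
  thus ?thesis unfolding dleg_eq D_def[symmetric] by simp
qed

definition flipz :: "real ^ 3 \<Rightarrow> real ^ 3" where "flipz u = vector [u $ 1, u $ 2, - u $ 3]"
definition flipy :: "real ^ 3 \<Rightarrow> real ^ 3" where "flipy u = vector [u $ 1, - u $ 2, u $ 3]"
definition flipx :: "real ^ 3 \<Rightarrow> real ^ 3" where "flipx u = vector [- u $ 1, u $ 2, u $ 3]"
definition swap12 :: "real ^ 3 \<Rightarrow> real ^ 3" where "swap12 u = vector [u $ 2, u $ 1, u $ 3]"
definition rot13 :: "real \<Rightarrow> real ^ 3 \<Rightarrow> real ^ 3" where
  "rot13 t u = vector [cos t * u $ 1 + sin t * u $ 3, u $ 2, cos t * u $ 3 - sin t * u $ 1]"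

lemma flip_nth [simp]:
  "flipz u $ 1 = u $ 1" "flipz u $ 2 = u $ 2" "flipz u $ 3 = - u $ 3"
  "flipy u $ 1 = u $ 1" "flipy u $ 2 = - u $ 2" "flipy u $ 3 = u $ 3"
  "flipx u $ 1 = - u $ 1" "flipx u $ 2 = u $ 2" "flipx u $ 3 = u $ 3"
  "swap12 u $ 1 = u $ 2" "swap12 u $ 2 = u $ 1" "swap12 u $ 3 = u $ 3"
  "rot13 t u $ 1 = cos t * u $ 1 + sin t * u $ 3" "rot13 t u $ 2 = u $ 2" 
  "rot13 t u $ 3 = cos t * u $ 3 - sin t * u $ 1"
  by (simp_all add: flipz_def flipy_def flipx_def swap12_def rot13_def vector_3)

lemma orthogonal_flips:
  "orthogonal_transformation flipz" "orthogonal_transformation flipy"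
  "orthogonal_transformation flipx" "orthogonal_transformation swap12"
  by (auto intro!: orthogonal_transformation_vec3I linearI simp: vec_eq_iff forall_3)

lemma orthogonal_rot13: "orthogonal_transformation (rot13 t)"
proof (rule orthogonal_transformation_vec3I)
  show "linear (rot13 t)" by (rule linearI) (simp_all add: vec_eq_iff forall_3 algebra_simps)
  fix u :: "real ^ 3"
  have "(cos t * u $ 1 + sin t * u $ 3)\<^sup>2 + (cos t * u $ 3 - sin t * u $ 1)\<^sup>2
      = ((sin t)\<^sup>2 + (cos t)\<^sup>2) * ((u $ 1)\<^sup>2 + (u $ 3)\<^sup>2)"
    by algebra
  thus "(rot13 t u $ 1)\<^sup>2 + (rot13 t u $ 2)\<^sup>2 + (rot13 t u $ 3)\<^sup>2 = (u $ 1)\<^sup>2 + (u $ 2)\<^sup>2 + (u $ 3)\<^sup>2" by simp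
qed

text \<open>
  If l + m is even, the harmonic is symmetric in z.  If l + m is odd, reflection in z
  changes its sign, and the rotation by pi / m about the axis changes it back.
\<close>
lemma centroid_z:
  assumes m: "1 \<le> m" and pos: "\<And>u. norm u = 1 \<Longrightarrow> rad l m \<epsilon> u > 0"
  shows "centroid (body l m \<epsilon>) $ 3 = 0"
proof -
  have fz: "harm l m (flipz u) = (-1) ^ (l + m) * harm l m u" for u by (simp add: harm_def dleg_minus)
  show ?thesis
  proof (cases "even (l + m)")
    case True
    have "flipz (centroid (body l m \<epsilon>)) = centroid (body l m \<epsilon>)"
      using True by (intro centroid_fixed[OF m orthogonal_flips(1) _ pos]) (simp_all add: fz)
    from arg_cong[OF this, of "\<lambda>v. v $ 3"] show ?thesis by simp
  next
    case False
    have o: "orthogonal_transformation (flipz \<circ> rotz (pi / m))"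
      by (intro orthogonal_transformation_compose orthogonal_flips orthogonal_rotz)
    have "(flipz \<circ> rotz (pi / m)) (centroid (body l m \<epsilon>)) = centroid (body l m \<epsilon>)"
      using False by (intro centroid_fixed[OF m o _ pos]) (simp_all add: fz harm_rotz(1)[OF m])
    from arg_cong[OF this, of "\<lambda>v. v $ 3"] show ?thesis by simp
  qed
qed

lemma centroid_y:
  assumes pos: "\<And>u. norm u = 1 \<Longrightarrow> rad l 1 \<epsilon> u > 0"
  shows "centroid (body l 1 \<epsilon>) $ 2 = 0"
proof -
  have "flipy (centroid (body l 1 \<epsilon>)) = centroid (body l 1 \<epsilon>)"
    by (intro centroid_fixed[OF _ orthogonal_flips(2) _ pos]) (simp_all add: harm_def)
  from arg_cong[OF this, of "\<lambda>v. v $ 2"] show ?thesis by simp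
qed

text \<open>
  For m \<ge> 2 the rotation by 2 pi / m is a symmetry which is not the identity, and it
  fixes only the axis.
\<close>
lemma centroid_zero:
  assumes m: "2 \<le> m" and pos: "\<And>u. norm u = 1 \<Longrightarrow> rad l m \<epsilon> u > 0"
  shows "centroid (body l m \<epsilon>) = 0"
proof -
  define c where "c = centroid (body l m \<epsilon>)"
  define a where "a = 2 * pi / m"
  have m1: "1 \<le> m" using m by simp
  have f: "rotz a c = c" unfolding c_def a_def
    by (rule centroid_fixed[OF m1 orthogonal_rotz harm_rotz(2)[OF m1] pos])
  have e: "cos a * c $ 1 - sin a * c $ 2 = c $ 1" "sin a * c $ 1 + cos a * c $ 2 = c $ 2"
    using arg_cong[OF f, of "\<lambda>v. v $ 1"] arg_cong[OF f, of "\<lambda>v. v $ 2"] by simp_all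
  have "0 < a" "a \<le> pi" using m by (simp_all add: a_def field_simps)
  hence ca: "cos a < 1" using cos_monotone_0_pi[of 0 a] by simp
  have "cos a * ((c $ 1)\<^sup>2 + (c $ 2)\<^sup>2) = c $ 1 * (cos a * c $ 1 - sin a * c $ 2) + c $ 2 * (sin a * c $ 1 + cos a * c $ 2)"
    by (simp add: power2_eq_square algebra_simps)
  also have "\<dots> = (c $ 1)\<^sup>2 + (c $ 2)\<^sup>2" unfolding e by (simp add: power2_eq_square)
  finally have "(c $ 1)\<^sup>2 + (c $ 2)\<^sup>2 = 0" using ca by simp
  hence "c $ 1 = 0" "c $ 2 = 0" by (simp_all add: sum_power2_eq_zero_iff)
  moreover have "c $ 3 = 0" unfolding c_def by (rule centroid_z[OF m1 pos])
  ultimately show ?thesis unfolding c_def[symmetric] by (simp add: vec_eq_iff forall_3)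
qed


section \<open>Order 1: the centroid to second order\<close>

text \<open>
  The domain of the integrals below.  The centre is removed because functions of the direction
  v / |v| are not continuous there.
\<close>
definition pball :: "(real ^ 3) set" where "pball = cball 0 1 - {0}"

lemma pball_lmeasurable: "pball \<in> lmeasurable"
  unfolding pball_def by (rule fmeasurable.Diff[OF lmeasurable_cball lmeasurable_compact]) simp

lemma pball_iff: "v \<in> pball \<longleftrightarrow> v \<noteq> 0 \<and> norm v \<le> 1" by (auto simp: pball_def)

lemma pball_image: "orthogonal_transformation T \<Longrightarrow> T ` pball = pball"
proof -
  assume T: "orthogonal_transformation T"
  have "T ` cball 0 1 = cball (T 0) 1" using image_orthogonal_transformation_cball[OF T] .
  moreover have "T 0 = 0" using T by (simp add: orthogonal_transformation linear_0)
  ultimately show "T ` pball = pball" unfolding pball_def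
    using orthogonal_transformation_inj[OF T] by (simp add: image_set_diff)
qed

lemma integral_pball_invariant:
  fixes f :: "real ^ 3 \<Rightarrow> real"
  assumes f: "f absolutely_integrable_on pball" and T: "orthogonal_transformation T"
  shows "integral pball (\<lambda>v. f (T v)) = integral pball f" "(\<lambda>v. f (T v)) absolutely_integrable_on pball"
proof -
  define F where "F v = f v *\<^sub>R (axis 1 1 :: real ^ 3)" for v
  have lin: "linear T" using T by (simp add: orthogonal_transformation)
  have F: "F absolutely_integrable_on pball" unfolding F_def
    using f by (rule absolutely_integrable_scaleR_right)
  have FT: "(F \<circ> T) absolutely_integrable_on pball"
    using absolutely_integrable_on_linear_image[OF lin, where f = F and S = pball] F pball_image[OF T] orthogonal_transformation_det[OF T] by auto
  have "integral (T ` pball) F = \<bar>det (matrix T)\<bar> *\<^sub>R integral pball (F \<circ> T)"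
    by (rule integral_change_of_variables_linear[OF lin]) (use FT in simp)
  hence "integral pball F $ 1 = integral pball (F \<circ> T) $ 1" using T by (simp add: pball_image)
  hence "integral pball (\<lambda>v. F v $ 1) = integral pball (\<lambda>v. (F \<circ> T) v $ 1)"
    using integral_component_eq_cart[of F pball 1] integral_component_eq_cart[of "F \<circ> T" pball 1] F FT
    unfolding absolutely_integrable_on_def by (simp only:)
  thus "integral pball (\<lambda>v. f (T v)) = integral pball f" by (simp add: F_def axis_def)
  have "(\<lambda>v. (F \<circ> T) v $ 1) absolutely_integrable_on pball"
    using absolutely_integrable_component[OF FT, of "axis 1 1"] by (simp add: inner_axis)
  thus "(\<lambda>v. f (T v)) absolutely_integrable_on pball" by (simp add: F_def axis_def)
qed

lemma poly_bounded: "\<exists>M\<ge>0. \<forall>z. \<bar>z\<bar> \<le> 1 \<longrightarrow> \<bar>poly p z\<bar> \<le> (M::real)"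
proof -
  have "compact (poly p ` {-1..1})" by (intro compact_continuous_image continuous_intros) auto
  then obtain M where M: "\<forall>y\<in>poly p ` {-1..1}. norm y \<le> M" using compact_imp_bounded bounded_iff by blast
  have "\<bar>poly p z\<bar> \<le> max M 0" if "\<bar>z\<bar> \<le> 1" for z
  proof -
    have "z \<in> {-1..1}" using that by (simp add: abs_le_iff)
    hence "norm (poly p z) \<le> M" using M by blast
    thus ?thesis by simp
  qed
  thus ?thesis by (intro exI[of _ "max M 0"]) auto
qed

lemma unit_component: "v \<in> pball \<Longrightarrow> \<bar>v $ i / norm v\<bar> \<le> 1"
  using component_le_norm_cart[of v i] by (simp add: pball_iff field_simps)

lemma pball_component: "v \<in> pball \<Longrightarrow> \<bar>v $ i\<bar> \<le> 1"
  using component_le_norm_cart[of v i] by (simp add: pball_iff)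

lemma absolutely_integrable_pball:
  fixes f :: "real ^ 3 \<Rightarrow> real"
  assumes "continuous_on pball f" "\<And>v. v \<in> pball \<Longrightarrow> \<bar>f v\<bar> \<le> M"
  shows "f absolutely_integrable_on pball"
  by (rule absolutely_integrable_bounded_continuous[OF pball_lmeasurable assms(1), of M]) (use assms(2) in simp)

lemma continuous_on_direction: "continuous_on pball (\<lambda>v. v $ i / norm v)"
  by (intro continuous_intros) (simp add: pball_iff)

lemma continuous_on_pball_poly [continuous_intros]: "continuous_on pball (\<lambda>v. poly p (v $ i / norm v))"
  by (intro continuous_intros continuous_on_direction) (simp add: pball_iff)

lemma linear_abs_integrable:
  "(\<lambda>v. v $ i * poly h (v $ 3 / norm v)) absolutely_integrable_on pball"
proof -
  obtain M where M: "M \<ge> 0" "\<And>z. \<bar>z\<bar> \<le> 1 \<Longrightarrow> \<bar>poly h z\<bar> \<le> M" using poly_bounded by blast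
  show ?thesis
  proof (rule absolutely_integrable_pball)
    show "continuous_on pball (\<lambda>v. v $ i * poly h (v $ 3 / norm v))" by (intro continuous_intros)
    show "\<bar>v $ i * poly h (v $ 3 / norm v)\<bar> \<le> 1 * M" if "v \<in> pball" for v
      unfolding abs_mult using pball_component[OF that] M(2)[OF unit_component[OF that]] by (intro mult_mono) auto
  qed
qed

lemma quadratic_abs_integrable:
  "(\<lambda>v. (v $ i)\<^sup>2 / norm v * poly h (v $ 3 / norm v)) absolutely_integrable_on pball"
proof -
  obtain M where M: "M \<ge> 0" "\<And>z. \<bar>z\<bar> \<le> 1 \<Longrightarrow> \<bar>poly h z\<bar> \<le> M" using poly_bounded by blast
  show ?thesis
  proof (rule absolutely_integrable_pball)
    show "continuous_on pball (\<lambda>v. (v $ i)\<^sup>2 / norm v * poly h (v $ 3 / norm v))"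
      by (intro continuous_intros) (simp add: pball_iff)
    show "\<bar>(v $ i)\<^sup>2 / norm v * poly h (v $ 3 / norm v)\<bar> \<le> (1 * 1) * M" if "v \<in> pball" for v
    proof -
      have "\<bar>(v $ i)\<^sup>2 / norm v\<bar> = \<bar>v $ i\<bar> * \<bar>v $ i / norm v\<bar>"
        by (simp add: power2_eq_square abs_mult)
      also have "\<dots> \<le> 1 * 1" using unit_component[OF that] pball_component[OF that] by (intro mult_mono) auto
      finally show ?thesis unfolding abs_mult using M(2)[OF unit_component[OF that]] by (intro mult_mono) auto
    qed
  qed
qed

text \<open>
  Let R(t) be the rotation by t in the (x, z)-plane and \<xi> the function x g(z / |v|).  The
  integral of \<xi> o R(t) does not depend on t, so the integral of the derivative at t = 0, which is
  z g - x^2 g' / |v|, is zero.  The derivative is taken along t = 1/(k + 1) by dominated convergence.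
\<close>
lemma rotation_identity:
  "integral pball (\<lambda>v. v $ 3 * poly g (v $ 3 / norm v))
    = integral pball (\<lambda>v. (v $ 1)\<^sup>2 / norm v * poly (pderiv g) (v $ 3 / norm v))"
proof -
  obtain M0 where M0: "M0 \<ge> 0" "\<And>z. \<bar>z\<bar> \<le> 1 \<Longrightarrow> \<bar>poly g z\<bar> \<le> M0" using poly_bounded by blast
  obtain M1 where M1: "M1 \<ge> 0" "\<And>z. \<bar>z\<bar> \<le> 1 \<Longrightarrow> \<bar>poly (pderiv g) z\<bar> \<le> M1" using poly_bounded by blast
  define \<xi> where "\<xi> v = v $ 1 * poly g (v $ 3 / norm v)" for v :: "real ^ 3"
  define L where "L v = v $ 3 * poly g (v $ 3 / norm v) - (v $ 1)\<^sup>2 / norm v * poly (pderiv g) (v $ 3 / norm v)" for v :: "real ^ 3"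
  define d where "d k v = (\<xi> (rot13 (inverse (real (Suc k))) v) - \<xi> v) / inverse (real (Suc k))" for k v
  have nrot: "norm (rot13 t v) = norm v" for t v
    using orthogonal_rot13 by (simp add: orthogonal_transformation_norm)
  have xi_int: "\<xi> absolutely_integrable_on pball" unfolding \<xi>_def by (rule linear_abs_integrable)
  note rot = integral_pball_invariant[OF xi_int orthogonal_rot13]
  have deriv: "((\<lambda>t. \<xi> (rot13 t v)) has_real_derivative rot13 t v $ 3 * poly g (rot13 t v $ 3 / norm v)
      - (rot13 t v $ 1)\<^sup>2 / norm v * poly (pderiv g) (rot13 t v $ 3 / norm v)) (at t)" if "v \<in> pball" for v t
  proof -
    have n: "norm v \<noteq> 0" using that by (simp add: pball_iff)
    have z: "((\<lambda>t. (cos t * v $ 3 - sin t * v $ 1) / norm v) has_real_derivative 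
        - (cos t * v $ 1 + sin t * v $ 3) / norm v) (at t)"
      by (rule derivative_eq_intros refl)+ (use n in \<open>auto simp: field_simps\<close>)
    show ?thesis unfolding \<xi>_def nrot flip_nth
      by (rule derivative_eq_intros DERIV_chain2[OF poly_DERIV z] refl)+
         (use n in \<open>simp add: field_simps power2_eq_square\<close>)
  qed
  have bound: "\<bar>rot13 t v $ 3 * poly g (rot13 t v $ 3 / norm v)
      - (rot13 t v $ 1)\<^sup>2 / norm v * poly (pderiv g) (rot13 t v $ 3 / norm v)\<bar> \<le> M0 + M1" if v: "v \<in> pball" for v t
  proof -
    have r: "rot13 t v \<in> pball" using v nrot[of t v] unfolding pball_iff by (metis norm_eq_zero)
    have n: "0 < norm v" using v by (simp add: pball_iff)
    have z: "\<bar>rot13 t v $ 3 / norm v\<bar> \<le> 1" using unit_component[OF r, of 3] by (simp add: nrot)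
    have x: "\<bar>rot13 t v $ 1 / norm v\<bar> \<le> 1" using unit_component[OF r, of 1] by (simp add: nrot)
    have "\<bar>(rot13 t v $ 1)\<^sup>2 / norm v\<bar> = \<bar>rot13 t v $ 1\<bar> * \<bar>rot13 t v $ 1 / norm v\<bar>"
      by (simp add: power2_eq_square abs_mult)
    also have "\<dots> \<le> 1 * 1" using x pball_component[OF r, of 1] by (intro mult_mono) auto
    finally have "\<bar>(rot13 t v $ 1)\<^sup>2 / norm v * poly (pderiv g) (rot13 t v $ 3 / norm v)\<bar> \<le> 1 * M1"
      unfolding abs_mult using M1(2)[OF z] by (intro mult_mono) auto
    moreover have "\<bar>rot13 t v $ 3 * poly g (rot13 t v $ 3 / norm v)\<bar> \<le> 1 * M0"
      unfolding abs_mult using M0(2)[OF z] pball_component[OF r, of 3] by (intro mult_mono) auto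
    ultimately show ?thesis by linarith
  qed
  have rot0: "rot13 0 v = v" for v by (simp add: vec_eq_iff forall_3)
  have dint: "d k integrable_on pball" "integral pball (d k) = 0" for k
  proof -
    have i: "(\<lambda>v. \<xi> (rot13 (inverse (real (Suc k))) v)) integrable_on pball" "\<xi> integrable_on pball"
      using rot(2) xi_int by (auto simp: absolutely_integrable_on_def)
    show "d k integrable_on pball" unfolding d_def
      using integrable_on_cmult_right[OF integrable_diff[OF i], of "real (Suc k)"] by (simp add: mult.commute)
    show "integral pball (d k) = 0" unfolding d_def
      using integral_diff[OF i] rot(1) by simp
  qed
  have dbound: "norm (d k v) \<le> M0 + M1" if v: "v \<in> pball" for k v
  proof -
    define h where "h = inverse (real (Suc k))"
    have h: "0 < h" by (simp add: h_def)
    obtain t where t: "\<xi> (rot13 h v) - \<xi> (rot13 0 v) = (h - 0) * (rot13 t v $ 3 * poly g (rot13 t v $ 3 / norm v)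
      - (rot13 t v $ 1)\<^sup>2 / norm v * poly (pderiv g) (rot13 t v $ 3 / norm v))"
      using MVT2[OF h, of "\<lambda>t. \<xi> (rot13 t v)" "\<lambda>t. rot13 t v $ 3 * poly g (rot13 t v $ 3 / norm v)
      - (rot13 t v $ 1)\<^sup>2 / norm v * poly (pderiv g) (rot13 t v $ 3 / norm v)"] deriv[OF v] by blast
    hence "d k v = rot13 t v $ 3 * poly g (rot13 t v $ 3 / norm v)
      - (rot13 t v $ 1)\<^sup>2 / norm v * poly (pderiv g) (rot13 t v $ 3 / norm v)"
      using h unfolding d_def h_def[symmetric] rot0 by simp
    thus ?thesis using bound[OF v, of t] by simp
  qed
  have lim: "(\<lambda>k. d k v) \<longlonglongrightarrow> L v" if "v \<in> pball" for v
  proof -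
    have "((\<lambda>t. (\<xi> (rot13 t v) - \<xi> (rot13 0 v)) / (t - 0)) \<longlongrightarrow> L v) (at 0)"
      using deriv[OF that, of 0] unfolding has_field_derivative_iff by (simp add: L_def)
    moreover have "filterlim (\<lambda>k. inverse (real (Suc k))) (at 0) sequentially"
      unfolding filterlim_at using LIMSEQ_inverse_real_of_nat by auto
    ultimately have "(\<lambda>k. (\<xi> (rot13 (inverse (real (Suc k))) v) - \<xi> (rot13 0 v)) / (inverse (real (Suc k)) - 0)) \<longlonglongrightarrow> L v"
      by (rule filterlim_compose)
    thus ?thesis unfolding d_def rot0 by simp
  qed
  have "(\<lambda>v. M0 + M1) integrable_on pball" using pball_lmeasurable by (rule integrable_on_const)
  from dominated_convergence(2)[OF dint(1) this dbound lim]
  have "(\<lambda>k. 0) \<longlonglongrightarrow> integral pball L" unfolding dint(2) .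
  hence "integral pball L = 0" by (simp add: LIMSEQ_const_iff)
  moreover have "integral pball L = integral pball (\<lambda>v. v $ 3 * poly g (v $ 3 / norm v))
     - integral pball (\<lambda>v. (v $ 1)\<^sup>2 / norm v * poly (pderiv g) (v $ 3 / norm v))"
    unfolding L_def using linear_abs_integrable quadratic_abs_integrable
    by (intro integral_diff) (simp_all add: absolutely_integrable_on_def)
  ultimately show ?thesis by simp
qed

lemma norm_sq_vec3: "(norm (v :: real ^ 3))\<^sup>2 = (v $ 1)\<^sup>2 + (v $ 2)\<^sup>2 + (v $ 3)\<^sup>2"
  unfolding power2_norm_eq_inner inner_vec_def sum_3 by (simp add: power2_eq_square)

lemma zonal_integrable: "(\<lambda>v. norm v * poly h (v $ 3 / norm v)) integrable_on pball"
proof -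
  obtain M where M: "M \<ge> 0" "\<And>z. \<bar>z\<bar> \<le> 1 \<Longrightarrow> \<bar>poly h z\<bar> \<le> M" using poly_bounded by blast
  have "(\<lambda>v. norm v * poly h (v $ 3 / norm v)) absolutely_integrable_on pball"
  proof (rule absolutely_integrable_pball)
    show "continuous_on pball (\<lambda>v. norm v * poly h (v $ 3 / norm v))" by (intro continuous_intros)
    show "\<bar>norm v * poly h (v $ 3 / norm v)\<bar> \<le> 1 * M" if "v \<in> pball" for v
      unfolding abs_mult using M(2)[OF unit_component[OF that]] that by (intro mult_mono) (auto simp: pball_iff)
  qed
  thus ?thesis by (simp add: absolutely_integrable_on_def)
qed

text \<open>
  A weak form of Archimedes' theorem that z is uniformly distributed on
  the sphere: the function h(z / |v|), weighted by |v|, has integral 0 if h is the derivative of a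
  polynomial vanishing at -1 and 1.  It is the rotation identity, averaged over the two horizontal
  coordinates.
\<close>
lemma zonal_integral_derivative:
  "integral pball (\<lambda>v. norm v * poly (pderiv ([:1, 0, -1:] * g)) (v $ 3 / norm v)) = 0"
proof -
  define q where "q i v = (v $ i)\<^sup>2 / norm v * poly (pderiv g) (v $ 3 / norm v)" for i and v :: "real ^ 3"
  have qi: "q i absolutely_integrable_on pball" for i unfolding q_def by (rule quadratic_abs_integrable)
  hence qi': "q i integrable_on pball" for i by (simp add: absolutely_integrable_on_def)
  have "norm (swap12 v) = norm v" for v using orthogonal_flips(4) by (simp add: orthogonal_transformation_norm)
  hence "q 1 (swap12 v) = q 2 v" for v by (simp add: q_def)
  hence q12: "integral pball (q 2) = integral pball (q 1)"
    using integral_pball_invariant(1)[OF qi[of 1] orthogonal_flips(4)] by simp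
  define h0 h1 where "h0 v = norm v * poly ([:0, 1:] * g) (v $ 3 / norm v)"
     "h1 v = norm v * poly ([:1, 0, -1:] * pderiv g) (v $ 3 / norm v)" for v :: "real ^ 3"
  have hi: "h0 integrable_on pball" "h1 integrable_on pball" unfolding h0_h1_def by (rule zonal_integrable)+
  have "integral pball h0 = integral pball (\<lambda>v. v $ 3 * poly g (v $ 3 / norm v))"
    by (rule integral_cong) (simp add: h0_h1_def pball_iff)
  also have "\<dots> = integral pball (q 1)" unfolding q_def by (rule rotation_identity)
  finally have 0: "integral pball h0 = integral pball (q 1)" .
  have "integral pball h1 = integral pball (\<lambda>v. q 1 v + q 2 v)"
  proof (rule integral_cong)
    fix v assume "v \<in> pball"
    hence n: "norm v \<noteq> 0" by (simp add: pball_iff)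
    have "norm v * (1 - (v $ 3 / norm v)\<^sup>2) = ((norm v)\<^sup>2 - (v $ 3)\<^sup>2) / norm v"
      using n by (simp add: field_simps power2_eq_square)
    also have "\<dots> = (v $ 1)\<^sup>2 / norm v + (v $ 2)\<^sup>2 / norm v"
      unfolding norm_sq_vec3 by (simp add: add_divide_distrib)
    finally have key: "norm v * (1 - (v $ 3 / norm v)\<^sup>2) = (v $ 1)\<^sup>2 / norm v + (v $ 2)\<^sup>2 / norm v" .
    have "h1 v = norm v * (1 - (v $ 3 / norm v)\<^sup>2) * poly (pderiv g) (v $ 3 / norm v)"
      unfolding h0_h1_def poly_mult by (simp add: power2_eq_square)
    thus "h1 v = q 1 v + q 2 v" unfolding key q_def distrib_right .
  qed
  also have "\<dots> = 2 * integral pball (q 1)" using integral_add[OF qi'[of 1] qi'[of 2]] q12 by simp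
  finally have 1: "integral pball h1 = 2 * integral pball (q 1)" .
  have d: "pderiv [:1, 0, -1:] = [:0, -2::real:]" by (simp add: pderiv_pCons)
  have "norm v * poly (pderiv ([:1, 0, -1:] * g)) (v $ 3 / norm v) = h1 v - 2 * h0 v" for v :: "real ^ 3"
    unfolding pderiv_mult d h0_h1_def by (simp add: algebra_simps)
  hence "integral pball (\<lambda>v. norm v * poly (pderiv ([:1, 0, -1:] * g)) (v $ 3 / norm v)) = integral pball h1 - integral pball (\<lambda>v. 2 * h0 v)"
    using integral_diff[OF hi(2) integrable_on_cmult_left[OF hi(1), of 2]] by simp
  thus ?thesis using 0 1 by simp
qed

text \<open>
  With w = X^2 - 1, let K and L be the derivatives of w^l of orders l - 1 and l - 2, scaled
  as in Rodrigues' formula.  Then X P = (X K - L)' for the Legendre polynomial P, and w divides both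
  K and L.  This is the place where l \<ge> 2 is needed.
\<close>
lemma legendre_first_moment:
  assumes "2 \<le> l"
  shows "\<exists>g. pderiv ([:1, 0, -1:] * g) = [:0, 1:] * legendre_poly l"
proof -
  define c :: real where "c = 1 / (2 ^ l * fact l)"
  define K L where "K = smult c ((pderiv ^^ (l - 1)) (w_poly ^ l))" "L = smult c ((pderiv ^^ (l - 2)) (w_poly ^ l))"
  have S: "l = Suc (l - 1)" "l - 1 = Suc (l - 2)" using assms by auto
  have D: "pderiv ((pderiv ^^ (l - 1)) p) = (pderiv ^^ l) p" "pderiv ((pderiv ^^ (l - 2)) p) = (pderiv ^^ (l - 1)) p"
    for p :: "real poly" using S by (metis funpow.simps(2) o_apply)+
  have K': "pderiv K = legendre_poly l"
    unfolding K_L_def legendre_poly_def c_def pderiv_smult D ..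
  have L': "pderiv L = K" unfolding K_L_def pderiv_smult D ..
  have dvd: "w_poly dvd smult c ((pderiv ^^ k) (w_poly ^ l))" if "k < l" for k
  proof -
    obtain j where "l - k = Suc j" using \<open>k < l\<close> by (metis Suc_diff_Suc)
    hence "w_poly * w_poly ^ j dvd (pderiv ^^ k) (w_poly ^ l)"
      using power_dvd_pderiv_funpow[of w_poly l k] by (simp only: power_Suc)
    thus ?thesis by (metis dvd_mult_left dvd_smult)
  qed
  have "w_poly dvd K" "w_poly dvd L" unfolding K_L_def using assms by (auto intro!: dvd)
  hence "w_poly dvd [:0, 1:] * K - L" by (intro dvd_diff dvd_mult)
  then obtain H where H: "[:0, 1:] * K - L = w_poly * H" by (rule dvdE)
  (* The sign turns w into 1 - X^2. *)
  have "[:1, 0, -1:] * (- H) = w_poly * H" by simp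
  hence "pderiv ([:1, 0, -1:] * (- H)) = pderiv ([:0, 1:] * K - L)" unfolding H by (rule arg_cong)
  also have "\<dots> = [:0, 1:] * legendre_poly l"
  proof -
    have "pderiv [:0, 1:] = [:1::real:]" by (simp add: pderiv_pCons)
    thus ?thesis unfolding pderiv_diff pderiv_mult K' L' by simp
  qed
  finally show ?thesis by blast
qed

text \<open>
  The harmonic of order 1 in the direction of v, extended to be constant along
  rays.
\<close>
definition harm_dir :: "nat \<Rightarrow> real ^ 3 \<Rightarrow> real" where
  "harm_dir l v = poly (dleg l 1) (v $ 3 / norm v) * (v $ 1 / norm v)"

text \<open>
  The harmonic is orthogonal to the linear function x.  Since Q = P', the rotation
  identity replaces x^2 Q by z P, to which Archimedes' theorem applies.
\<close>
lemma harmonic_orthogonal_to_linear: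
  assumes l: "2 \<le> l"
  shows "integral pball (\<lambda>v. harm_dir l v * v $ 1) = 0"
proof -
  have Q: "dleg l 1 = pderiv (legendre_poly l)" by (simp add: dleg_def)
  have "integral pball (\<lambda>v. harm_dir l v * v $ 1) 
      = integral pball (\<lambda>v. (v $ 1)\<^sup>2 / norm v * poly (pderiv (legendre_poly l)) (v $ 3 / norm v))"
    by (rule integral_cong) (simp add: harm_dir_def Q[unfolded One_nat_def] power2_eq_square)
  also have "\<dots> = integral pball (\<lambda>v. v $ 3 * poly (legendre_poly l) (v $ 3 / norm v))"
    by (rule rotation_identity[symmetric])
  also have "\<dots> = integral pball (\<lambda>v. norm v * poly ([:0, 1:] * legendre_poly l) (v $ 3 / norm v))"
    by (rule integral_cong) (simp add: pball_iff)
  also obtain g where "[:0, 1:] * legendre_poly l = pderiv ([:1, 0, -1:] * g)"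
    using legendre_first_moment[OF l] by metis
  hence "integral pball (\<lambda>v. norm v * poly ([:0, 1:] * legendre_poly l) (v $ 3 / norm v)) = 0"
    by (simp only: zonal_integral_derivative)
  finally show ?thesis .
qed

lemma harm_dir_harm: "harm_dir l v = harm l 1 (v /\<^sub>R norm v)"
  by (simp add: harm_dir_def harm_def divide_inverse mult.commute)

lemma harm_dir_scale: "t > 0 \<Longrightarrow> harm_dir l (t *\<^sub>R v) = harm_dir l v"
  by (simp add: harm_dir_def)

lemma harm_dir_bounded: "\<exists>M\<ge>0. \<forall>v\<in>pball. \<bar>harm_dir l v\<bar> \<le> M"
proof -
  obtain M where M: "M \<ge> 0" "\<And>z. \<bar>z\<bar> \<le> 1 \<Longrightarrow> \<bar>poly (dleg l 1) z\<bar> \<le> M" using poly_bounded by blast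
  have "\<bar>harm_dir l v\<bar> \<le> M * 1" if "v \<in> pball" for v
    unfolding harm_dir_def abs_mult using M(1) M(2)[OF unit_component[OF that]] unit_component[OF that, of 1]
    by (intro mult_mono) auto
  thus ?thesis using M(1) by auto
qed

text \<open>
  A function that is constant along rays has derivative 0 in the radial direction.
\<close>
lemma harm_dir_deriv:
  assumes v: "v \<noteq> 0"
  shows "\<exists>D. (harm_dir l has_derivative D) (at v) \<and> D v = 0"
proof -
  have "(\<lambda>v :: real ^ 3. v /\<^sub>R norm v) differentiable (at v)"
    unfolding divide_inverse
    using v by (intro differentiable_scaleR differentiable_inverse differentiable_norm_at differentiable_ident) auto
  hence "(\<lambda>v. harm l 1 (v /\<^sub>R norm v)) differentiable (at v)"
    using differentiable_chain_at[of "\<lambda>v. v /\<^sub>R norm v" v "harm l 1"] harm_differentiable[of 1 l] by (simp add: o_def)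
  then obtain D where D: "(harm_dir l has_derivative D) (at v)"
    unfolding harm_dir_harm[symmetric] differentiable_def by blast
  interpret D: bounded_linear D using D by (rule has_derivative_bounded_linear)
  have "((\<lambda>t. (1 + t) *\<^sub>R v) has_derivative (\<lambda>t. t *\<^sub>R v)) (at 0)"
    by (auto intro!: derivative_eq_intros)
  hence "((harm_dir l \<circ> (\<lambda>t. (1 + t) *\<^sub>R v)) has_derivative (D \<circ> (\<lambda>t. t *\<^sub>R v))) (at 0)"
    using D by (intro diff_chain_at) auto
  hence 1: "((\<lambda>t. harm_dir l ((1 + t) *\<^sub>R v)) has_derivative (\<lambda>t. D (t *\<^sub>R v))) (at 0)" by (simp add: o_def)
  have "((\<lambda>t. harm_dir l v) has_derivative (\<lambda>t::real. D (t *\<^sub>R v))) (at 0)"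
    by (rule has_derivative_transform_within_open[OF 1, of "{-1<..}"]) (auto simp: harm_dir_scale)
  hence "(\<lambda>t::real. D (t *\<^sub>R v)) = (\<lambda>t. 0)"
    using has_derivative_unique has_derivative_const by blast
  from fun_cong[OF this, of 1] have "D v = 0" by simp
  thus ?thesis using D by blast
qed

lemma det_rank_one_update:
  "det (\<chi> i j. (if i = j then r else 0) + v $ i * w $ j :: real ^ 3 ^ 3)
    = r ^ 3 + r\<^sup>2 * (v $ 1 * w $ 1 + v $ 2 * w $ 2 + v $ 3 * w $ 3)"
  by (simp add: det_3 power2_eq_square power3_eq_cube algebra_simps)

lemma body_minus_origin:
  assumes pos: "\<And>u. norm u = 1 \<Longrightarrow> rad l 1 \<epsilon> u > 0"
  shows "(\<lambda>v. (1 + \<epsilon> * harm_dir l v) *\<^sub>R v) ` pball = body l 1 \<epsilon> - {0}"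
    and "inj_on (\<lambda>v. (1 + \<epsilon> * harm_dir l v) *\<^sub>R v) pball"
    and "\<And>v. v \<noteq> 0 \<Longrightarrow> 1 + \<epsilon> * harm_dir l v > 0"
proof -
  have R: "1 + \<epsilon> * harm_dir l v = rad l 1 \<epsilon> (v /\<^sub>R norm v)" for v by (simp add: rad_def harm_dir_harm)
  show R0: "1 + \<epsilon> * harm_dir l v > 0" if "v \<noteq> 0" for v
    unfolding R using that by (intro pos) simp
  show "(\<lambda>v. (1 + \<epsilon> * harm_dir l v) *\<^sub>R v) ` pball = body l 1 \<epsilon> - {0}"
  proof (intro equalityI subsetI)
    fix x assume "x \<in> (\<lambda>v. (1 + \<epsilon> * harm_dir l v) *\<^sub>R v) ` pball"
    then obtain v where v: "x = (1 + \<epsilon> * harm_dir l v) *\<^sub>R v" "v \<noteq> 0" "norm v \<le> 1" by (auto simp: pball_iff)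
    have "x = ((1 + \<epsilon> * harm_dir l v) * norm v) *\<^sub>R (v /\<^sub>R norm v)" using v by simp
    moreover have "norm (v /\<^sub>R norm v) = 1" using v by simp
    moreover have "0 \<le> (1 + \<epsilon> * harm_dir l v) * norm v" using R0[OF v(2)] by simp
    moreover have "(1 + \<epsilon> * harm_dir l v) * norm v \<le> rad l 1 \<epsilon> (v /\<^sub>R norm v)"
      unfolding R using v(3) R0[OF v(2)] unfolding R by (intro mult_left_le) auto
    ultimately have "x \<in> body l 1 \<epsilon>" unfolding body_eq[OF order_refl] by blast
    moreover have "x \<noteq> 0" using v R0[OF v(2)] by simp
    ultimately show "x \<in> body l 1 \<epsilon> - {0}" by blast
  next
    fix x assume x: "x \<in> body l 1 \<epsilon> - {0}"
    then obtain t u where tu: "x = t *\<^sub>R u" "norm u = 1" "0 \<le> t" "t \<le> rad l 1 \<epsilon> u"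
      unfolding body_eq[OF order_refl] by blast
    have t: "t > 0" using tu x by (cases "t = 0") auto
    have r: "rad l 1 \<epsilon> u > 0" using pos tu by blast
    define v where "v = (t / rad l 1 \<epsilon> u) *\<^sub>R u"
    have p: "t / rad l 1 \<epsilon> u > 0" using t r by simp
    have "(s *\<^sub>R u) /\<^sub>R norm (s *\<^sub>R u) = u" if "s > 0" for s using that tu(2) by simp
    from this[OF p] have "v /\<^sub>R norm v = u" unfolding v_def .
    hence "1 + \<epsilon> * harm_dir l v = rad l 1 \<epsilon> u" unfolding R by simp
    hence "x = (1 + \<epsilon> * harm_dir l v) *\<^sub>R v" using r tu by (simp add: v_def)
    moreover have "v \<in> pball"
    proof -
      have "u \<noteq> 0" using tu(2) by auto
      hence "v \<noteq> 0" using t r by (simp add: v_def)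
      moreover have "norm v = t / rad l 1 \<epsilon> u" using t r tu(2) by (simp add: v_def)
      ultimately show ?thesis unfolding pball_iff using tu(4) r by (simp add: divide_le_eq_1)
    qed
    ultimately show "x \<in> (\<lambda>v. (1 + \<epsilon> * harm_dir l v) *\<^sub>R v) ` pball" by blast
  qed
  show "inj_on (\<lambda>v. (1 + \<epsilon> * harm_dir l v) *\<^sub>R v) pball"
  proof (rule inj_onI)
    fix v w assume vw: "v \<in> pball" "w \<in> pball" and eq: "(1 + \<epsilon> * harm_dir l v) *\<^sub>R v = (1 + \<epsilon> * harm_dir l w) *\<^sub>R w"
    define a b where "a = 1 + \<epsilon> * harm_dir l v" "b = 1 + \<epsilon> * harm_dir l w"
    have ab: "a > 0" "b > 0" using R0 vw by (auto simp: a_b_def pball_iff)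
    have "w = (a / b) *\<^sub>R v"
      using arg_cong[OF eq[folded a_b_def], of "\<lambda>x. x /\<^sub>R b"] ab by (simp add: divide_inverse mult.commute)
    hence "harm_dir l w = harm_dir l v" using ab by (simp add: harm_dir_scale)
    hence "a = b" unfolding a_b_def by simp
    thus "v = w" using eq[folded a_b_def] ab(2) by simp
  qed
qed

text \<open>
  The map v \<mapsto> r(v / |v|) v takes the ball to the body.  Its derivative at v is r times the
  identity plus the rank one map h \<mapsto> (Dr h) v, and Dr v = 0, so the Jacobian determinant is
  r^3.
\<close>
lemma integral_body:
  assumes pos: "\<And>u. norm u = 1 \<Longrightarrow> rad l 1 \<epsilon> u > 0"
  shows "(\<lambda>v. (1 + \<epsilon> * harm_dir l v) ^ 4 * v $ 1) integrable_on pball"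
    "integral (body l 1 \<epsilon>) (\<lambda>x. x) $ 1 = integral pball (\<lambda>v. (1 + \<epsilon> * harm_dir l v) ^ 4 * v $ 1)"
proof -
  define R where "R v = 1 + \<epsilon> * harm_dir l v" for v
  have bmo1: "(\<lambda>v. R v *\<^sub>R v) ` pball = body l 1 \<epsilon> - {0}"
    unfolding R_def by (rule body_minus_origin(1)) (rule pos)
  have bmo2: "inj_on (\<lambda>v. R v *\<^sub>R v) pball"
    unfolding R_def by (rule body_minus_origin(2)) (rule pos)
  have R_pos: "R v > 0" if "v \<noteq> 0" for v
    unfolding R_def by (rule body_minus_origin(3)[OF _ that], rule pos)
  have "\<forall>v. \<exists>D. v \<noteq> 0 \<longrightarrow> (harm_dir l has_derivative D) (at v) \<and> D v = 0" using harm_dir_deriv by blast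
  from choice[OF this]
  obtain D where D: "\<And>v. v \<noteq> 0 \<Longrightarrow> (harm_dir l has_derivative D v) (at v) \<and> D v v = 0" by blast
  define \<Phi>' where "\<Phi>' v = (\<lambda>h. R v *\<^sub>R h + (\<epsilon> * D v h) *\<^sub>R v)" for v
  have der: "((\<lambda>v. R v *\<^sub>R v) has_derivative \<Phi>' v) (at v within pball)" if "v \<in> pball" for v
  proof -
    have "v \<noteq> 0" using that by (simp add: pball_iff)
    hence "(harm_dir l has_derivative D v) (at v)" using D by blast
    hence "(R has_derivative (\<lambda>h. \<epsilon> * D v h)) (at v)"
      unfolding R_def by (auto intro!: derivative_eq_intros)
    hence "((\<lambda>v. R v *\<^sub>R v) has_derivative (\<lambda>h. R v *\<^sub>R h + (\<epsilon> * D v h) *\<^sub>R v)) (at v)"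
      by (auto intro!: derivative_eq_intros)
    thus ?thesis unfolding \<Phi>'_def by (rule has_derivative_at_withinI)
  qed
  have det: "\<bar>det (matrix (\<Phi>' v))\<bar> = R v ^ 3" if "v \<in> pball" for v
  proof -
    have v: "v \<noteq> 0" using that by (simp add: pball_iff)
    interpret D: bounded_linear "D v" using D[OF v] has_derivative_bounded_linear by blast
    define w :: "real ^ 3" where "w = (\<chi> j. \<epsilon> * D v (axis j 1))"
    have "matrix (\<Phi>' v) = (\<chi> i j. (if i = j then R v else 0) + v $ i * w $ j)"
      by (simp add: vec_eq_iff matrix_def \<Phi>'_def w_def axis_def mult_ac)
    hence "det (matrix (\<Phi>' v)) = R v ^ 3 + (R v)\<^sup>2 * (v $ 1 * w $ 1 + v $ 2 * w $ 2 + v $ 3 * w $ 3)"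
      by (simp only: det_rank_one_update)
    also have "v $ 1 * w $ 1 + v $ 2 * w $ 2 + v $ 3 * w $ 3 = \<epsilon> * D v v"
    proof -
      have "v = v $ 1 *\<^sub>R axis 1 1 + v $ 2 *\<^sub>R axis 2 1 + v $ 3 *\<^sub>R axis 3 1"
        by (simp add: vec_eq_iff forall_3 axis_def)
      hence "D v v = D v (v $ 1 *\<^sub>R axis 1 1 + v $ 2 *\<^sub>R axis 2 1 + v $ 3 *\<^sub>R axis 3 1)" by (rule arg_cong)
      also have "\<dots> = v $ 1 * D v (axis 1 1) + v $ 2 * D v (axis 2 1) + v $ 3 * D v (axis 3 1)"
        by (simp add: D.add D.scaleR)
      finally show ?thesis by (simp add: w_def algebra_simps)
    qed
    finally have "det (matrix (\<Phi>' v)) = R v ^ 3" using D[OF v] by simp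
    thus ?thesis using R_pos[OF v] by simp
  qed
  have cb: "compact (body l 1 \<epsilon>)" by (rule compact_body[OF order_refl pos])
  have negl: "negligible (body l 1 \<epsilon> - (body l 1 \<epsilon> - {0}))"
    by (rule negligible_subset[of "{0}"]) auto
  have "(\<lambda>x. x) absolutely_integrable_on (body l 1 \<epsilon> - {0})"
  proof -
    have "body l 1 \<epsilon> - {0} \<in> sets lebesgue"
      using lmeasurable_compact[OF cb] by auto
    thus ?thesis using set_integrable_subset[OF compact_id_integrable[OF cb]] by blast
  qed
  hence int: "(\<lambda>x. x) absolutely_integrable_on ((\<lambda>v. R v *\<^sub>R v) ` pball)" unfolding bmo1 .
  have pball_sets: "pball \<in> sets lebesgue" using pball_lmeasurable by auto
  have main: "(\<lambda>v. \<bar>det (matrix (\<Phi>' v))\<bar> *\<^sub>R (R v *\<^sub>R v)) absolutely_integrable_on pball"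
     "integral pball (\<lambda>v. \<bar>det (matrix (\<Phi>' v))\<bar> *\<^sub>R (R v *\<^sub>R v)) = integral ((\<lambda>v. R v *\<^sub>R v) ` pball) (\<lambda>x. x)"
    using has_absolute_integral_change_of_variables[OF pball_sets der bmo2, of "\<lambda>x. x" "integral ((\<lambda>v. R v *\<^sub>R v) ` pball) (\<lambda>x. x)"] int
    by auto
  have i: "(\<lambda>v. \<bar>det (matrix (\<Phi>' v))\<bar> *\<^sub>R (R v *\<^sub>R v)) integrable_on pball"
    using main(1) by (simp add: absolutely_integrable_on_def)
  have comp: "(\<bar>det (matrix (\<Phi>' v))\<bar> *\<^sub>R (R v *\<^sub>R v)) $ 1 = R v ^ 4 * v $ 1" if "v \<in> pball" for v
    using det[OF that] by (simp add: power3_eq_cube power4_eq_xxxx)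
  have "(\<lambda>v. (\<bar>det (matrix (\<Phi>' v))\<bar> *\<^sub>R (R v *\<^sub>R v)) $ 1) integrable_on pball"
    using integrable_linear[OF i bounded_linear_vec_nth[of 1]] by (simp add: o_def)
  thus "(\<lambda>v. (1 + \<epsilon> * harm_dir l v) ^ 4 * v $ 1) integrable_on pball"
    unfolding R_def[symmetric] by (rule integrable_eq) (use comp in simp)
  have "integral (body l 1 \<epsilon>) (\<lambda>x. x) = integral (body l 1 \<epsilon> - {0}) (\<lambda>x. x)"
    by (rule integral_subset_negligible[symmetric, OF _ negl]) auto
  also have "\<dots> = integral pball (\<lambda>v. \<bar>det (matrix (\<Phi>' v))\<bar> *\<^sub>R (R v *\<^sub>R v))"
    using main(2) bmo1 by simp
  finally have "integral (body l 1 \<epsilon>) (\<lambda>x. x) $ 1 = integral pball (\<lambda>v. (\<bar>det (matrix (\<Phi>' v))\<bar> *\<^sub>R (R v *\<^sub>R v)) $ 1)"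
    by (simp only: integral_component_eq_cart[OF i])
  also have "\<dots> = integral pball (\<lambda>v. R v ^ 4 * v $ 1)" by (rule integral_cong) (rule comp)
  finally show "integral (body l 1 \<epsilon>) (\<lambda>x. x) $ 1 = integral pball (\<lambda>v. (1 + \<epsilon> * harm_dir l v) ^ 4 * v $ 1)"
    unfolding R_def .
qed

text \<open>
  Expand r^4 x in powers of \<epsilon>: the term of order 0 is odd in x, and the term of
  order 1 vanishes because the harmonic is orthogonal to x.  The volume is bounded below by that of
  the ball of radius 1/2.
\<close>
lemma centroid_second_order:
  assumes l: "2 \<le> l"
  shows "\<exists>C. \<forall>\<epsilon>. 0 < \<epsilon> \<and> \<epsilon> \<le> 1 \<and> (\<forall>u. norm u = 1 \<longrightarrow> rad l 1 \<epsilon> u \<ge> 1 / 2) \<longrightarrow>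
     \<bar>centroid (body l 1 \<epsilon>) $ 1\<bar> \<le> C * \<epsilon>\<^sup>2"
proof -
  obtain M where M: "M \<ge> 0" "\<And>v. v \<in> pball \<Longrightarrow> \<bar>harm_dir l v\<bar> \<le> M" using harm_dir_bounded by blast
  define N where "N = 6 * M ^ 2 + 4 * M ^ 3 + M ^ 4"
  define \<mu> where "\<mu> = measure lebesgue (cball (0 :: real ^ 3) (1 / 2))"
  have mu: "\<mu> > 0" unfolding \<mu>_def using content_cball_pos[of "1/2" "0 :: real ^ 3"] by simp
  have v1: "(\<lambda>v. v $ 1) absolutely_integrable_on pball"
    by (rule absolutely_integrable_pball[of _ 1]) (auto intro!: continuous_intros pball_component)
  have Kv: "(\<lambda>v. harm_dir l v * v $ 1) absolutely_integrable_on pball"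
  proof (rule absolutely_integrable_pball)
    show "continuous_on pball (\<lambda>v. harm_dir l v * v $ 1)" unfolding harm_dir_def
      by (intro continuous_intros) (auto simp: pball_iff)
    show "\<bar>harm_dir l v * v $ 1\<bar> \<le> M * 1" if "v \<in> pball" for v
      unfolding abs_mult using M that pball_component[OF that] by (intro mult_mono) auto
  qed
  have int0: "integral pball (\<lambda>v. v $ 1) = 0"
  proof -
    have "integral pball (\<lambda>v. flipx v $ 1) = integral pball (\<lambda>v. v $ 1)"
      by (rule integral_pball_invariant(1)[OF v1 orthogonal_flips(3)])
    thus ?thesis by simp
  qed
  have "\<bar>centroid (body l 1 \<epsilon>) $ 1\<bar> \<le> (N * measure lebesgue pball / \<mu>) * \<epsilon>\<^sup>2"
    if e: "0 < \<epsilon>" "\<epsilon> \<le> 1" and half: "\<And>u. norm u = 1 \<Longrightarrow> rad l 1 \<epsilon> u \<ge> 1 / 2" for \<epsilon>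
  proof -
    have pos: "rad l 1 \<epsilon> u > 0" if "norm u = 1" for u using half[OF that] by simp
    have ib1: "(\<lambda>v. (1 + \<epsilon> * harm_dir l v) ^ 4 * v $ 1) integrable_on pball"
      by (rule integral_body(1)) (rule pos)
    have ib2: "integral (body l 1 \<epsilon>) (\<lambda>x. x) $ 1 = integral pball (\<lambda>v. (1 + \<epsilon> * harm_dir l v) ^ 4 * v $ 1)"
      by (rule integral_body(2)) (rule pos)
    define P where "P v = 6 * (harm_dir l v)\<^sup>2 + 4 * \<epsilon> * (harm_dir l v) ^ 3 + \<epsilon>\<^sup>2 * (harm_dir l v) ^ 4" for v
    have expand: "(1 + \<epsilon> * harm_dir l v) ^ 4 * v $ 1 = v $ 1 + 4 * \<epsilon> * (harm_dir l v * v $ 1) + \<epsilon>\<^sup>2 * P v * v $ 1" for v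
      unfolding P_def by algebra
    have i1: "(\<lambda>v. v $ 1) integrable_on pball" using v1 by (simp add: absolutely_integrable_on_def)
    have i2: "(\<lambda>v. 4 * \<epsilon> * (harm_dir l v * v $ 1)) integrable_on pball"
    proof -
      have "(\<lambda>v. (4 * \<epsilon>) *\<^sub>R (harm_dir l v * v $ 1)) integrable_on pball"
        by (rule integrable_cmul) (use Kv in \<open>simp add: absolutely_integrable_on_def\<close>)
      thus ?thesis by simp
    qed
    have i12: "(\<lambda>v. v $ 1 + 4 * \<epsilon> * (harm_dir l v * v $ 1)) integrable_on pball" using i1 i2 by (rule integrable_add)
    have i3: "(\<lambda>v. \<epsilon>\<^sup>2 * P v * v $ 1) integrable_on pball"
      using integrable_diff[OF ib1 i12] by (simp add: expand)
    have "integral pball (\<lambda>v. (1 + \<epsilon> * harm_dir l v) ^ 4 * v $ 1) =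
       integral pball (\<lambda>v. v $ 1) + 4 * \<epsilon> * integral pball (\<lambda>v. harm_dir l v * v $ 1) + integral pball (\<lambda>v. \<epsilon>\<^sup>2 * P v * v $ 1)"
      unfolding expand integral_add[OF i12 i3] integral_add[OF i1 i2] by simp
    hence eq: "integral pball (\<lambda>v. (1 + \<epsilon> * harm_dir l v) ^ 4 * v $ 1) = integral pball (\<lambda>v. \<epsilon>\<^sup>2 * P v * v $ 1)"
      using int0 harmonic_orthogonal_to_linear[OF l] by simp
    have "norm (integral pball (\<lambda>v. \<epsilon>\<^sup>2 * P v * v $ 1)) \<le> integral pball (\<lambda>v. \<epsilon>\<^sup>2 * N)"
    proof (rule integral_norm_bound_integral[OF i3])
      show "(\<lambda>v. \<epsilon>\<^sup>2 * N) integrable_on pball" using pball_lmeasurable by (rule integrable_on_const)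
      fix v assume v: "v \<in> pball"
      define k where "k = \<bar>harm_dir l v\<bar>"
      have k: "0 \<le> k" "k \<le> M" using M(2)[OF v] by (auto simp: k_def)
      have "\<bar>P v\<bar> \<le> 6 * k ^ 2 + 4 * \<epsilon> * k ^ 3 + \<epsilon>\<^sup>2 * k ^ 4"
      proof -
        have "\<bar>P v\<bar> \<le> \<bar>6 * (harm_dir l v)\<^sup>2\<bar> + \<bar>4 * \<epsilon> * (harm_dir l v) ^ 3\<bar> + \<bar>\<epsilon>\<^sup>2 * (harm_dir l v) ^ 4\<bar>"
          unfolding P_def by linarith
        also have "\<dots> = 6 * k ^ 2 + 4 * \<epsilon> * k ^ 3 + \<epsilon>\<^sup>2 * k ^ 4"
          using e unfolding k_def abs_mult power_abs by simp
        finally show ?thesis .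
      qed
      also have "\<dots> \<le> 6 * M ^ 2 + 4 * 1 * M ^ 3 + 1 * M ^ 4"
        using k e M(1) by (intro add_mono mult_mono power_mono power_le_one) auto
      finally have "\<bar>P v\<bar> \<le> N" by (simp add: N_def)
      hence "\<epsilon>\<^sup>2 * (\<bar>P v\<bar> * \<bar>v $ 1\<bar>) \<le> \<epsilon>\<^sup>2 * (N * 1)"
        using pball_component[OF v, of 1] by (intro mult_left_mono mult_mono) auto
      thus "norm (\<epsilon>\<^sup>2 * P v * v $ 1) \<le> \<epsilon>\<^sup>2 * N" by (simp add: abs_mult mult.assoc)
    qed
    also have "integral pball (\<lambda>v. \<epsilon>\<^sup>2 * N) = \<epsilon>\<^sup>2 * N * measure lebesgue pball"
      using pball_lmeasurable lmeasure_integral[OF pball_lmeasurable] integral_mult_right[of pball "\<epsilon>\<^sup>2 * N" "\<lambda>_. 1"] by simp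
    finally have I: "\<bar>integral (body l 1 \<epsilon>) (\<lambda>x. x) $ 1\<bar> \<le> \<epsilon>\<^sup>2 * N * measure lebesgue pball"
      unfolding ib2 eq by simp
    have cb: "compact (body l 1 \<epsilon>)" by (rule compact_body[OF order_refl pos])
    have "cball 0 (1 / 2) \<subseteq> body l 1 \<epsilon>"
    proof
      fix x :: "real ^ 3" assume "x \<in> cball 0 (1 / 2)"
      hence x: "norm x \<le> 1 / 2" by simp
      show "x \<in> body l 1 \<epsilon>"
      proof (cases "x = 0")
        case True
        have "norm (axis 1 1 :: real ^ 3) = 1" by simp
        thus ?thesis unfolding body_eq[OF order_refl] using True pos[of "axis 1 1"]
          by (auto intro!: exI[of _ "0::real"] exI[of _ "axis 1 1 :: real ^ 3"])
      next
        case False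
        have "x = norm x *\<^sub>R (x /\<^sub>R norm x)" "norm (x /\<^sub>R norm x) = 1" using False by auto
        moreover have "norm x \<le> rad l 1 \<epsilon> (x /\<^sub>R norm x)" using half[OF calculation(2)] x by linarith
        ultimately show ?thesis unfolding body_eq[OF order_refl] using norm_ge_zero by blast
      qed
    qed
    hence mm: "\<mu> \<le> measure lebesgue (body l 1 \<epsilon>)" unfolding \<mu>_def
      using lmeasurable_compact[OF cb] by (intro measure_mono_fmeasurable) auto
    have "\<bar>centroid (body l 1 \<epsilon>) $ 1\<bar> = \<bar>integral (body l 1 \<epsilon>) (\<lambda>x. x) $ 1\<bar> / measure lebesgue (body l 1 \<epsilon>)"
      unfolding centroid_def using mu mm by (simp add: abs_mult)
    also have "\<dots> \<le> (\<epsilon>\<^sup>2 * N * measure lebesgue pball) / \<mu>"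
      using I mm mu by (intro frac_le) auto
    finally show ?thesis by (simp add: mult_ac)
  qed
  thus ?thesis by blast
qed

section \<open>Order 1: convexity for small amplitude\<close>

text \<open>
  Two applications of the mean value theorem.
\<close>
lemma poly_taylor2:
  assumes M: "\<And>x. \<bar>x\<bar> \<le> 1 \<Longrightarrow> \<bar>poly (pderiv (pderiv p)) x\<bar> \<le> M" and z: "\<bar>z\<bar> \<le> 1" "\<bar>z'\<bar> \<le> 1"
  shows "\<bar>poly p z' - poly p z - poly (pderiv p) z * (z' - z)\<bar> \<le> M * (z' - z :: real)\<^sup>2"
proof -
  have mvt: "\<exists>x. \<bar>x\<bar> \<le> 1 \<and> \<bar>x - a\<bar> \<le> \<bar>b - a\<bar> \<and> poly q b - poly q a = (b - a) * poly (pderiv q) x"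
    if "\<bar>a\<bar> \<le> 1" "\<bar>b\<bar> \<le> 1" for a b and q :: "real poly"
  proof -
    consider "a = b" | "a < b" | "b < a" by linarith
    thus ?thesis
    proof cases
      case 1 thus ?thesis using that by (intro exI[of _ a]) simp
    next
      case 2
      then obtain x where "a < x" "x < b" "poly q b - poly q a = (b - a) * poly (pderiv q) x"
        using poly_MVT by blast
      thus ?thesis using that by (intro exI[of _ x]) auto
    next
      case 3
      then obtain x where "b < x" "x < a" "poly q a - poly q b = (a - b) * poly (pderiv q) x"
        using poly_MVT by blast
      thus ?thesis using that by (intro exI[of _ x]) (auto simp: algebra_simps)
    qed
  qed
  obtain x where x: "\<bar>x\<bar> \<le> 1" "\<bar>x - z\<bar> \<le> \<bar>z' - z\<bar>" "poly p z' - poly p z = (z' - z) * poly (pderiv p) x"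
    using mvt[OF z] by blast
  obtain y where y: "\<bar>y\<bar> \<le> 1" "poly (pderiv p) x - poly (pderiv p) z = (x - z) * poly (pderiv (pderiv p)) y"
    using mvt[OF z(1) x(1)] by blast
  have "poly p z' - poly p z - poly (pderiv p) z * (z' - z) = (z' - z) * (poly (pderiv p) x - poly (pderiv p) z)"
    unfolding x(3) by (simp add: algebra_simps)
  also have "\<dots> = (z' - z) * (x - z) * poly (pderiv (pderiv p)) y" unfolding y(2) by simp
  finally have "\<bar>poly p z' - poly p z - poly (pderiv p) z * (z' - z)\<bar> = \<bar>z' - z\<bar> * \<bar>x - z\<bar> * \<bar>poly (pderiv (pderiv p)) y\<bar>"
    by (simp add: abs_mult)
  also have "\<dots> \<le> \<bar>z' - z\<bar> * \<bar>z' - z\<bar> * M"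
    using x(2) M[OF y(1)] by (intro mult_mono) auto
  finally show ?thesis by (simp add: power2_eq_square mult.commute)
qed

lemma unit_abs_component: "norm (u :: real ^ 3) = 1 \<Longrightarrow> \<bar>u $ i\<bar> \<le> 1"
  using component_le_norm_cart[of u i] by simp

text \<open>
  The vector g is the gradient of the polynomial x Q(z).
\<close>
lemma harm_1_taylor:
  "\<exists>C>0. \<exists>g. \<forall>u v. norm u = 1 \<and> norm v = 1 \<longrightarrow> norm (g u) \<le> C \<and> \<bar>harm l 1 u\<bar> \<le> C \<and>
     \<bar>harm l 1 v - harm l 1 u - g u \<bullet> (v - u)\<bar> \<le> C * (norm (v - u))\<^sup>2"
proof -
  define q where "q = dleg l 1"
  obtain M0 where M0: "M0 \<ge> 0" "\<And>z. \<bar>z\<bar> \<le> 1 \<Longrightarrow> \<bar>poly q z\<bar> \<le> M0" using poly_bounded by blast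
  obtain M1 where M1: "M1 \<ge> 0" "\<And>z. \<bar>z\<bar> \<le> 1 \<Longrightarrow> \<bar>poly (pderiv q) z\<bar> \<le> M1" using poly_bounded by blast
  obtain M2 where M2: "M2 \<ge> 0" "\<And>z. \<bar>z\<bar> \<le> 1 \<Longrightarrow> \<bar>poly (pderiv (pderiv q)) z\<bar> \<le> M2" using poly_bounded by blast
  define C where "C = M0 + M1 + M2 + 1"
  define g where "g u = (vector [poly q (u $ 3), 0, u $ 1 * poly (pderiv q) (u $ 3)] :: real ^ 3)" for u :: "real ^ 3"
  have g_nth: "g u $ 1 = poly q (u $ 3)" "g u $ 2 = 0" "g u $ 3 = u $ 1 * poly (pderiv q) (u $ 3)" for u
    by (simp_all add: g_def vector_3)
  have Y: "harm l 1 u = u $ 1 * poly q (u $ 3)" for u by (simp add: harm_def q_def)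
  have "norm (g u) \<le> C \<and> \<bar>harm l 1 u\<bar> \<le> C \<and> \<bar>harm l 1 v - harm l 1 u - g u \<bullet> (v - u)\<bar> \<le> C * (norm (v - u))\<^sup>2"
    if u: "norm u = 1" and v: "norm v = 1" for u v
  proof (intro conjI)
    have xq: "\<bar>u $ 1 * p\<bar> \<le> \<bar>p\<bar>" for p
      unfolding abs_mult using unit_abs_component[OF u, of 1] by (intro mult_left_le_one_le) auto
    show "\<bar>harm l 1 u\<bar> \<le> C" unfolding Y C_def
      using xq[of "poly q (u $ 3)"] M0(2)[OF unit_abs_component[OF u, of 3]] M1(1) M2(1) by linarith
    have "norm (g u) \<le> \<bar>g u $ 1\<bar> + \<bar>g u $ 2\<bar> + \<bar>g u $ 3\<bar>"
      using norm_le_l1_cart[of "g u"] by (simp add: sum_3)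
    thus "norm (g u) \<le> C" unfolding g_nth C_def
      using xq[of "poly (pderiv q) (u $ 3)"] M0(2)[OF unit_abs_component[OF u, of 3]]
        M1(2)[OF unit_abs_component[OF u, of 3]] M2(1) by linarith
    define dx dz where "dx = v $ 1 - u $ 1" "dz = v $ 3 - u $ 3"
    define R where "R = poly q (v $ 3) - poly q (u $ 3) - poly (pderiv q) (u $ 3) * dz"
    have R: "\<bar>R\<bar> \<le> M2 * dz\<^sup>2" unfolding R_def dx_dz_def
      by (rule poly_taylor2[OF M2(2) unit_abs_component[OF u] unit_abs_component[OF v]])
    have "\<bar>dx\<bar> \<le> norm (v - u)" "\<bar>dz\<bar> \<le> norm (v - u)"
      using component_le_norm_cart[of "v - u" 1] component_le_norm_cart[of "v - u" 3] by (simp_all add: dx_dz_def)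
    hence "\<bar>dx\<bar> * \<bar>dz\<bar> \<le> norm (v - u) * norm (v - u)" "\<bar>dz\<bar> * \<bar>dz\<bar> \<le> norm (v - u) * norm (v - u)"
      by (auto intro!: mult_mono simp del: abs_mult_self_eq)
    hence d: "\<bar>dx\<bar> * \<bar>dz\<bar> \<le> (norm (v - u))\<^sup>2" "dz\<^sup>2 \<le> (norm (v - u))\<^sup>2"
      by (simp_all add: power2_eq_square)
    have "harm l 1 v - harm l 1 u - g u \<bullet> (v - u) = dx * dz * poly (pderiv q) (u $ 3) + v $ 1 * R"
      unfolding Y by (simp add: inner_vec_def sum_3 g_nth R_def dx_dz_def algebra_simps)
    hence "\<bar>harm l 1 v - harm l 1 u - g u \<bullet> (v - u)\<bar> \<le> (\<bar>dx\<bar> * \<bar>dz\<bar>) * \<bar>poly (pderiv q) (u $ 3)\<bar> + \<bar>v $ 1\<bar> * \<bar>R\<bar>"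
      by (metis abs_mult abs_triangle_ineq)
    also have "\<dots> \<le> (norm (v - u))\<^sup>2 * M1 + 1 * (M2 * (norm (v - u))\<^sup>2)"
    proof (intro add_mono mult_mono)
      show "\<bar>R\<bar> \<le> M2 * (norm (v - u))\<^sup>2" using R d(2) M2(1) by (meson mult_left_mono order_trans)
    qed (use d M1 unit_abs_component[OF u] unit_abs_component[OF v] in auto)
    also have "\<dots> \<le> C * (norm (v - u))\<^sup>2"
    proof -
      have "(M1 + M2) * (norm (v - u))\<^sup>2 \<le> C * (norm (v - u))\<^sup>2"
        using M0(1) by (intro mult_right_mono) (auto simp: C_def)
      thus ?thesis by (simp add: algebra_simps)
    qed
    finally show "\<bar>harm l 1 v - harm l 1 u - g u \<bullet> (v - u)\<bar> \<le> C * (norm (v - u))\<^sup>2" .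
  qed
  moreover have "C > 0" using M0(1) M1(1) M2(1) by (simp add: C_def)
  ultimately show ?thesis by blast
qed

text \<open>
  If every boundary point has a supporting half-space, the body is the intersection
  of these half-spaces.  The normal is scaled by n(u) \<bullet> u = 1, so that the half-space at u
  cuts the ray through u exactly at the boundary.
\<close>
lemma body_halfspaces_convex:
  assumes n: "\<And>u v. norm u = 1 \<Longrightarrow> norm v = 1 \<Longrightarrow> rad l 1 \<epsilon> v * (n u \<bullet> v) \<le> rad l 1 \<epsilon> u"
    and nu: "\<And>u. norm u = 1 \<Longrightarrow> n u \<bullet> u = 1" and pos: "\<And>u. norm u = 1 \<Longrightarrow> rad l 1 \<epsilon> u > 0"
  shows "convex (body l 1 \<epsilon>)"
proof -
  have "body l 1 \<epsilon> = (\<Inter>u\<in>{u. norm u = 1}. {w. n u \<bullet> w \<le> rad l 1 \<epsilon> u})"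
  proof (intro equalityI subsetI)
    fix w assume "w \<in> body l 1 \<epsilon>"
    then obtain t v where w: "w = t *\<^sub>R v" "norm v = 1" "0 \<le> t" "t \<le> rad l 1 \<epsilon> v"
      unfolding body_eq[OF order_refl] by blast
    have "n u \<bullet> w \<le> rad l 1 \<epsilon> u" if u: "norm u = 1" for u
    proof (cases "n u \<bullet> v \<ge> 0")
      case True
      have "n u \<bullet> w = t * (n u \<bullet> v)" by (simp add: w)
      also have "\<dots> \<le> rad l 1 \<epsilon> v * (n u \<bullet> v)" using w True by (intro mult_right_mono)
      also have "\<dots> \<le> rad l 1 \<epsilon> u" by (rule n[OF u w(2)])
      finally show ?thesis .
    next
      case False
      have "n u \<bullet> w = t * (n u \<bullet> v)" by (simp add: w)
      also have "\<dots> \<le> 0" using w False by (intro mult_nonneg_nonpos) auto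
      finally show ?thesis using pos[OF u] by linarith
    qed
    thus "w \<in> (\<Inter>u\<in>{u. norm u = 1}. {w. n u \<bullet> w \<le> rad l 1 \<epsilon> u})" by blast
  next
    fix w assume w: "w \<in> (\<Inter>u\<in>{u. norm u = 1}. {w. n u \<bullet> w \<le> rad l 1 \<epsilon> u})"
    show "w \<in> body l 1 \<epsilon>"
    proof (cases "w = 0")
      case True
      have "norm (axis 1 1 :: real ^ 3) = 1" by simp
      thus ?thesis unfolding body_eq[OF order_refl] using True pos[of "axis 1 1"]
        by (auto intro!: exI[of _ "0::real"] exI[of _ "axis 1 1 :: real ^ 3"])
    next
      case False
      define u where "u = w /\<^sub>R norm w"
      have u: "norm u = 1" "w = norm w *\<^sub>R u" using False by (auto simp: u_def)
      have "norm w * (n u \<bullet> u) = n u \<bullet> w" using u(2) by (metis inner_scaleR_right)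
      also have "\<dots> \<le> rad l 1 \<epsilon> u" using w u(1) by blast
      finally have "norm w \<le> rad l 1 \<epsilon> u" using nu[OF u(1)] by simp
      thus ?thesis unfolding body_eq[OF order_refl] using u norm_ge_zero[of w] by blast
    qed
  qed
  thus ?thesis by (auto intro!: convex_INT convex_halfspace_le)
qed

text \<open>
  The sphere is curved: the plane touching it at u recedes from v by s = 1 - u \<bullet> v =
  |v - u|^2 / 2.  Tilting the normal by - \<epsilon> / r(u) times the tangential gradient of the harmonic
  makes the half-space touch the body to first order, and what remains is of size
  \<epsilon> |v - u|^2, hence is absorbed by s for small \<epsilon>.
\<close>
lemma convex_body_small:
  "\<exists>\<epsilon>0>0. \<forall>\<epsilon>. 0 < \<epsilon> \<and> \<epsilon> \<le> \<epsilon>0 \<longrightarrow> \<epsilon> \<le> 1 \<and> (\<forall>u. norm u = 1 \<longrightarrow> rad l 1 \<epsilon> u \<ge> 1 / 2) \<and> convex (body l 1 \<epsilon>)"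
proof -
  obtain C g where C: "C > 0" and gC: "\<And>u. norm u = 1 \<Longrightarrow> norm (g u) \<le> C" 
    and YC: "\<And>u. norm u = 1 \<Longrightarrow> \<bar>harm l 1 u\<bar> \<le> C"
    and T: "\<And>u v. norm u = 1 \<Longrightarrow> norm v = 1 \<Longrightarrow> \<bar>harm l 1 v - harm l 1 u - g u \<bullet> (v - u)\<bar> \<le> C * (norm (v - u))\<^sup>2"
    using harm_1_taylor[of l] by blast
  (* The second entry keeps the radius between 1/2 and 3/2.  The third comes from the estimate of main:
     2 C from the Taylor remainder, 3 C from the normal component of the gradient, and 12 C^2 from the
     variation of the radius. *)
  define \<epsilon>0 where "\<epsilon>0 = min 1 (min (1 / (2 * C)) (1 / (2 * (5 * C + 12 * C * C))))"
  have e0: "\<epsilon>0 > 0" using C by (simp add: \<epsilon>0_def add_pos_pos)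
  have "\<epsilon> \<le> 1 \<and> (\<forall>u. norm u = 1 \<longrightarrow> rad l 1 \<epsilon> u \<ge> 1 / 2) \<and> convex (body l 1 \<epsilon>)" if e: "0 < \<epsilon>" "\<epsilon> \<le> \<epsilon>0" for \<epsilon>
  proof -
    have e1: "\<epsilon> \<le> 1" "\<epsilon> \<le> 1 / (2 * C)" "\<epsilon> \<le> 1 / (2 * (5 * C + 12 * C * C))" using e by (auto simp: \<epsilon>0_def)
    have eC: "\<epsilon> * C \<le> 1 / 2" using e1(2) C by (simp add: field_simps)
    have eC2: "\<epsilon> * (5 * C + 12 * C * C) \<le> 1 / 2" 
    proof -
      have p: "5 * C + 12 * C * C > 0" using C by (simp add: add_pos_pos)
      have "\<epsilon> * (5 * C + 12 * C * C) \<le> 1 / (2 * (5 * C + 12 * C * C)) * (5 * C + 12 * C * C)"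
        using e1(3) p by (intro mult_right_mono) auto
      also have "\<dots> = 1 / 2" using p by (simp add: divide_simps)
      finally show ?thesis .
    qed
    have q: "\<bar>\<epsilon> * harm l 1 u\<bar> \<le> 1 / 2" if "norm u = 1" for u
    proof -
      have "\<bar>\<epsilon> * harm l 1 u\<bar> \<le> \<epsilon> * C" unfolding abs_mult using e(1) YC[OF that] by (intro mult_mono) auto
      thus ?thesis using eC by linarith
    qed
    have half: "1 / 2 \<le> rad l 1 \<epsilon> u" "rad l 1 \<epsilon> u \<le> 3 / 2" if "norm u = 1" for u
      using q[OF that] unfolding rad_def by linarith+
    define gt where "gt u = g u - (g u \<bullet> u) *\<^sub>R u" for u
    define n where "n u = u - (\<epsilon> / rad l 1 \<epsilon> u) *\<^sub>R gt u" for u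
    have gtu: "gt u \<bullet> u = 0" if "norm u = 1" for u
      using that by (simp add: gt_def inner_diff_left norm_eq_1)
    have nu: "n u \<bullet> u = 1" if "norm u = 1" for u
      using that gtu[OF that] by (simp add: n_def inner_diff_left norm_eq_1)
    have main: "rad l 1 \<epsilon> v * (n u \<bullet> v) \<le> rad l 1 \<epsilon> u" if u: "norm u = 1" and v: "norm v = 1" for u v
    proof -
      define s d where "s = 1 - u \<bullet> v" "d = v - u"
      define ru rv \<delta> where "ru = rad l 1 \<epsilon> u" "rv = rad l 1 \<epsilon> v" "\<delta> = harm l 1 v - harm l 1 u"
      have r: "1/2 \<le> ru" "ru \<le> 3/2" "1/2 \<le> rv" "rv \<le> 3/2" using half u v by (auto simp: ru_rv_\<delta>_def)
      have uu: "u \<bullet> u = 1" "v \<bullet> v = 1" using u v by (auto simp: norm_eq_1)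
      have d2: "(norm d)\<^sup>2 = 2 * s"
        unfolding power2_norm_eq_inner s_d_def by (simp add: inner_diff inner_commute uu)
      have s0: "0 \<le> s" using d2 zero_le_power2[of "norm d"] by linarith
      define A where "A = g u \<bullet> d"
      define B where "B = g u \<bullet> u"
      have gv: "gt u \<bullet> v = A + B * s"
        by (simp add: gt_def A_def B_def s_d_def inner_diff algebra_simps)
      have nd2: "norm d \<le> 2" using norm_triangle_ineq4[of v u] u v by (simp add: s_d_def)
      have Ab: "\<bar>A\<bar> \<le> C * norm d" unfolding A_def
        using Cauchy_Schwarz_ineq2[of "g u" d] gC[OF u] by (meson mult_right_mono norm_ge_zero order_trans)
      have Bb: "\<bar>B\<bar> \<le> C" unfolding B_def
        using Cauchy_Schwarz_ineq2[of "g u" u] gC[OF u] u by simp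
      have t: "\<bar>\<delta> - A\<bar> \<le> C * (2 * s)" using T[OF u v] unfolding ru_rv_\<delta>_def A_def s_d_def(2)[symmetric] d2 .
      have db: "\<bar>\<delta>\<bar> \<le> 3 * C * norm d"
      proof -
        have "C * (2 * s) = C * (norm d * norm d)" using d2 by (simp add: power2_eq_square)
        also have "\<dots> \<le> C * (2 * norm d)" using C nd2 by (intro mult_left_mono mult_right_mono) auto
        finally have "C * (2 * s) \<le> 2 * (C * norm d)" by simp
        thus ?thesis using t Ab by (simp add: mult.assoc)
      qed
      have nv: "n u \<bullet> v = 1 - s - \<epsilon> / ru * (A + B * s)"
        by (simp add: n_def inner_diff_left gv ru_rv_\<delta>_def s_d_def)
      have rvu: "rv = ru + \<epsilon> * \<delta>" by (simp add: ru_rv_\<delta>_def rad_def algebra_simps)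
      have "rv * (n u \<bullet> v) - ru = \<epsilon> * (\<delta> - A) - s * rv - \<epsilon> * (rv / ru) * (B * s) - \<epsilon> * \<epsilon> / ru * (A * \<delta>)"
      proof -
        have "\<epsilon> * (rv / ru) * A = \<epsilon> * A + \<epsilon> * \<epsilon> / ru * (A * \<delta>)" unfolding rvu using r(1) by (simp add: field_simps)
        moreover have "rv * (n u \<bullet> v) = rv - rv * s - \<epsilon> * (rv / ru) * A - \<epsilon> * (rv / ru) * (B * s)"
          unfolding nv by (simp add: algebra_simps)
        moreover have "rv - ru = \<epsilon> * \<delta>" using rvu by simp
        ultimately show ?thesis by (simp add: algebra_simps)
      qed
      also have "\<dots> \<le> \<epsilon> * (C * (2 * s)) - s * (1/2) + \<epsilon> * (3 * (C * s)) + \<epsilon> * (12 * C * C * s)"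
      proof -
        have 1: "\<epsilon> * (\<delta> - A) \<le> \<epsilon> * (C * (2 * s))" using t e(1) by (intro mult_left_mono) auto
        have 2: "s * (1/2) \<le> s * rv" using s0 r by (intro mult_left_mono) auto
        have rr: "rv / ru \<le> 3" "0 \<le> rv / ru" using r by (auto simp: field_simps)
        have "\<bar>\<epsilon> * x * (B * s)\<bar> = \<epsilon> * (x * (\<bar>B\<bar> * s))" if "0 \<le> x" for x
          using e(1) s0 that by (simp add: abs_mult)
        from this[OF rr(2)] have "\<bar>\<epsilon> * (rv / ru) * (B * s)\<bar> = \<epsilon> * ((rv / ru) * (\<bar>B\<bar> * s))" .
        also have "\<dots> \<le> \<epsilon> * (3 * (C * s))"
          using e(1) rr s0 Bb C by (intro mult_left_mono mult_mono mult_right_mono) auto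
        finally have 3: "- (\<epsilon> * (rv / ru) * (B * s)) \<le> \<epsilon> * (3 * (C * s))" by linarith
        have "\<bar>A * \<delta>\<bar> \<le> (C * norm d) * (3 * C * norm d)"
          unfolding abs_mult using Ab db C by (intro mult_mono) auto
        also have "\<dots> = 3 * C * C * (norm d)\<^sup>2" by (simp add: power2_eq_square)
        also have "\<dots> = 6 * C * C * s" unfolding d2 by simp
        finally have Ad: "\<bar>A * \<delta>\<bar> \<le> 6 * C * C * s" .
        have "\<epsilon> / ru \<le> 2" 
        proof -
          have "\<epsilon> \<le> 2 * ru" using e1(1) r(1) by linarith
          thus ?thesis using r(1) by (simp add: divide_le_eq)
        qed
        hence "\<bar>\<epsilon> * \<epsilon> / ru * (A * \<delta>)\<bar> \<le> \<epsilon> * (2 * (6 * C * C * s))"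
        proof -
          have "\<bar>\<epsilon> * \<epsilon> / ru * (A * \<delta>)\<bar> = \<epsilon> * ((\<epsilon> / ru) * \<bar>A * \<delta>\<bar>)"
            using e(1) r(1) by (simp add: abs_mult)
          also have "\<dots> \<le> \<epsilon> * (2 * (6 * C * C * s))"
            using \<open>\<epsilon> / ru \<le> 2\<close> Ad e(1) r(1) by (intro mult_left_mono mult_mono) auto
          finally show ?thesis .
        qed
        moreover have "2 * (6 * C * C * s) = 12 * C * C * s" by simp
        ultimately have 4: "- (\<epsilon> * \<epsilon> / ru * (A * \<delta>)) \<le> \<epsilon> * (12 * C * C * s)"
          by (metis abs_ge_minus_self order_trans)
        show ?thesis using 1 2 3 4 by linarith
      qed
      also have "\<dots> = s * (\<epsilon> * (5 * C + 12 * C * C) - 1/2)" by (simp add: algebra_simps)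
      also have "\<dots> \<le> 0" using s0 eC2 by (intro mult_nonneg_nonpos) auto
      finally show ?thesis unfolding ru_rv_\<delta>_def by linarith
    qed
    have pos: "rad l 1 \<epsilon> u > 0" if "norm u = 1" for u using half(1)[OF that] by linarith
    have "convex (body l 1 \<epsilon>)"
      by (rule body_halfspaces_convex[where n = n]) (use main nu pos in auto)
    thus ?thesis using e1(1) half(1) by blast
  qed
  thus ?thesis using e0 by blast
qed

section \<open>Equilibrium classes\<close>

lemma sphere_max_order_eq:
  assumes "\<And>u v. norm u = 1 \<Longrightarrow> norm v = 1 \<Longrightarrow> f u \<le> f v \<longleftrightarrow> g u \<le> g v"
  shows "sphere_max f = sphere_max g"
proof (rule set_eqI)
  fix v
  show "v \<in> sphere_max f \<longleftrightarrow> v \<in> sphere_max g"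
  proof (cases "v \<in> sphere 0 1")
    case True thus ?thesis using assms by (intro sphere_max_cong) auto
  qed (simp add: sphere_max_def)
qed

lemma card_sphere_min_harm:
  assumes "1 \<le> m" "m \<le> l"
  shows "card (sphere_max (\<lambda>u. - harm l m u)) = m * (l - m + 1)"
proof -
  have "card (sphere_max (\<lambda>u. harm l m (rotz (pi / m) u))) = card (sphere_max (harm l m))"
    by (rule sphere_max_isometry[OF orthogonal_rotz])
  thus ?thesis unfolding harm_rotz(1)[OF assms(1)] card_sphere_max_harm[OF assms] .
qed

lemma convex_rangeD:
  assumes "\<epsilon> \<in> convex_range l m" "1 \<le> m"
  shows "\<epsilon> > 0" "\<And>u. norm u = 1 \<Longrightarrow> rad l m \<epsilon> u > 0"
  using assms radius_eq[OF _ assms(2)] by (force simp: convex_range_def)+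

text \<open>
  The centroid is the origin, so the squared distance is r^2, and it has the same local
  extrema as the harmonic, whatever the amplitude.
\<close>
lemma equilibrium_class_m_ge_2:
  assumes m: "2 \<le> m" "m \<le> l" and e: "\<epsilon> \<in> convex_range l m"
  shows "equilibrium_class l m \<epsilon> = (m * (l - m + 1), m * (l - m + 1))"
proof -
  have m1: "1 \<le> m" using m by simp
  note er = convex_rangeD[OF e m1]
  have c: "centroid (body l m \<epsilon>) = 0" by (rule centroid_zero[OF m(1)]) (rule er(2))
  have sq: "sq_dist l m \<epsilon> v = (rad l m \<epsilon> v)\<^sup>2" if "norm v = 1" for v
    unfolding sq_dist_def c radius_eq[OF that m1] using that by simp
  have diff: "(\<lambda>v. (rad l m \<epsilon> v)\<^sup>2) differentiable (at v)" for v
    unfolding rad_def power2_eq_square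
    by (intro differentiable_mult differentiable_add differentiable_const harm_differentiable[OF m1])
  have ord: "sq_dist l m \<epsilon> u \<le> sq_dist l m \<epsilon> v \<longleftrightarrow> harm l m u \<le> harm l m v" if "norm u = 1" "norm v = 1" for u v
  proof -
    have "(rad l m \<epsilon> u)\<^sup>2 \<le> (rad l m \<epsilon> v)\<^sup>2 \<longleftrightarrow> rad l m \<epsilon> u \<le> rad l m \<epsilon> v"
      using er(2)[OF that(1)] er(2)[OF that(2)] by (intro power_mono_iff) auto
    thus ?thesis using sq that er(1) by (simp add: rad_def)
  qed
  have "sphere_max (sq_dist l m \<epsilon>) = sphere_max (harm l m)"
    by (rule sphere_max_order_eq) (rule ord)
  moreover have "sphere_max (\<lambda>u. - sq_dist l m \<epsilon> u) = sphere_max (\<lambda>u. - harm l m u)"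
    by (rule sphere_max_order_eq) (simp add: ord)
  moreover have "unstable_equilibria l m \<epsilon> = sphere_max (sq_dist l m \<epsilon>)"
      "stable_equilibria l m \<epsilon> = sphere_max (\<lambda>u. - sq_dist l m \<epsilon> u)"
    using sq by (intro unstable_equilibria_eq[OF diff] stable_equilibria_eq[OF diff]; simp)+
  ultimately show ?thesis unfolding equilibrium_class_def
    by (simp add: card_sphere_max_harm[OF m1 m(2)] card_sphere_min_harm[OF m1 m(2)])
qed

text \<open>
  Local minima become local maxima of a function of the same family.
\<close>
lemma pharm_flipx: "pharm l a (- b) (- c) (flipx u) = - pharm l a b c u"
  by (simp add: pharm_def quad_coeff_def algebra_simps)

text \<open>
  The centroid is (k, 0, 0) with k of order \<epsilon>^2, so the three parameters of the
  perturbed harmonic are at most of order \<epsilon>.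
\<close>
lemma equilibrium_class_m_1:
  assumes l: "2 \<le> l"
  shows "\<forall>\<^sub>F \<epsilon> in at_right 0. \<epsilon> \<in> convex_range l 1 \<and> equilibrium_class l 1 \<epsilon> = (l, l)"
proof -
  have l1: "1 \<le> l" using l by simp
  obtain \<delta> where d: "\<delta> > 0" "\<And>a b c. \<bar>a\<bar> \<le> \<delta> \<Longrightarrow> \<bar>b\<bar> \<le> \<delta> \<Longrightarrow> \<bar>c\<bar> \<le> \<delta> \<Longrightarrow> nondegenerate l a b c"
    using small_perturbation_nondegenerate[OF l1] by blast
  obtain \<epsilon>0 where e0: "\<epsilon>0 > 0" and small: "\<And>\<epsilon>. 0 < \<epsilon> \<Longrightarrow> \<epsilon> \<le> \<epsilon>0 \<Longrightarrow> 
      \<epsilon> \<le> 1 \<and> (\<forall>u. norm u = 1 \<longrightarrow> rad l 1 \<epsilon> u \<ge> 1 / 2) \<and> convex (body l 1 \<epsilon>)"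
    using convex_body_small by blast
  obtain C where C: "\<And>\<epsilon>. 0 < \<epsilon> \<Longrightarrow> \<epsilon> \<le> 1 \<Longrightarrow> (\<forall>u. norm u = 1 \<longrightarrow> rad l 1 \<epsilon> u \<ge> 1 / 2) \<Longrightarrow>
     \<bar>centroid (body l 1 \<epsilon>) $ 1\<bar> \<le> C * \<epsilon>\<^sup>2"
    using centroid_second_order[OF l] by blast
  (* Adding 1 makes K positive and lets \<epsilon> K bound \<epsilon> / 2 as well. *)
  define K where "K = \<bar>C\<bar> + 1"
  have "\<epsilon> \<in> convex_range l 1 \<and> equilibrium_class l 1 \<epsilon> = (l, l)"
    if e: "0 < \<epsilon>" "\<epsilon> < min \<epsilon>0 (\<delta> / K)" for \<epsilon>
  proof -
    have e': "\<epsilon> \<le> \<epsilon>0" "\<epsilon> < \<delta> / K" using e by auto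
    have e1: "\<epsilon> \<le> 1" and half: "\<forall>u. norm u = 1 \<longrightarrow> rad l 1 \<epsilon> u \<ge> 1 / 2" and cvx: "convex (body l 1 \<epsilon>)"
      using small[OF e(1) e'(1)] by auto
    have pos: "rad l 1 \<epsilon> u > 0" if "norm u = 1" for u using half that by fastforce
    have eK: "\<epsilon> * K < \<delta>" using e'(2) by (simp add: K_def field_simps)
    have range: "\<epsilon> \<in> convex_range l 1"
      unfolding convex_range_def using e(1) cvx pos radius_eq[of _ 1 l \<epsilon>] by simp
    define k where "k = centroid (body l 1 \<epsilon>)"
    have k3: "k $ 3 = 0" unfolding k_def by (rule centroid_z[OF order_refl]) (rule pos)
    have k2: "k $ 2 = 0" unfolding k_def by (rule centroid_y) (rule pos)
    have k1: "\<bar>k $ 1\<bar> \<le> \<epsilon> * (\<epsilon> * K)"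
    proof -
      have "\<bar>k $ 1\<bar> \<le> C * \<epsilon>\<^sup>2" unfolding k_def by (rule C[OF e(1) e1 half])
      also have "\<dots> \<le> K * \<epsilon>\<^sup>2" by (intro mult_right_mono) (auto simp: K_def)
      finally show ?thesis by (simp add: power2_eq_square mult_ac)
    qed
    define a b c where "a = k $ 1 / \<epsilon>" "b = \<epsilon> / 2" "c = k $ 1"
    have "\<bar>a\<bar> \<le> \<epsilon> * K" using k1 e(1) by (simp add: a_b_c_def abs_divide field_simps)
    moreover have "\<bar>b\<bar> \<le> \<epsilon> * K"
    proof -
      have "\<epsilon> * 1 \<le> \<epsilon> * K" using e(1) by (intro mult_left_mono) (auto simp: K_def)
      thus ?thesis using e(1) by (simp add: a_b_c_def)
    qed
    moreover have "\<bar>c\<bar> \<le> \<epsilon> * K"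
    proof -
      have "\<epsilon> * (\<epsilon> * K) \<le> 1 * (\<epsilon> * K)" using e(1) e1 by (intro mult_right_mono) (auto simp: K_def)
      thus ?thesis using k1 by (simp add: a_b_c_def)
    qed
    ultimately have abc: "\<bar>a\<bar> \<le> \<delta>" "\<bar>b\<bar> \<le> \<delta>" "\<bar>c\<bar> \<le> \<delta>" using eK by linarith+
    have nondegenerate: "nondegenerate l a b c" "nondegenerate l a (- b) (- c)" using abc by (auto intro!: d(2))
    have sq: "sq_dist l 1 \<epsilon> u = 1 + c\<^sup>2 + 2 * \<epsilon> * pharm l a b c u" if u: "norm u = 1" for u
    proof -
      define \<rho> where "\<rho> = rad l 1 \<epsilon> u"
      have n: "(u $ 1)\<^sup>2 + (u $ 2)\<^sup>2 + (u $ 3)\<^sup>2 = 1" using u by (simp add: norm_eq_1_vec3)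
      have "sq_dist l 1 \<epsilon> u = (norm (\<rho> *\<^sub>R u - k))\<^sup>2"
        unfolding sq_dist_def radius_eq[OF u order_refl] \<rho>_def k_def ..
      also have "\<dots> = (\<rho> * u $ 1 - c)\<^sup>2 + (\<rho> * u $ 2)\<^sup>2 + (\<rho> * u $ 3)\<^sup>2"
        unfolding norm_sq_vec3 by (simp add: k2 k3 a_b_c_def)
      also have "\<dots> = \<rho>\<^sup>2 * ((u $ 1)\<^sup>2 + (u $ 2)\<^sup>2 + (u $ 3)\<^sup>2) - 2 * \<rho> * u $ 1 * c + c\<^sup>2"
        by (simp add: power2_eq_square algebra_simps)
      also have "\<dots> = \<rho>\<^sup>2 - 2 * \<rho> * u $ 1 * c + c\<^sup>2" unfolding n by simp
      also have "\<rho> = 1 + \<epsilon> * (poly (dleg l 1) (u $ 3) * u $ 1)" by (simp add: \<rho>_def rad_def harm_def)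
      also have "(1 + \<epsilon> * (poly (dleg l 1) (u $ 3) * u $ 1))\<^sup>2 - 2 * (1 + \<epsilon> * (poly (dleg l 1) (u $ 3) * u $ 1)) * u $ 1 * c + c\<^sup>2
          = 1 + c\<^sup>2 + 2 * \<epsilon> * pharm l a b c u"
      proof -
        have "\<epsilon> * a = c" using e(1) by (simp add: a_b_c_def)
        have "2 * \<epsilon> * pharm l a b c u = 2 * u $ 1 * (\<epsilon> * poly (dleg l 1) (u $ 3) - \<epsilon> * a) +
            (u $ 1)\<^sup>2 * (\<epsilon> * (2 * b) * (poly (dleg l 1) (u $ 3))\<^sup>2 - 2 * \<epsilon> * c * poly (dleg l 1) (u $ 3))"
          by (simp add: pharm_def quad_coeff_def power2_eq_square algebra_simps)
        also have "2 * b = \<epsilon>" by (simp add: a_b_c_def)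
        finally show ?thesis unfolding \<open>\<epsilon> * a = c\<close> by (simp add: power2_eq_square algebra_simps)
      qed
      finally show ?thesis .
    qed
    have diff: "(\<lambda>u. 1 + c\<^sup>2 + 2 * \<epsilon> * pharm l a b c u) differentiable (at u)" for u
      by (intro differentiable_add differentiable_mult differentiable_const pharm_differentiable)
    have ord: "sq_dist l 1 \<epsilon> u \<le> sq_dist l 1 \<epsilon> v \<longleftrightarrow> pharm l a b c u \<le> pharm l a b c v" if "norm u = 1" "norm v = 1" for u v
      using sq that e(1) by simp
    have "sphere_max (sq_dist l 1 \<epsilon>) = sphere_max (pharm l a b c)"
      by (rule sphere_max_order_eq) (rule ord)
    hence max: "card (sphere_max (sq_dist l 1 \<epsilon>)) = l" using card_sphere_max_pharm[OF l1 nondegenerate(1)] by simp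
    have "sphere_max (\<lambda>u. - sq_dist l 1 \<epsilon> u) = sphere_max (\<lambda>u. - pharm l a b c u)"
      by (rule sphere_max_order_eq) (simp only: neg_le_iff_le ord)
    also have "card \<dots> = card (sphere_max (pharm l a (- b) (- c)))"
      using sphere_max_isometry[OF orthogonal_flips(3), of "pharm l a (- b) (- c)"] unfolding pharm_flipx .
    finally have min: "card (sphere_max (\<lambda>u. - sq_dist l 1 \<epsilon> u)) = l"
      using card_sphere_max_pharm[OF l1 nondegenerate(2)] by simp
    have "unstable_equilibria l 1 \<epsilon> = sphere_max (sq_dist l 1 \<epsilon>)"
      using sq by (intro unstable_equilibria_eq[OF diff]) simp
    moreover have "stable_equilibria l 1 \<epsilon> = sphere_max (\<lambda>u. - sq_dist l 1 \<epsilon> u)"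
      using sq by (intro stable_equilibria_eq[OF diff]) simp
    ultimately have "equilibrium_class l 1 \<epsilon> = (l, l)"
      unfolding equilibrium_class_def using max min by simp
    thus ?thesis using range by blast
  qed
  moreover have "min \<epsilon>0 (\<delta> / K) > 0" using e0 d(1) by (simp add: K_def)
  ultimately show ?thesis unfolding eventually_at_right_field by blast
qed

lemma realizes_m_1: "n \<ge> 2 \<Longrightarrow> realizes n 1 (n, n)"
  using equilibrium_class_m_1 by (simp add: realizes_def)

lemma values_eq: "{m * (l - m + 1) | l m :: nat. 2 \<le> l \<and> 1 \<le> m \<and> m \<le> l} = {2..}"
proof (intro equalityI subsetI)
  fix n assume "n \<in> {m * (l - m + 1) | l m :: nat. 2 \<le> l \<and> 1 \<le> m \<and> m \<le> l}"
  then obtain l m where n: "n = m * (l - m + 1)" "2 \<le> l" "1 \<le> m" "m \<le> l" by blast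
  show "n \<in> {2..}"
  proof (cases "m = 1")
    case False
    hence "2 * 1 \<le> m * (l - m + 1)" using n by (intro mult_le_mono) auto
    thus ?thesis using n(1) by simp
  qed (use n in auto)
next
  fix n :: nat assume "n \<in> {2..}"
  hence "n = 1 * (n - 1 + 1) \<and> 2 \<le> n \<and> 1 \<le> (1::nat) \<and> 1 \<le> n" by auto
  thus "n \<in> {m * (l - m + 1) | l m :: nat. 2 \<le> l \<and> 1 \<le> m \<and> m \<le> l}" by blast
qed

theorem corollary1:
  shows "(\<forall>l m. 2 \<le> l \<and> 1 \<le> m \<and> m \<le> l \<longrightarrow>
            (2 \<le> m \<longrightarrow> (\<forall>\<epsilon>\<in>convex_range l m.
               equilibrium_class l m \<epsilon> = (m * (l - m + 1), m * (l - m + 1)))) \<and>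
            (m = 1 \<longrightarrow> (\<forall>\<^sub>F \<epsilon> in at_right 0. \<epsilon> \<in> convex_range l m \<and>
               equilibrium_class l m \<epsilon> = (m * (l - m + 1), m * (l - m + 1)))))
       \<and> reachable_classes = (\<lambda>n. (n, n)) ` {m * (l - m + 1) | l m. 2 \<le> l \<and> 1 \<le> m \<and> m \<le> l}
       \<and> {m * (l - m + 1) | l m :: nat. 2 \<le> l \<and> 1 \<le> m \<and> m \<le> l} = {2..}
       \<and> (\<forall>n\<ge>2. realizes n 1 (n, n))"
proof (intro conjI allI impI ballI)
  fix l m :: nat assume lm: "2 \<le> l \<and> 1 \<le> m \<and> m \<le> l"
  show "equilibrium_class l m \<epsilon> = (m * (l - m + 1), m * (l - m + 1))" if "2 \<le> m" "\<epsilon> \<in> convex_range l m" for \<epsilon>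
    using equilibrium_class_m_ge_2 that lm by blast
  show "\<forall>\<^sub>F \<epsilon> in at_right 0. \<epsilon> \<in> convex_range l m \<and>
               equilibrium_class l m \<epsilon> = (m * (l - m + 1), m * (l - m + 1))" if "m = 1"
    using equilibrium_class_m_1[of l] lm that by simp
next
  show "reachable_classes = (\<lambda>n. (n, n)) ` {m * (l - m + 1) | l m. 2 \<le> l \<and> 1 \<le> m \<and> m \<le> l}"
  proof (intro equalityI subsetI)
    fix c assume "c \<in> reachable_classes"
    then obtain l m where lm: "2 \<le> l" "1 \<le> m" "m \<le> l" "realizes l m c" by (auto simp: reachable_classes_def)
    have "c = (m * (l - m + 1), m * (l - m + 1))"
    proof (cases "m = 1")
      case True
      have "\<forall>\<^sub>F \<epsilon> in at_right (0::real). equilibrium_class l 1 \<epsilon> = c \<and> equilibrium_class l 1 \<epsilon> = (l, l)"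
        using lm(4) equilibrium_class_m_1[OF lm(1)] True unfolding realizes_def by (auto elim: eventually_elim2)
      from eventually_happens'[OF _ this] have "c = (l, l)" by auto
      thus ?thesis using True lm by simp
    next
      case False
      then obtain \<epsilon> where "\<epsilon> \<in> convex_range l m" "equilibrium_class l m \<epsilon> = c"
        using lm(4) by (auto simp: realizes_def)
      thus ?thesis using equilibrium_class_m_ge_2[of m l \<epsilon>] False lm by simp
    qed
    thus "c \<in> (\<lambda>n. (n, n)) ` {m * (l - m + 1) | l m. 2 \<le> l \<and> 1 \<le> m \<and> m \<le> l}" using lm by blast
  next
    fix c assume "c \<in> (\<lambda>n. (n, n)) ` {m * (l - m + 1) | l m :: nat. 2 \<le> l \<and> 1 \<le> m \<and> m \<le> l}"
    then obtain n where n: "c = (n, n)" "2 \<le> n" unfolding values_eq by auto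
    have "2 \<le> n \<and> (1::nat) \<le> 1 \<and> 1 \<le> n \<and> realizes n 1 c" using n realizes_m_1 by simp
    thus "c \<in> reachable_classes" unfolding reachable_classes_def by blast
  qed
next
  show "{m * (l - m + 1) | l m :: nat. 2 \<le> l \<and> 1 \<le> m \<and> m \<le> l} = {2..}" by (rule values_eq)
qed (rule realizes_m_1)

end
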